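(* Let $\alpha>0$ and let $X=(X_t)_{t\in\mathbb{R}}$ be a two-sided real-valued Lévy process which is not a deterministic linear drift and which satisfies $\mathbb{E}[|X_1|]<\infty$ and $|\mathbb{E}[X_1]|<\alpha$. Let $M$ be the $\alpha$-Lipschitz minorant of $X$, $\mathcal{Z}=\{t\in\mathbb{R}:M_t=X_t\wedge X_{t-}\}$ and $D=\inf(\mathcal{Z}\cap(0,\infty))$. Set $I^-=\inf\{X_u-\alpha u:u\le0\}$. Consider independent random objects: a random variable $\Gamma$ with the same distribution as $I^-$, and two independent copies $(X'_t)_{t\ge0}$ and $(X''_t)_{t\ge0}$ of $(X_t)_{t\ge0}$. Put $$T'_\Gamma=\inf\{t\ge0:X'_t\wedge X'_{t-}-\alpha t\le\Gamma\},\qquad \tilde T''=\inf\{t\ge0:X''_t\wedge X''_{t-}+\alpha t=\inf\{X''_u+\alpha u:u\ge0\}\},$$ and define $$Z_t=\begin{cases}X'_t,&0\le t\le T'_\Gamma,\\ X''_{t-T'_\Gamma}+X'_{T'_\Gamma},&T'_\Gamma\le t\le T'_\Gamma+\tilde T'',\\ \partial,&t>T'_\Gamma+\tilde T''.\end{cases}$$ Then $(X_t,\,0\le t\le D)$ and $(Z_t,\,0\le t\le T'_\Gamma+\tilde T'')$ have the same distribution.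
   Context: A two-sided Lévy process is a real-valued process indexed by $\mathbb{R}$ with càdlàg paths, stationary independent increments and value $0$ at time $0$. "Not a deterministic linear drift" means that there is no $a\in\mathbb{R}$ with $X_t=at$ for all $t$. The conditions $\mathbb{E}[|X_1|]<\infty$, $|\mathbb{E}[X_1]|<\alpha$ ensure that almost surely the path of $X$ has an $\alpha$-Lipschitz minorant $M$, the greatest function with $M\le X$ and $|M_s-M_t|\le\alpha|s-t|$ for all $s,t$; explicitly $M_t=\inf\{X_s+\alpha|t-s|:s\in\mathbb{R}\}$. $\partial$ is an isolated cemetery state. Equality in distribution of path segments on random intervals is understood as equality in distribution of the processes indexed by $t\ge0$ that are sent to $\partial$ after the end of the segment. Convention: $X'_{0-}=X''_{0-}=0$. *)

theory Defs
  imports "HOL-Probability.Probability"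
begin

section \<open>Two-sided Levy processes\<close>

text \<open>For \<open>S = {0..}\<close> the left-limit condition at \<open>0\<close> is void, the filter being trivial there.\<close>

definition cadlag_on :: "real set \<Rightarrow> (real \<Rightarrow> real) \<Rightarrow> bool" where
  "cadlag_on S f \<longleftrightarrow>
     (\<forall>t\<in>S. continuous (at t within S \<inter> {t..}) f \<and>
            (\<exists>l. (f \<longlongrightarrow> l) (at t within S \<inter> {..<t})))"

text \<open>Path regularity and the value at time \<open>0\<close> are required surely, i.e.\ on all of \<open>space M\<close>;
  the measure space need not be complete.\<close>

locale two_sided_levy = prob_space M for M :: "'a measure" +
  fixes X :: "real \<Rightarrow> 'a \<Rightarrow> real"
  assumes random_variable_X: "\<And>t. X t \<in> borel_measurable M"
    and cadlag_X: "\<And>\<omega>. \<omega> \<in> space M \<Longrightarrow> cadlag_on UNIV (\<lambda>t. X t \<omega>)"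
    and X_zero: "\<And>\<omega>. \<omega> \<in> space M \<Longrightarrow> X 0 \<omega> = 0"
    and stationary_increments:
      "\<And>s t. s \<le> t \<Longrightarrow> distr M borel (\<lambda>\<omega>. X t \<omega> - X s \<omega>) = distr M borel (X (t - s))"
    and independent_increments:
      "\<And>(n::nat) \<tau>. strict_mono_on {..n} \<tau> \<Longrightarrow>
         indep_vars (\<lambda>_. borel) (\<lambda>i \<omega>. X (\<tau> (Suc i)) \<omega> - X (\<tau> i) \<omega>) {..<n}"

definition linear_drift :: "'a measure \<Rightarrow> (real \<Rightarrow> 'a \<Rightarrow> real) \<Rightarrow> bool" where
  "linear_drift M X \<longleftrightarrow> (\<exists>a. AE \<omega> in M. \<forall>t. X t \<omega> = a * t)"


section \<open>Functionals of a path\<close>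

text \<open>Infima are taken in \<^typ>\<open>ereal\<close>, so that they are meaningful on every path: an infimum over
  the empty set is \<open>\<infinity>\<close>, and an infimum of a set unbounded below is \<open>-\<infinity>\<close>.\<close>

definition lipschitz_minorant :: "real \<Rightarrow> (real \<Rightarrow> real) \<Rightarrow> real \<Rightarrow> ereal" where
  "lipschitz_minorant \<alpha> f t = (INF s. ereal (f s + \<alpha> * \<bar>t - s\<bar>))"

text \<open>Whenever \<open>f\<close> has some \<open>\<alpha>\<close>-Lipschitz minorant, this is the greatest one.\<close>

definition is_lipschitz_below :: "real \<Rightarrow> (real \<Rightarrow> real) \<Rightarrow> (real \<Rightarrow> real) \<Rightarrow> bool" where
  "is_lipschitz_below \<alpha> f m \<longleftrightarrow>
     (\<forall>t. m t \<le> f t) \<and> (\<forall>s t. \<bar>m s - m t\<bar> \<le> \<alpha> * \<bar>s - t\<bar>)"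

lemma lipschitz_minorant_upper:
  assumes "is_lipschitz_below \<alpha> f m"
  shows "ereal (m t) \<le> lipschitz_minorant \<alpha> f t"
  unfolding lipschitz_minorant_def
proof (rule INF_greatest)
  fix s
  have "m s \<le> f s" "\<bar>m t - m s\<bar> \<le> \<alpha> * \<bar>t - s\<bar>"
    using assms by (auto simp: is_lipschitz_below_def)
  then show "ereal (m t) \<le> ereal (f s + \<alpha> * \<bar>t - s\<bar>)" by simp
qed

lemma lipschitz_minorant_greatest:
  assumes "0 \<le> \<alpha>" and "is_lipschitz_below \<alpha> f m0"
  shows "\<exists>m. (\<forall>t. lipschitz_minorant \<alpha> f t = ereal (m t)) \<and> is_lipschitz_below \<alpha> f m
           \<and> (\<forall>m'. is_lipschitz_below \<alpha> f m' \<longrightarrow> (\<forall>t. m' t \<le> m t))"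
proof -
  define m where "m t = real_of_ereal (lipschitz_minorant \<alpha> f t)" for t
  have up: "lipschitz_minorant \<alpha> f t \<le> ereal (f s + \<alpha> * \<bar>t - s\<bar>)" for s t
    unfolding lipschitz_minorant_def by (rule INF_lower) simp
  have m: "lipschitz_minorant \<alpha> f t = ereal (m t)" for t
    using lipschitz_minorant_upper[OF assms(2), of t] up[of t t]
    unfolding m_def by (cases "lipschitz_minorant \<alpha> f t") auto
  have half: "m t - \<alpha> * \<bar>s - t\<bar> \<le> m s" for s t
  proof -
    have "ereal (m t - \<alpha> * \<bar>s - t\<bar>) \<le> lipschitz_minorant \<alpha> f s"
      unfolding lipschitz_minorant_def
    proof (rule INF_greatest)
      fix u
      have "m t \<le> f u + \<alpha> * \<bar>t - u\<bar>" using up[of t u] m by simp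
      moreover have "\<alpha> * \<bar>t - u\<bar> \<le> \<alpha> * (\<bar>s - t\<bar> + \<bar>s - u\<bar>)"
        by (rule mult_left_mono) (use assms(1) in auto)
      ultimately show "ereal (m t - \<alpha> * \<bar>s - t\<bar>) \<le> ereal (f u + \<alpha> * \<bar>s - u\<bar>)"
        by (simp add: distrib_left)
    qed
    then show ?thesis using m by simp
  qed
  have "is_lipschitz_below \<alpha> f m"
    unfolding is_lipschitz_below_def
  proof (intro conjI allI)
    show "m t \<le> f t" for t using up[of t t] m by simp
    show "\<bar>m s - m t\<bar> \<le> \<alpha> * \<bar>s - t\<bar>" for s t
      using half[of t s] half[of s t] by (simp add: abs_minus_commute)
  qed
  moreover have "m' t \<le> m t" if "is_lipschitz_below \<alpha> f m'" for m' t
    using lipschitz_minorant_upper[OF that, of t] m by simp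
  ultimately show ?thesis using m by blast
qed

definition contact_set :: "real \<Rightarrow> (real \<Rightarrow> real) \<Rightarrow> real set" where
  "contact_set \<alpha> f =
     {t. lipschitz_minorant \<alpha> f t = ereal (min (f t) (Lim (at_left t) f))}"

definition D_time :: "real \<Rightarrow> (real \<Rightarrow> real) \<Rightarrow> ereal" where
  "D_time \<alpha> f = Inf (ereal ` (contact_set \<alpha> f \<inter> {0<..}))"

definition I_minus :: "real \<Rightarrow> (real \<Rightarrow> real) \<Rightarrow> ereal" where
  "I_minus \<alpha> f = (INF u\<in>{..0}. ereal (f u - \<alpha> * u))"

text \<open>Paths on \<open>[0,\<infinity>)\<close> have left limit \<open>0\<close> at time \<open>0\<close>, by convention.\<close>

definition left_lim0 :: "(real \<Rightarrow> real) \<Rightarrow> real \<Rightarrow> real" where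
  "left_lim0 f t = (if t = 0 then 0 else Lim (at_left t) f)"

definition T_hit :: "real \<Rightarrow> (real \<Rightarrow> real) \<Rightarrow> real \<Rightarrow> ereal" where
  "T_hit \<alpha> f \<gamma> = Inf (ereal ` {t. 0 \<le> t \<and> min (f t) (left_lim0 f t) - \<alpha> * t \<le> \<gamma>})"

definition T_min :: "real \<Rightarrow> (real \<Rightarrow> real) \<Rightarrow> ereal" where
  "T_min \<alpha> f = Inf (ereal ` {t. 0 \<le> t \<and>
     ereal (min (f t) (left_lim0 f t) + \<alpha> * t) = (INF u\<in>{0..}. ereal (f u + \<alpha> * u))})"

text \<open>The cemetery state is \<^const>\<open>None\<close>.\<close>

definition killed_after :: "ereal \<Rightarrow> (real \<Rightarrow> real) \<Rightarrow> real \<Rightarrow> real option" where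
  "killed_after T f t = (if ereal t \<le> T then Some (f t) else None)"

definition Z_path ::
  "real \<Rightarrow> real \<Rightarrow> (real \<Rightarrow> real) \<Rightarrow> (real \<Rightarrow> real) \<Rightarrow> real \<Rightarrow> real option" where
  "Z_path \<alpha> \<gamma> f g t =
     (let T = T_hit \<alpha> f \<gamma> in
      if ereal t \<le> T then Some (f t)
      else if ereal t \<le> T + T_min \<alpha> g
           then Some (g (t - real_of_ereal T) + f (real_of_ereal T))
      else None)"


section \<open>Laws and independence\<close>

text \<open>The Borel sets of the disjoint union of the real line and an isolated point.\<close>

definition borel_cemetery :: "real option measure" where
  "borel_cemetery = sigma UNIV ((`) Some ` sets borel)"

abbreviation path_space :: "(real \<Rightarrow> real) measure" where
  "path_space \<equiv> Pi\<^sub>M {0..} (\<lambda>_. borel)"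

abbreviation killed_path_space :: "(real \<Rightarrow> real option) measure" where
  "killed_path_space \<equiv> Pi\<^sub>M {0..} (\<lambda>_. borel_cemetery)"

text \<open>Measurability is part of the notion, since \<^const>\<open>distr\<close> is only meaningful for
  measurable maps.\<close>

definition same_law ::
  "'c measure \<Rightarrow> 'a measure \<Rightarrow> ('a \<Rightarrow> 'c) \<Rightarrow> 'b measure \<Rightarrow> ('b \<Rightarrow> 'c) \<Rightarrow> bool" where
  "same_law S M f N g \<longleftrightarrow> f \<in> measurable M S \<and> g \<in> measurable N S \<and> distr M S f = distr N S g"

definition half_line_path :: "(real \<Rightarrow> 'a \<Rightarrow> 'c) \<Rightarrow> 'a \<Rightarrow> real \<Rightarrow> 'c" where
  "half_line_path X \<omega> = (\<lambda>t\<in>{0..}. X t \<omega>)"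

definition half_line_copy ::
  "'b measure \<Rightarrow> (real \<Rightarrow> 'b \<Rightarrow> real) \<Rightarrow> 'a measure \<Rightarrow> (real \<Rightarrow> 'a \<Rightarrow> real) \<Rightarrow> bool" where
  "half_line_copy N Y M X \<longleftrightarrow>
     (\<forall>\<omega>\<in>space N. cadlag_on {0..} (\<lambda>t. Y t \<omega>)) \<and>
     same_law path_space N (half_line_path Y) M (half_line_path X)"

text \<open>\<^const>\<open>prob_space.indep_vars\<close> does not apply to random objects of different types, so joint
  independence is expressed through the generated sigma-algebras.\<close>

definition generated_events :: "'a measure \<Rightarrow> 'c measure \<Rightarrow> ('a \<Rightarrow> 'c) \<Rightarrow> 'a set set" where
  "generated_events N S f = {f -` A \<inter> space N | A. A \<in> sets S}"

definition indep_triple ::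
  "'a measure \<Rightarrow> ('a \<Rightarrow> real) \<Rightarrow> (real \<Rightarrow> 'a \<Rightarrow> real) \<Rightarrow> (real \<Rightarrow> 'a \<Rightarrow> real) \<Rightarrow> bool" where
  "indep_triple N G Y Y' \<longleftrightarrow>
     prob_space.indep_sets N
       (\<lambda>i::nat. if i = 0 then generated_events N borel G
                 else if i = 1 then generated_events N path_space (half_line_path Y)
                 else generated_events N path_space (half_line_path Y')) {0, 1, 2}"

end

theory Submission
  imports Defs
begin


text \<open>Write \<open>\<gamma>\<close> for \<open>I\<^sup>-\<close>, \<open>T\<close> for the first time \<open>t \<ge> 0\<close> with \<open>X\<^sub>t \<and> X\<^sub>t\<^sub>- - \<alpha> t \<le> \<gamma>\<close>, and \<open>V\<close> for the path
\<open>X\<^sub>T\<^sub>+\<^sub>u - X\<^sub>T\<close>, \<open>u \<ge> 0\<close>. A time is a contact time of the \<open>\<alpha>\<close>-Lipschitz minorant exactly when the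
lower of the two values of \<open>X\<close> there lies below every cone of slope \<open>\<alpha>\<close> with apex on the path
(\<open>mem_contact_set_iff\<close>). The cones with apex in \<open>(-\<infinity>, 0]\<close> say that a contact time \<open>t > 0\<close> satisfies
\<open>t \<ge> T\<close>. The cones with apex to the right of \<open>t\<close> say that \<open>X\<^sub>u + \<alpha> u\<close> does not fall below its lower
value at \<open>t\<close> after \<open>t\<close>; the first time after \<open>T\<close> where this happens is the first time where
\<open>X\<^sub>u + \<alpha> u\<close> attains its infimum over \<open>[T, \<infinity>)\<close>, and there all the other cones are respected as well.
Hence \<open>D = T + T_min V\<close> (\<open>D_time_eq_hitting_plus_minimum\<close>), and the path of \<open>X\<close> up to \<open>D\<close> is
obtained from \<open>\<gamma>\<close>, from \<open>X\<close> stopped at \<open>T\<close> and from \<open>V\<close> in the same way as \<open>Z\<close> is obtained from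
\<open>\<Gamma>\<close>, \<open>X'\<close> and \<open>X''\<close>.

It remains to compare laws. The level \<open>\<gamma>\<close> is a functional of the path on \<open>(-\<infinity>, 0]\<close>, so it is
independent of the path on \<open>[0, \<infinity>)\<close> (\<open>I_minus_independent_of_half_line\<close>). For a fixed level \<open>T\<close> is a
stopping time of the latter, so by the strong Markov property \<open>V\<close> is an independent copy of the
path (\<open>strong_markov_law\<close>). Integrating over the level gives the equality of laws.

The pathwise identity \<open>D = T + T_min V\<close> needs four almost sure facts.

\<^item> The time \<open>T\<close> is finite and \<open>V\<^sub>u + \<alpha> u\<close> attains its infimum. Both follow from
\<open>\<bar>E[X\<^sub>1]\<bar> < \<alpha>\<close>: at integer times from a maximal ergodic inequality, which gives that a random walk
with positive mean is bounded below (\<open>AE_integer_times_bounded_below\<close>); at real times from the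
strong Markov property, since a path that is very low at some time is still low at the next integer
with probability at least \<open>1/2\<close> (\<open>AE_bounded_below_line\<close>).

\<^item> The path does not jump upwards at \<open>T\<close>. Otherwise \<open>T\<close> could be a contact time because of the value
\<open>X\<^sub>T\<^sub>-\<close>, which \<open>V\<close> does not see. At an upward jump \<open>T\<close> would be announced by the hitting times of
slightly higher levels, and a Levy process does not jump at an announced time
(\<open>AE_no_upward_jump_at_hitting_time\<close>).

\<^item> The path does not jump at \<open>0\<close> (\<open>AE_left_limit_at_zero\<close>), in accordance with the convention for the
left limit of half-line paths.

\<^item> If \<open>T + T_min V = 0\<close> then \<open>0\<close> is a contact time, and \<open>D = 0\<close> holds only if contact times
accumulate at \<open>0\<close> from the right. Contact times that are isolated on the right by a fixed distance
cannot be close to each other, so by stationarity a given time is almost surely not one of them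
(\<open>AE_zero_contact_imp_D_time_zero\<close>).\<close>

section \<open>Cadlag paths and their lower values\<close>

lemma at_within_Ici_eq_at_right: "at t within {t..} = at_right (t::real)"
proof -
  have "{t..} - {t} = {t<..} - {t}" by auto
  then show ?thesis by (simp add: at_within_def)
qed

text \<open>Within the half-line the filter from the left is trivial at \<open>0\<close>, which is why only \<open>t > 0\<close> appears in
the second half.\<close>

lemma cadlag_half_line_iff:
  "cadlag_on {0..} f \<longleftrightarrow>
     (\<forall>t\<ge>0. (f \<longlongrightarrow> f t) (at_right t)) \<and> (\<forall>t>0. \<exists>l. (f \<longlongrightarrow> l) (at_left t))"
proof -
  have 1: "continuous (at t within {0..} \<inter> {t..}) f \<longleftrightarrow> (f \<longlongrightarrow> f t) (at_right t)" if "t \<ge> 0" for t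
  proof -
    have "{0..} \<inter> {t..} = {t..}" using that by auto
    then show ?thesis by (simp add: continuous_within at_within_Ici_eq_at_right)
  qed
  have 2: "at t within {0..} \<inter> {..<t} = at_left t" if "t > 0" for t :: real
    using that by (intro at_within_nhd[of _ "{0<..}"]) auto
  have 3: "at 0 within {0..} \<inter> {..<0::real} = bot"
  proof -
    have "{0..} \<inter> {..<0::real} = {}" by auto
    then show ?thesis by simp
  qed
  have 4: "(\<exists>l. (f \<longlongrightarrow> l) (at t within {0..} \<inter> {..<t})) \<longleftrightarrow> t = 0 \<or> (\<exists>l. (f \<longlongrightarrow> l) (at_left t))"
    if "t \<ge> 0" for t
    using 2[of t] 3 that by (cases "t = 0") auto
  have "cadlag_on {0..} f \<longleftrightarrow> (\<forall>t\<ge>0. continuous (at t within {0..} \<inter> {t..}) f \<and>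
      (\<exists>l. (f \<longlongrightarrow> l) (at t within {0..} \<inter> {..<t})))"
    by (simp add: cadlag_on_def Ball_def)
  also have "\<dots> \<longleftrightarrow> (\<forall>t\<ge>0. (f \<longlongrightarrow> f t) (at_right t) \<and> (t = 0 \<or> (\<exists>l. (f \<longlongrightarrow> l) (at_left t))))"
    using 1 4 by simp
  also have "\<dots> \<longleftrightarrow> (\<forall>t\<ge>0. (f \<longlongrightarrow> f t) (at_right t)) \<and> (\<forall>t>0. \<exists>l. (f \<longlongrightarrow> l) (at_left t))"
    by (auto simp: less_le)
  finally show ?thesis .
qed

lemma cadlag_UNIV_iff:
  "cadlag_on UNIV f \<longleftrightarrow> (\<forall>t. (f \<longlongrightarrow> f t) (at_right t) \<and> (\<exists>l. (f \<longlongrightarrow> l) (at_left t)))"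
  by (simp add: cadlag_on_def continuous_within at_within_Ici_eq_at_right)

lemma cadlag_UNIV_imp_half_line: "cadlag_on UNIV f \<Longrightarrow> cadlag_on {0..} f"
  by (simp add: cadlag_UNIV_iff cadlag_half_line_iff)

lemma cadlag_right_limit: "cadlag_on {0..} f \<Longrightarrow> t \<ge> 0 \<Longrightarrow> (f \<longlongrightarrow> f t) (at_right t)"
  by (simp add: cadlag_half_line_iff)

lemma tendsto_Lim_at_left:
  fixes f :: "real \<Rightarrow> real"
  assumes "\<exists>l. (f \<longlongrightarrow> l) (at_left t)"
  shows "(f \<longlongrightarrow> Lim (at_left t) f) (at_left t)"
  using assms by (auto simp: tendsto_Lim)

lemma cadlag_left_limit: "cadlag_on {0..} f \<Longrightarrow> t > 0 \<Longrightarrow> (f \<longlongrightarrow> left_lim0 f t) (at_left t)"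
  by (simp add: cadlag_half_line_iff left_lim0_def tendsto_Lim_at_left)

lemma left_lim0_eqI: "(f \<longlongrightarrow> l) (at_left t) \<Longrightarrow> t > 0 \<Longrightarrow> left_lim0 f t = l"
  by (simp add: left_lim0_def tendsto_Lim)

lemma eventually_at_right_imp_ball:
  assumes "eventually P (at_right (t::real))"
  shows "\<exists>d>0. \<forall>s. t < s \<and> s < t + d \<longrightarrow> P s"
proof -
  from assms obtain b where "b > t" "\<forall>s>t. s < b \<longrightarrow> P s"
    by (auto simp: eventually_at_right_field)
  then show ?thesis by (intro exI[of _ "b - t"]) auto
qed

lemma eventually_at_left_imp_ball:
  assumes "eventually P (at_left (t::real))"
  shows "\<exists>d>0. \<forall>s. t - d < s \<and> s < t \<longrightarrow> P s"
proof -
  from assms obtain b where "b < t" "\<forall>s>b. s < t \<longrightarrow> P s"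
    by (auto simp: eventually_at_left_field)
  then show ?thesis by (intro exI[of _ "t - b"]) auto
qed

lemma eventually_at_right_rational:
  assumes "eventually P (at_right (t::real))" "e > 0"
  shows "\<exists>q\<in>\<rat>. t < q \<and> q < t + e \<and> P q"
proof -
  obtain d where "d > 0" and d: "\<forall>s. t < s \<and> s < t + d \<longrightarrow> P s"
    using eventually_at_right_imp_ball[OF assms(1)] by auto
  with assms(2) obtain q where "q \<in> \<rat>" "t < q" "q < t + min d e"
    using Rats_dense_in_real[of t "t + min d e"] by auto
  with d show ?thesis by (intro bexI[of _ q]) auto
qed

lemma eventually_at_left_rational:
  assumes "eventually P (at_left (t::real))" "e > 0"
  shows "\<exists>q\<in>\<rat>. t - e < q \<and> q < t \<and> P q"
proof -
  obtain d where "d > 0" and d: "\<forall>s. t - d < s \<and> s < t \<longrightarrow> P s"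
    using eventually_at_left_imp_ball[OF assms(1)] by auto
  with assms(2) obtain q where "q \<in> \<rat>" "t - min d e < q" "q < t"
    using Rats_dense_in_real[of "t - min d e" t] by auto
  with d show ?thesis by (intro bexI[of _ q]) auto
qed

lemma cadlag_cong:
  assumes "\<And>t. t \<ge> 0 \<Longrightarrow> f t = g t"
  shows "cadlag_on {0..} f \<longleftrightarrow> cadlag_on {0..} g"
proof -
  have r: "((f \<longlongrightarrow> f t) (at_right t)) = ((g \<longlongrightarrow> g t) (at_right t))" if "t \<ge> 0" for t
    unfolding assms[OF that]
    by (rule tendsto_cong) (use that assms in \<open>auto simp: eventually_at_right_field intro!: exI[of _ "t+1"]\<close>)
  have l: "((f \<longlongrightarrow> l) (at_left t)) = ((g \<longlongrightarrow> l) (at_left t))" if "t > 0" for t l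
    by (rule tendsto_cong) (use that assms in \<open>auto simp: eventually_at_left_field intro!: exI[of _ 0]\<close>)
  show ?thesis unfolding cadlag_half_line_iff using r l by auto
qed

lemma left_lim0_cong:
  assumes "\<And>s. 0 \<le> s \<Longrightarrow> s < t \<Longrightarrow> f s = g s" and "0 \<le> t"
  shows "left_lim0 f t = left_lim0 g t"
proof (cases "t = 0")
  case False
  then have "t > 0" using assms by simp
  have "((f \<longlongrightarrow> l) (at_left t)) = ((g \<longlongrightarrow> l) (at_left t))" for l
    by (rule tendsto_cong) (use \<open>t > 0\<close> assms in \<open>auto simp: eventually_at_left_field intro!: exI[of _ 0]\<close>)
  then show ?thesis using False by (simp add: left_lim0_def Topological_Spaces.Lim_def)
qed (simp add: left_lim0_def)

lemma filterlim_shift_at_right: "filterlim (\<lambda>u. s + u) (at_right (s + t)) (at_right (t::real))"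
  unfolding filterlim_at
proof
  show "\<forall>\<^sub>F u in at_right t. s + u \<in> {s + t<..} \<and> s + u \<noteq> s + t"
    by (simp add: eventually_at_filter)
  show "((\<lambda>u. s + u) \<longlongrightarrow> s + t) (at_right t)"
    by (intro tendsto_intros)
qed

lemma filterlim_shift_at_left: "filterlim (\<lambda>u. s + u) (at_left (s + t)) (at_left (t::real))"
  unfolding filterlim_at
proof
  show "\<forall>\<^sub>F u in at_left t. s + u \<in> {..<s + t} \<and> s + u \<noteq> s + t"
    by (simp add: eventually_at_filter)
  show "((\<lambda>u. s + u) \<longlongrightarrow> s + t) (at_left t)"
    by (intro tendsto_intros)
qed

lemma cadlag_shift:
  assumes "cadlag_on {0..} f" "s \<ge> 0"
  shows "cadlag_on {0..} (\<lambda>u. f (s + u) - c)"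
  unfolding cadlag_half_line_iff
proof safe
  fix t :: real
  { assume "t \<ge> 0"
    then have "(f \<longlongrightarrow> f (s + t)) (at_right (s + t))" using assms by (intro cadlag_right_limit) auto
    from filterlim_compose[OF this filterlim_shift_at_right]
    show "((\<lambda>u. f (s + u) - c) \<longlongrightarrow> f (s + t) - c) (at_right t)" by (rule tendsto_diff[OF _ tendsto_const]) }
  { assume "t > 0"
    then have "(f \<longlongrightarrow> left_lim0 f (s + t)) (at_left (s + t))" using assms by (intro cadlag_left_limit) auto
    from filterlim_compose[OF this filterlim_shift_at_left]
    have "((\<lambda>u. f (s + u) - c) \<longlongrightarrow> left_lim0 f (s + t) - c) (at_left t)" by (rule tendsto_diff[OF _ tendsto_const])
    then show "\<exists>l. ((\<lambda>u. f (s + u) - c) \<longlongrightarrow> l) (at_left t)" by blast }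
qed

lemma left_lim0_shift:
  assumes "cadlag_on {0..} f" "s \<ge> 0" "t > 0"
  shows "left_lim0 (\<lambda>u. f (s + u) - c) t = left_lim0 f (s + t) - c"
proof (rule left_lim0_eqI[OF _ assms(3)])
  have "(f \<longlongrightarrow> left_lim0 f (s + t)) (at_left (s + t))" using assms by (intro cadlag_left_limit) auto
  from filterlim_compose[OF this filterlim_shift_at_left]
  show "((\<lambda>u. f (s + u) - c) \<longlongrightarrow> left_lim0 f (s + t) - c) (at_left t)" by (rule tendsto_diff[OF _ tendsto_const])
qed

lemma cadlag_stop:
  assumes "cadlag_on {0..} f" "c \<ge> 0"
  shows "cadlag_on {0..} (\<lambda>u. f (min u c))"
  unfolding cadlag_half_line_iff
proof safe
  fix t :: real
  { assume "t \<ge> 0"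
    show "((\<lambda>u. f (min u c)) \<longlongrightarrow> f (min t c)) (at_right t)"
    proof (cases "t < c")
      case True
      have "(f \<longlongrightarrow> f t) (at_right t)" using assms \<open>t \<ge> 0\<close> by (intro cadlag_right_limit)
      moreover have "\<forall>\<^sub>F u in at_right t. f u = f (min u c)"
        using True by (auto simp: eventually_at_right_field intro!: exI[of _ c])
      ultimately have "((\<lambda>u. f (min u c)) \<longlongrightarrow> f t) (at_right t)"
        by (rule Lim_transform_eventually)
      then show ?thesis using True by simp
    next
      case False
      then have "\<forall>\<^sub>F u in at_right t. f (min t c) = f (min u c)"
        by (auto simp: eventually_at_right_field intro!: exI[of _ "t+1"])
      with tendsto_const show ?thesis by (rule Lim_transform_eventually)
    qed }
  { assume "t > 0"
    show "\<exists>l. ((\<lambda>u. f (min u c)) \<longlongrightarrow> l) (at_left t)"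
    proof (cases "t \<le> c")
      case True
      have "(f \<longlongrightarrow> left_lim0 f t) (at_left t)" using assms \<open>t > 0\<close> by (intro cadlag_left_limit)
      moreover have "\<forall>\<^sub>F u in at_left t. f u = f (min u c)"
        using True by (auto simp: eventually_at_left_field intro!: exI[of _ "t-1"])
      ultimately have "((\<lambda>u. f (min u c)) \<longlongrightarrow> left_lim0 f t) (at_left t)"
        by (rule Lim_transform_eventually)
      then show ?thesis by blast
    next
      case False
      then have "\<forall>\<^sub>F u in at_left t. f c = f (min u c)"
        by (auto simp: eventually_at_left_field intro!: exI[of _ c])
      with tendsto_const have "((\<lambda>u. f (min u c)) \<longlongrightarrow> f c) (at_left t)" by (rule Lim_transform_eventually)
      then show ?thesis by blast
    qed }
qed

lemma cadlag_add_continuous: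
  assumes "cadlag_on {0..} f" "continuous_on UNIV c"
  shows "cadlag_on {0..} (\<lambda>t. f t + c t)"
proof -
  have c: "(c \<longlongrightarrow> c t) (at t within A)" for t A
    using assms(2) by (simp add: continuous_on_eq_continuous_at continuous_at_imp_continuous_at_within flip: continuous_within)
  then show ?thesis
    using assms(1) tendsto_add[OF _ c] unfolding cadlag_half_line_iff by blast
qed

text \<open>The lower semicontinuous regularisation of a cadlag path on the half-line. Both hitting times and
contact times are times at which this function is small, and lower semicontinuity is what makes
infima of such times attained.\<close>

definition lower_value :: "(real \<Rightarrow> real) \<Rightarrow> real \<Rightarrow> real" where
  "lower_value f t = min (f t) (left_lim0 f t)"

lemma lower_value_le: "lower_value f t \<le> f t"
  by (simp add: lower_value_def)

text \<open>Adding a line or a continuous random function reduces all sublevel conditions to \<open>lower_value g t \<le> 0\<close>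
for another cadlag path \<open>g\<close>. At time \<open>0\<close> the left limit is \<open>0\<close> by convention and does not move with \<open>c\<close>.\<close>

lemma lower_value_add_continuous:
  assumes "cadlag_on {0..} f" "continuous_on UNIV c" "t > 0 \<or> c 0 = 0" "t \<ge> 0"
  shows "lower_value (\<lambda>t. f t + c t) t = lower_value f t + c t"
proof (cases "t = 0")
  case False
  then have t: "t > 0" using assms by simp
  have "(c \<longlongrightarrow> c t) (at_left t)"
    using assms(2) by (simp add: continuous_on_eq_continuous_at continuous_at_imp_continuous_at_within flip: continuous_within)
  then have "left_lim0 (\<lambda>t. f t + c t) t = left_lim0 f t + c t"
    using t assms(1) by (intro left_lim0_eqI tendsto_add cadlag_left_limit)
  then show ?thesis by (simp add: lower_value_def)
qed (use assms in \<open>simp add: lower_value_def left_lim0_def\<close>)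

lemma lower_value_lower_semicontinuous:
  assumes f: "cadlag_on {0..} f" and t: "t \<ge> 0" and x: "x < lower_value f t"
  shows "\<exists>d>0. \<forall>s\<ge>0. \<bar>s - t\<bar> < d \<longrightarrow> x < lower_value f s"
proof -
  obtain y where y: "x < y" "y < lower_value f t" using x dense by blast
  have "\<forall>\<^sub>F s in at_right t. y < f s"
    using cadlag_right_limit[OF f t] y by (intro order_tendstoD(1)) (auto simp: lower_value_def)
  then obtain d1 where d1: "d1 > 0" "\<forall>s. t < s \<and> s < t + d1 \<longrightarrow> y < f s"
    using eventually_at_right_imp_ball by blast
  obtain d2 where d2: "d2 > 0" "\<forall>s. t - d2 < s \<and> s < t \<and> 0 \<le> s \<longrightarrow> y < f s" "t > 0 \<longrightarrow> d2 \<le> t"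
  proof (cases "t = 0")
    case True
    with that[of 1] show ?thesis by auto
  next
    case False
    then have "t > 0" using t by simp
    then have "\<forall>\<^sub>F s in at_left t. y < f s"
      using cadlag_left_limit[OF f] y by (intro order_tendstoD(1)) (auto simp: lower_value_def)
    then obtain d where "d > 0" "\<forall>s. t - d < s \<and> s < t \<longrightarrow> y < f s"
      using eventually_at_left_imp_ball by blast
    with that[of "min d t"] \<open>t > 0\<close> show ?thesis by (simp add: min_def split: if_splits)
  qed
  have ft: "y < f t" "y < left_lim0 f t" using y by (auto simp: lower_value_def)
  have "x < lower_value f s" if s: "s \<ge> 0" "\<bar>s - t\<bar> < min d1 d2" for s
  proof -
    have 1: "y < f s" if "s \<ge> 0" "\<bar>s - t\<bar> < min d1 d2" for s
      using d1(2)[rule_format, of s] d2(2)[rule_format, of s] ft that by (cases s t rule: linorder_cases) auto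
    have "y \<le> left_lim0 f s"
    proof (cases "s = 0")
      case True
      then have "t = 0" using d2 s t by (auto simp: abs_less_iff)
      then show ?thesis using True ft by simp
    next
      case False
      then have s0: "s > 0" using s by simp
      have "\<forall>\<^sub>F u in at_left s. y \<le> f u"
      proof -
        define e where "e = min s (min d1 d2 - \<bar>s - t\<bar>)"
        have "e > 0" using s s0 by (simp add: e_def)
        have "y \<le> f u" if "s - e < u" "u < s" for u
          using that by (intro less_imp_le 1) (auto simp: e_def)
        then show ?thesis using \<open>e > 0\<close>
          by (auto simp: eventually_at_left_field intro!: exI[of _ "s - e"])
      qed
      with cadlag_left_limit[OF f s0] show ?thesis by (intro tendsto_lowerbound) auto
    qed
    with 1[OF s] y show ?thesis by (simp add: lower_value_def)
  qed
  then show ?thesis using d1 d2 by (intro exI[of _ "min d1 d2"]) auto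
qed

lemma lower_value_sequential_limit:
  assumes f: "cadlag_on {0..} f" and u: "u \<longlonglongrightarrow> t" "\<And>n::nat. 0 \<le> u n"
    and x: "\<And>n. lower_value f (u n) \<le> x n" "x \<longlonglongrightarrow> y"
  shows "lower_value f t \<le> y"
proof (rule ccontr)
  assume "\<not> lower_value f t \<le> y"
  then obtain z where z: "y < z" "z < lower_value f t" using dense by (meson not_le)
  have t: "t \<ge> 0" using u by (intro LIMSEQ_le_const[OF u(1)]) auto
  obtain d where d: "d > 0" "\<forall>s\<ge>0. \<bar>s - t\<bar> < d \<longrightarrow> z < lower_value f s"
    using lower_value_lower_semicontinuous[OF f t z(2)] by auto
  have "\<forall>\<^sub>F n in sequentially. dist (u n) t < d" using u(1) d(1) by (rule tendstoD)
  moreover have "\<forall>\<^sub>F n in sequentially. x n < z" using x(2) z(1) by (rule order_tendstoD)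
  ultimately have "\<forall>\<^sub>F n in sequentially. False"
  proof eventually_elim
    case (elim n)
    then have "z < lower_value f (u n)" using d(2) u(2) by (auto simp: dist_real_def)
    with x(1)[of n] elim show ?case by simp
  qed
  then show False by simp
qed

lemma closed_lower_value_sublevel:
  assumes "cadlag_on {0..} f"
  shows "closed {t. 0 \<le> t \<and> lower_value f t \<le> y}"
  unfolding closed_sequential_limits
proof safe
  fix u t assume u: "\<forall>n. u n \<in> {t. 0 \<le> t \<and> lower_value f t \<le> y}" "u \<longlonglongrightarrow> t"
  show "0 \<le> t" using u by (intro LIMSEQ_le_const[OF u(2)]) auto
  show "lower_value f t \<le> y"
    using u by (intro lower_value_sequential_limit[OF assms u(2) _ _ tendsto_const[of y]]) auto
qed

lemma lower_value_attains_minimum: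
  assumes f: "cadlag_on {0..} f" and ab: "0 \<le> a" "a \<le> b"
  shows "\<exists>t\<in>{a..b}. \<forall>s\<in>{a..b}. lower_value f t \<le> lower_value f s"
proof -
  define S where "S s = {t. 0 \<le> t \<and> lower_value f t \<le> lower_value f s}" for s
  have "{a..b} \<inter> \<Inter>(S ` {a..b}) \<noteq> {}"
  proof (rule compact_imp_fip)
    show "closed T" if "T \<in> S ` {a..b}" for T
      using that closed_lower_value_sublevel[OF f] by (auto simp: S_def)
    fix F assume "finite F" "F \<subseteq> S ` {a..b}"
    then obtain I where I: "finite I" "I \<subseteq> {a..b}" "F = S ` I" by (meson finite_subset_image)
    show "{a..b} \<inter> \<Inter>F \<noteq> {}"
    proof (cases "I = {}")
      case True
      then show ?thesis using I ab by auto
    next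
      case False
      obtain t where t: "t \<in> I" "\<forall>s\<in>I. lower_value f t \<le> lower_value f s"
        using ex_is_arg_min_if_finite[OF I(1) False, of "lower_value f"]
        by (auto simp: is_arg_min_linorder)
      then have "t \<in> {a..b} \<inter> \<Inter>F" using I ab by (auto simp: S_def subset_iff)
      then show ?thesis by blast
    qed
  qed simp
  then show ?thesis using ab by (auto simp: S_def)
qed

text \<open>The countable description of "the level is reached in \<open>[a, b]\<close>": a time where the lower value is
nonpositive is approximated by rational times from the right or from the left, and conversely
rational times of almost nonpositive value have a limit point, at which lower semicontinuity
applies. It is the source of measurability for all random times below.\<close>

lemma lower_value_nonpos_on_interval_iff:
  assumes f: "cadlag_on {0..} f" and ab: "0 < a" "a \<le> b"
  shows "(\<exists>t\<in>{a..b}. lower_value f t \<le> 0) \<longleftrightarrow>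
    (\<forall>n::nat. \<exists>q\<in>\<rat> \<inter> {0<..}. a - 1 / Suc n < q \<and> q < b + 1 / Suc n \<and> f q < 1 / Suc n)"
    (is "?L \<longleftrightarrow> (\<forall>n. ?R n)")
proof
  assume ?L
  then obtain t where t: "a \<le> t" "t \<le> b" "lower_value f t \<le> 0" by auto
  then have t0: "t > 0" using ab by simp
  show "\<forall>n. ?R n"
  proof
    fix n :: nat
    have n: "1 / real (Suc n) > 0" by simp
    consider "f t \<le> 0" | "left_lim0 f t \<le> 0" using t by (auto simp: lower_value_def min_def split: if_splits)
    then show "?R n"
    proof cases
      case 1
      then have "\<forall>\<^sub>F s in at_right t. f s < 1 / Suc n"
        using n t0 by (intro order_tendstoD(2)[OF cadlag_right_limit[OF f]]) (auto intro: le_less_trans)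
      from eventually_at_right_rational[OF this n] obtain q
        where "q\<in>\<rat>" "t < q" "q < t + 1 / Suc n" "f q < 1 / Suc n" by blast
      with t t0 show ?thesis using n by (intro bexI[of _ q]) auto
    next
      case 2
      then have "\<forall>\<^sub>F s in at_left t. f s < 1 / Suc n"
        using n t0 by (intro order_tendstoD(2)[OF cadlag_left_limit[OF f]]) (auto intro: le_less_trans)
      from eventually_at_left_rational[OF this, of "min t (1 / Suc n)"] obtain q
        where "q\<in>\<rat>" "t - min t (1 / Suc n) < q" "q < t" "f q < 1 / Suc n" using n t0 by auto
      with t t0 show ?thesis using n by (intro bexI[of _ q]) auto
    qed
  qed
next
  assume "\<forall>n. ?R n"
  then have "\<forall>n. \<exists>q. q > 0 \<and> a - 1 / Suc n < q \<and> q < b + 1 / Suc n \<and> f q < 1 / Suc n"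
    by blast
  then obtain q where "\<forall>n. q n > 0 \<and> a - 1 / Suc n < q n \<and> q n < b + 1 / Suc n \<and> f (q n) < 1 / Suc n"
    using choice by meson
  then have q: "\<And>n. q n > 0" "\<And>n. a - 1 / Suc n < q n" "\<And>n. q n < b + 1 / Suc n" "\<And>n. f (q n) < 1 / Suc n"
    by blast+
  have "\<forall>n. q n \<in> {0..b+1}"
  proof
    fix n
    have "1 / real (Suc n) \<le> 1" by simp
    moreover have "0 < q n" "q n < b + 1 / real (Suc n)" using q(1,3)[of n] by auto
    ultimately show "q n \<in> {0..b+1}" unfolding atLeastAtMost_iff by linarith
  qed
  then obtain t r where r: "strict_mono (r::nat\<Rightarrow>nat)" "(q \<circ> r) \<longlonglongrightarrow> t"
    using compact_Icc[of 0 "b+1"] unfolding compact_def by blast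
  have inv: "(\<lambda>n. 1 / real (Suc (r n))) \<longlonglongrightarrow> 0"
    using LIMSEQ_subseq_LIMSEQ[OF LIMSEQ_inverse_real_of_nat r(1)]
    by (simp add: o_def inverse_eq_divide)
  have "lower_value f t \<le> 0"
  proof (rule lower_value_sequential_limit[OF f r(2) _ _ inv])
    show "0 \<le> (q \<circ> r) n" for n using q(1)[of "r n"] by simp
    show "lower_value f ((q \<circ> r) n) \<le> 1 / real (Suc (r n))" for n
      using q(4)[of "r n"] lower_value_le[of f "q (r n)"] by simp
  qed
  moreover have "a \<le> t"
  proof (rule LIMSEQ_le[OF _ r(2)])
    show "(\<lambda>n. a - 1 / real (Suc (r n))) \<longlonglongrightarrow> a"
      using tendsto_diff[OF tendsto_const[of a] inv] by simp
  qed (use q(2) less_imp_le in \<open>auto simp: o_def\<close>)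
  moreover have "t \<le> b"
  proof (rule LIMSEQ_le[OF r(2)])
    show "(\<lambda>n. b + 1 / real (Suc (r n))) \<longlonglongrightarrow> b"
      using tendsto_add[OF tendsto_const[of b] inv] by simp
  qed (use q(3) less_imp_le in \<open>auto simp: o_def\<close>)
  ultimately show ?L by auto
qed

lemma T_hit_eq: "T_hit \<alpha> f \<gamma> = Inf (ereal ` {t. 0 \<le> t \<and> lower_value f t - \<alpha> * t \<le> \<gamma>})"
  by (simp add: T_hit_def lower_value_def)

lemma Inf_ereal_image_less_iff: "Inf (ereal ` A) < c \<longleftrightarrow> (\<exists>t\<in>A. ereal t < c)"
  by (simp add: Inf_less_iff)

lemma T_hit_nonneg: "0 \<le> T_hit \<alpha> f \<gamma>"
  unfolding T_hit_eq by (auto intro!: Inf_greatest)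

lemma Inf_ereal_closed_attained:
  assumes "closed A" "A \<subseteq> {0..}" "Inf (ereal ` A) = ereal t"
  shows "t \<in> A"
proof -
  have ne: "A \<noteq> {}" using assms(3) by (auto simp: top_ereal_def)
  have bdd: "bdd_below A" using assms(2) by auto
  have "ereal (Inf A) = Inf (ereal ` A)"
    by (rule ereal_Inf'[OF bdd ne])
  then have "Inf A = t" using assms(3) by simp
  then show ?thesis using closed_contains_Inf[OF ne bdd assms(1)] by simp
qed

lemma T_hit_attained:
  assumes f: "cadlag_on {0..} f" and T: "T_hit \<alpha> f \<gamma> = ereal t"
  shows "0 \<le> t" "lower_value f t - \<alpha> * t \<le> \<gamma>"
    "\<And>s. 0 \<le> s \<Longrightarrow> s < t \<Longrightarrow> \<gamma> < lower_value f s - \<alpha> * s"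
proof -
  define g where "g s = f s + (- \<alpha> * s)" for s
  have g: "cadlag_on {0..} g" unfolding g_def
    by (intro cadlag_add_continuous f continuous_intros)
  have lg: "lower_value g s = lower_value f s - \<alpha> * s" if "s \<ge> 0" for s
    unfolding g_def using that
    by (subst lower_value_add_continuous[OF f]) (auto intro!: continuous_intros)
  have A: "{s. 0 \<le> s \<and> lower_value f s - \<alpha> * s \<le> \<gamma>} = {s. 0 \<le> s \<and> lower_value g s \<le> \<gamma>}"
    using lg by auto
  have "t \<in> {s. 0 \<le> s \<and> lower_value g s \<le> \<gamma>}"
    using T closed_lower_value_sublevel[OF g]
    by (intro Inf_ereal_closed_attained) (auto simp: T_hit_eq A)
  then show "0 \<le> t" "lower_value f t - \<alpha> * t \<le> \<gamma>" using lg by auto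
  fix s assume s: "0 \<le> s" "s < t"
  show "\<gamma> < lower_value f s - \<alpha> * s"
  proof (rule ccontr)
    assume "\<not> ?thesis"
    then have "T_hit \<alpha> f \<gamma> \<le> ereal s" unfolding T_hit_eq using s by (intro Inf_lower) auto
    then show False using T s by simp
  qed
qed


section \<open>Measurability of random times\<close>

text \<open>The smallest multiple of \<open>1/(n+1)\<close> strictly after \<open>x\<close>. Strictness makes the event that the grid time
of a stopping time equals a given value \<open>b\<close> depend on the path before \<open>b\<close> only.\<close>

definition time_grid :: "nat \<Rightarrow> real \<Rightarrow> real" where
  "time_grid n x = (real_of_int \<lfloor>real (Suc n) * x\<rfloor> + 1) / real (Suc n)"

lemma time_grid_greater: "x < time_grid n x"
proof -
  have "real (Suc n) * x < real_of_int \<lfloor>real (Suc n) * x\<rfloor> + 1" by linarith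
  then show ?thesis unfolding time_grid_def by (simp add: field_simps)
qed

lemma time_grid_le: "time_grid n x \<le> x + 1 / real (Suc n)"
proof -
  have "real_of_int \<lfloor>real (Suc n) * x\<rfloor> + 1 \<le> real (Suc n) * x + 1" by linarith
  then have "time_grid n x \<le> (real (Suc n) * x + 1) / real (Suc n)"
    unfolding time_grid_def by (intro divide_right_mono) auto
  also have "\<dots> = x + 1 / real (Suc n)" by (simp add: field_simps)
  finally show ?thesis .
qed

lemma time_grid_tendsto: "filterlim (\<lambda>n. time_grid n x) (at_right x) sequentially"
  unfolding filterlim_at
proof
  show "\<forall>\<^sub>F n in sequentially. time_grid n x \<in> {x<..} \<and> time_grid n x \<noteq> x"
    by (rule always_eventually) (metis greaterThan_iff less_irrefl time_grid_greater)
  have "(\<lambda>n. x + 1 / real (Suc n)) \<longlonglongrightarrow> x + 0"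
    using LIMSEQ_inverse_real_of_nat by (intro tendsto_add tendsto_const) (simp add: inverse_eq_divide)
  then have u: "(\<lambda>n. x + 1 / real (Suc n)) \<longlonglongrightarrow> x" by simp
  show "(\<lambda>n. time_grid n x) \<longlonglongrightarrow> x"
    by (rule tendsto_sandwich[OF _ _ tendsto_const u])
      (auto intro!: always_eventually time_grid_le less_imp_le[OF time_grid_greater] simp del: of_nat_Suc)
qed

definition cadlag_process :: "'a measure \<Rightarrow> (real \<Rightarrow> 'a \<Rightarrow> real) \<Rightarrow> bool" where
  "cadlag_process N Y \<longleftrightarrow> (\<forall>t\<ge>0. Y t \<in> borel_measurable N) \<and>
     (\<forall>\<omega>\<in>space N. cadlag_on {0..} (\<lambda>t. Y t \<omega>))"

lemma cadlag_processD:
  assumes "cadlag_process N Y"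
  shows "t \<ge> 0 \<Longrightarrow> Y t \<in> borel_measurable N" "\<omega> \<in> space N \<Longrightarrow> cadlag_on {0..} (\<lambda>t. Y t \<omega>)"
  using assms by (auto simp: cadlag_process_def)

lemma cadlag_process_at_random_time:
  assumes Y: "cadlag_process N Y" and \<tau>: "\<tau> \<in> borel_measurable N" "\<And>\<omega>. \<omega> \<in> space N \<Longrightarrow> 0 \<le> \<tau> \<omega>"
  shows "(\<lambda>\<omega>. Y (\<tau> \<omega>) \<omega>) \<in> borel_measurable N"
proof (rule borel_measurable_LIMSEQ_real)
  show "(\<lambda>n. Y (time_grid n (\<tau> \<omega>)) \<omega>) \<longlonglongrightarrow> Y (\<tau> \<omega>) \<omega>" if "\<omega> \<in> space N" for \<omega>
    using filterlim_compose[OF cadlag_right_limit[OF cadlag_processD(2)[OF Y that] \<tau>(2)[OF that]] time_grid_tendsto] .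
  fix n :: nat
  define k where "k \<omega> = nat \<lfloor>real (Suc n) * \<tau> \<omega>\<rfloor>" for \<omega>
  have k: "k \<in> measurable N (count_space UNIV)" unfolding k_def using \<tau>(1) by measurable
  have "(\<lambda>\<omega>. Y ((real (k \<omega>) + 1) / real (Suc n)) \<omega>) \<in> borel_measurable N"
    using k by (rule measurable_compose_countable[rotated]) (intro cadlag_processD(1)[OF Y], simp)
  also have "?this \<longleftrightarrow> (\<lambda>\<omega>. Y (time_grid n (\<tau> \<omega>)) \<omega>) \<in> borel_measurable N"
  proof (rule measurable_cong)
    fix \<omega> assume "\<omega> \<in> space N"
    then have "real (k \<omega>) = real_of_int \<lfloor>real (Suc n) * \<tau> \<omega>\<rfloor>"
      unfolding k_def using \<tau>(2)[of \<omega>] by (subst of_nat_nat) auto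
    then show "Y ((real (k \<omega>) + 1) / real (Suc n)) \<omega> = Y (time_grid n (\<tau> \<omega>)) \<omega>"
      by (simp add: time_grid_def)
  qed
  finally show "(\<lambda>\<omega>. Y (time_grid n (\<tau> \<omega>)) \<omega>) \<in> borel_measurable N" .
qed

lemma sets_lower_value_nonpos_on_interval:
  assumes Y: "cadlag_process N Y" and ab: "0 < a" "a \<le> b"
  shows "{\<omega>\<in>space N. \<exists>t\<in>{a..b}. lower_value (\<lambda>t. Y t \<omega>) t \<le> 0} \<in> sets N"
proof -
  have "{\<omega>\<in>space N. \<exists>t\<in>{a..b}. lower_value (\<lambda>t. Y t \<omega>) t \<le> 0} =
    (\<Inter>n::nat. \<Union>q\<in>\<rat> \<inter> {0<..} \<inter> {q. a - 1 / Suc n < q \<and> q < b + 1 / Suc n}. {\<omega>\<in>space N. Y q \<omega> < 1 / Suc n})"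
    (is "?A = ?B")
  proof (rule set_eqI)
    fix \<omega>
    show "\<omega> \<in> ?A \<longleftrightarrow> \<omega> \<in> ?B"
    proof (cases "\<omega> \<in> space N")
      case True
      then show ?thesis
        using lower_value_nonpos_on_interval_iff[OF cadlag_processD(2)[OF Y True] ab] by fastforce
    qed auto
  qed
  also have "\<dots> \<in> sets N"
  proof -
    have "(\<Union>q\<in>\<rat> \<inter> {0<..} \<inter> {q. a - 1 / Suc n < q \<and> q < b + 1 / Suc n}. {\<omega>\<in>space N. Y q \<omega> < 1 / Suc n}) \<in> sets N"
      for n :: nat
    proof (rule sets.countable_UN'')
      show "countable (\<rat> \<inter> {0<..} \<inter> {q. a - 1 / Suc n < q \<and> q < b + 1 / Suc n})"
        by (rule countable_subset[OF _ countable_rat]) auto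
      fix q :: real
      assume "q \<in> \<rat> \<inter> {0<..} \<inter> {q. a - 1 / Suc n < q \<and> q < b + 1 / Suc n}"
      then have "q \<ge> 0" by simp
      from cadlag_processD(1)[OF Y this]
      show "{\<omega>\<in>space N. Y q \<omega> < 1 / Suc n} \<in> sets N" by measurable
    qed
    then show ?thesis by (intro sets.countable_INT) auto
  qed
  finally show ?thesis .
qed

text \<open>Time \<open>0\<close> is excluded because of the convention for the left limit there; the times of interest
treat it separately.\<close>

definition first_nonpos_time :: "(real \<Rightarrow> real) \<Rightarrow> ereal" where
  "first_nonpos_time f = Inf (ereal ` {t. 0 < t \<and> lower_value f t \<le> 0})"

lemma measurable_first_nonpos_time:
  assumes Y: "cadlag_process N Y"
  shows "(\<lambda>\<omega>. first_nonpos_time (\<lambda>t. Y t \<omega>)) \<in> borel_measurable N"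
  unfolding borel_measurable_ereal_iff_Iio
proof
  fix c :: ereal
  define Q where "Q = {(a, b). a \<in> \<rat> \<and> b \<in> \<rat> \<and> 0 < a \<and> a \<le> b \<and> ereal b < c}"
  have "(\<lambda>\<omega>. first_nonpos_time (\<lambda>t. Y t \<omega>)) -` {..<c} \<inter> space N =
     (\<Union>(a,b)\<in>Q. {\<omega>\<in>space N. \<exists>t\<in>{a..b}. lower_value (\<lambda>t. Y t \<omega>) t \<le> 0})" (is "?A = ?B")
  proof
    show "?B \<subseteq> ?A"
    proof
      fix \<omega> assume "\<omega> \<in> ?B"
      then obtain a b t where "ereal b < c" "0 < a" "\<omega> \<in> space N" "t \<in> {a..b}" "lower_value (\<lambda>t. Y t \<omega>) t \<le> 0"
        by (auto simp: Q_def)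
      moreover then have "ereal t < c" by (auto intro: le_less_trans[of "ereal t" "ereal b" c])
      moreover have "t > 0" using \<open>0 < a\<close> \<open>t \<in> {a..b}\<close> by simp
      ultimately have "\<exists>t\<in>{t. 0 < t \<and> lower_value (\<lambda>t. Y t \<omega>) t \<le> 0}. ereal t < c" by blast
      then show "\<omega> \<in> ?A"
        using \<open>\<omega> \<in> space N\<close> by (simp add: first_nonpos_time_def Inf_ereal_image_less_iff)
    qed
    show "?A \<subseteq> ?B"
    proof
      fix \<omega> assume "\<omega> \<in> ?A"
      then obtain t where t: "\<omega> \<in> space N" "0 < t" "lower_value (\<lambda>t. Y t \<omega>) t \<le> 0" "ereal t < c"
        by (auto simp: first_nonpos_time_def Inf_ereal_image_less_iff)
      obtain a where a: "a \<in> \<rat>" "0 < a" "a < t" using Rats_dense_in_real[OF t(2)] by auto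
      obtain z where z: "t < z" "ereal z < c"
        using ereal_dense2[OF t(4)] by auto
      obtain b where b: "b \<in> \<rat>" "t < b" "b < z" using Rats_dense_in_real[OF z(1)] by auto
      have "ereal b < c" using b z by (auto intro: less_trans[of "ereal b" "ereal z" c])
      then have "(a, b) \<in> Q" using a b by (auto simp: Q_def)
      moreover have "\<exists>t\<in>{a..b}. lower_value (\<lambda>t. Y t \<omega>) t \<le> 0"
        using t a b by (intro bexI[of _ t]) auto
      ultimately show "\<omega> \<in> ?B" using t(1) by (intro UN_I[of "(a, b)"]) auto
    qed
  qed
  also have "\<dots> \<in> sets N"
  proof (rule sets.countable_UN'')
    show "countable Q"
      by (rule countable_subset[of _ "\<rat> \<times> \<rat>"]) (auto simp: Q_def countable_rat)
    show "(case x of (a, b) \<Rightarrow> {\<omega> \<in> space N. \<exists>t\<in>{a..b}. lower_value (\<lambda>t. Y t \<omega>) t \<le> 0}) \<in> sets N"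
      if "x \<in> Q" for x
      using that sets_lower_value_nonpos_on_interval[OF Y] by (auto simp: Q_def)
  qed
  finally show "(\<lambda>\<omega>. first_nonpos_time (\<lambda>t. Y t \<omega>)) -` {..<c} \<inter> space N \<in> sets N" .
qed

lemma cadlag_process_add_continuous:
  assumes Y: "cadlag_process N Y" and c: "\<And>t. c t \<in> borel_measurable N"
    "\<And>\<omega>. \<omega> \<in> space N \<Longrightarrow> continuous_on UNIV (\<lambda>t. c t \<omega>)"
  shows "cadlag_process N (\<lambda>t \<omega>. Y t \<omega> + c t \<omega>)"
  using cadlag_processD[OF Y] c unfolding cadlag_process_def
  by (auto intro!: cadlag_add_continuous)

lemma Inf_ereal_split_zero:
  "Inf (ereal ` {t. 0 \<le> t \<and> P t}) = (if P 0 then 0 else Inf (ereal ` {t. 0 < t \<and> P t}))"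
proof (cases "P 0")
  case True
  have "Inf (ereal ` {t. 0 \<le> t \<and> P t}) \<le> ereal 0" using True by (intro Inf_lower) auto
  moreover have "0 \<le> Inf (ereal ` {t. 0 \<le> t \<and> P t})" by (auto intro!: Inf_greatest)
  ultimately show ?thesis using True by (auto simp: zero_ereal_def)
next
  case False
  then have "{t. 0 \<le> t \<and> P t} = {t. 0 < t \<and> P t}" by (auto simp: less_le)
  then show ?thesis using False by simp
qed

lemma measurable_T_hit:
  assumes Y: "cadlag_process N Y" and \<gamma>[measurable]: "\<gamma> \<in> borel_measurable N"
  shows "(\<lambda>\<omega>. T_hit \<alpha> (\<lambda>t. Y t \<omega>) (\<gamma> \<omega>)) \<in> borel_measurable N"
proof -
  define Y' where "Y' t \<omega> = Y t \<omega> + (- \<alpha> * t - \<gamma> \<omega>)" for t \<omega>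
  have Y': "cadlag_process N Y'" unfolding Y'_def
    by (intro cadlag_process_add_continuous Y continuous_intros) measurable
  have [measurable]: "Y 0 \<in> borel_measurable N" using cadlag_processD(1)[OF Y] by simp
  note [measurable] = measurable_first_nonpos_time[OF Y']
  have "T_hit \<alpha> (\<lambda>t. Y t \<omega>) (\<gamma> \<omega>) =
      (if min (Y 0 \<omega>) 0 \<le> \<gamma> \<omega> then 0 else first_nonpos_time (\<lambda>t. Y' t \<omega>))" if "\<omega> \<in> space N" for \<omega>
  proof -
    have "lower_value (\<lambda>t. Y' t \<omega>) t = lower_value (\<lambda>t. Y t \<omega>) t + (- \<alpha> * t - \<gamma> \<omega>)" if "t > 0" for t
      unfolding Y'_def
      by (rule lower_value_add_continuous[OF cadlag_processD(2)[OF Y \<open>\<omega> \<in> space N\<close>]])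
        (use that in \<open>auto intro!: continuous_intros\<close>)
    then have "{t. 0 < t \<and> lower_value (\<lambda>t. Y t \<omega>) t - \<alpha> * t \<le> \<gamma> \<omega>} = {t. 0 < t \<and> lower_value (\<lambda>t. Y' t \<omega>) t \<le> 0}"
      by (auto simp del: minus_mult_left)
    then show ?thesis
      unfolding T_hit_eq Inf_ereal_split_zero first_nonpos_time_def by (simp add: lower_value_def left_lim0_def)
  qed
  then show ?thesis by (subst measurable_cong) measurable
qed

text \<open>Right-continuity allows an arbitrary time to be replaced by a rational one slightly to its right.
The hypothesis on \<open>A\<close> covers half-lines closed on the right at a rational point, such as \<open>{..0}\<close>.\<close>

lemma cadlag_INF_eq_rational_INF:
  fixes f :: "real \<Rightarrow> real"
  assumes f: "\<And>t. t \<in> A \<Longrightarrow> (f \<longlongrightarrow> f t) (at_right t)"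
    and A: "\<And>t. t \<in> A \<Longrightarrow> t \<in> \<rat> \<or> (\<exists>e>0. {t<..<t+e} \<subseteq> A)"
  shows "(INF t\<in>A. ereal (f t)) = (INF t\<in>A \<inter> \<rat>. ereal (f t))"
proof (rule antisym)
  show "(INF t\<in>A. ereal (f t)) \<le> (INF t\<in>A \<inter> \<rat>. ereal (f t))"
    by (rule INF_superset_mono) auto
  show "(INF t\<in>A \<inter> \<rat>. ereal (f t)) \<le> (INF t\<in>A. ereal (f t))"
  proof (rule INF_greatest)
    fix t assume t: "t \<in> A"
    show "(INF t\<in>A \<inter> \<rat>. ereal (f t)) \<le> ereal (f t)"
    proof (cases "t \<in> \<rat>")
      case False
      then obtain e where e: "e > 0" "{t<..<t+e} \<subseteq> A" using A[OF t] by auto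
      show ?thesis
      proof (rule ereal_le_epsilon2)
        fix d :: real assume "d > 0"
        then have "\<forall>\<^sub>F s in at_right t. f s < f t + d" by (intro order_tendstoD(2)[OF f[OF t]]) auto
        from eventually_at_right_rational[OF this e(1)] obtain q where
          "q \<in> \<rat>" "t < q" "q < t + e" "f q < f t + d" by blast
        then have "(INF t\<in>A \<inter> \<rat>. ereal (f t)) \<le> ereal (f q)" using e by (intro INF_lower) auto
        also have "\<dots> \<le> ereal (f t) + ereal d" using \<open>f q < f t + d\<close> by simp
        finally show "(INF t\<in>A \<inter> \<rat>. ereal (f t)) \<le> ereal (f t) + ereal d" .
      qed
    qed (use t in \<open>auto intro: INF_lower\<close>)
  qed
qed

lemma continuous_on_UNIV_tendsto_within:
  "continuous_on UNIV (c :: real \<Rightarrow> real) \<Longrightarrow> (c \<longlongrightarrow> c t) (at t within A)"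
  by (simp add: continuous_on_eq_continuous_at continuous_at_imp_continuous_at_within flip: continuous_within)

lemma tendsto_at_right_add_continuous:
  fixes f c :: "real \<Rightarrow> real"
  assumes "(f \<longlongrightarrow> f t) (at_right t)" "continuous_on UNIV c"
  shows "((\<lambda>t. f t + c t) \<longlongrightarrow> f t + c t) (at_right t)"
  by (intro tendsto_add assms(1) continuous_on_UNIV_tendsto_within assms(2))

lemma measurable_future_infimum:
  assumes Y: "cadlag_process N Y"
  shows "(\<lambda>\<omega>. INF u\<in>{0..}. ereal (Y u \<omega> + \<alpha> * u)) \<in> borel_measurable N"
proof -
  have "(\<lambda>\<omega>. INF u\<in>{0..} \<inter> \<rat>. ereal (Y u \<omega> + \<alpha> * u)) \<in> borel_measurable N"
  proof (rule borel_measurable_INF)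
    show "countable ({0..} \<inter> \<rat> :: real set)" by (rule countable_subset[OF _ countable_rat]) auto
    fix u :: real assume "u \<in> {0..} \<inter> \<rat>"
    then have [measurable]: "Y u \<in> borel_measurable N" using cadlag_processD(1)[OF Y] by simp
    show "(\<lambda>\<omega>. ereal (Y u \<omega> + \<alpha> * u)) \<in> borel_measurable N" by measurable
  qed
  also have "?this \<longleftrightarrow> ?thesis"
  proof (rule measurable_cong)
    fix \<omega> assume "\<omega> \<in> space N"
    show "(INF u\<in>{0..} \<inter> \<rat>. ereal (Y u \<omega> + \<alpha> * u)) = (INF u\<in>{0..}. ereal (Y u \<omega> + \<alpha> * u))"
    proof (rule cadlag_INF_eq_rational_INF[symmetric])
      show "((\<lambda>u. Y u \<omega> + \<alpha> * u) \<longlongrightarrow> Y t \<omega> + \<alpha> * t) (at_right t)" if "t \<in> {0..}" for t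
        using cadlag_right_limit[OF cadlag_processD(2)[OF Y \<open>\<omega> \<in> space N\<close>]] that
        by (intro tendsto_at_right_add_continuous continuous_intros) auto
    qed (auto intro!: exI[of _ 1])
  qed
  finally show ?thesis .
qed

text \<open>Left limits are limits of values, hence not below the infimum. At time \<open>0\<close> this can fail by the
convention, unless \<open>f 0 \<le> 0\<close>.\<close>

lemma future_infimum_le_lower_value:
  assumes f: "cadlag_on {0..} f" and I: "(INF u\<in>{0..}. ereal (f u + \<alpha> * u)) = ereal m"
    and t: "t > 0 \<or> f 0 \<le> 0" "t \<ge> 0"
  shows "m \<le> lower_value f t + \<alpha> * t"
proof -
  have le: "m \<le> f u + \<alpha> * u" if "u \<ge> 0" for u
  proof -
    have "ereal m \<le> ereal (f u + \<alpha> * u)" unfolding I[symmetric] using that by (intro INF_lower) auto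
    then show ?thesis by simp
  qed
  show ?thesis
  proof (cases "t = 0")
    case True
    then show ?thesis using le[of 0] t by (simp add: lower_value_def left_lim0_def)
  next
    case False
    then have t: "t > 0" using t by simp
    have "((\<lambda>u. f u + \<alpha> * u) \<longlongrightarrow> left_lim0 f t + \<alpha> * t) (at_left t)"
      by (intro tendsto_intros cadlag_left_limit[OF f t])
    moreover have "\<forall>\<^sub>F u in at_left t. m \<le> f u + \<alpha> * u"
      using le t by (auto simp: eventually_at_left_field intro!: exI[of _ 0])
    ultimately have "m \<le> left_lim0 f t + \<alpha> * t" by (intro tendsto_lowerbound) auto
    then show ?thesis using le[of t] t by (simp add: lower_value_def)
  qed
qed

lemma measurable_T_min:
  assumes Y: "cadlag_process N Y"
  shows "(\<lambda>\<omega>. T_min \<alpha> (\<lambda>t. Y t \<omega>)) \<in> borel_measurable N"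
proof -
  define I where "I \<omega> = (INF u\<in>{0..}. ereal (Y u \<omega> + \<alpha> * u))" for \<omega>
  define Y' where "Y' t \<omega> = Y t \<omega> + (\<alpha> * t - real_of_ereal (I \<omega>))" for t \<omega>
  have [measurable]: "I \<in> borel_measurable N" unfolding I_def by (rule measurable_future_infimum[OF Y])
  have Y': "cadlag_process N Y'" unfolding Y'_def
    by (intro cadlag_process_add_continuous Y continuous_intros) measurable
  have [measurable]: "Y 0 \<in> borel_measurable N" using cadlag_processD(1)[OF Y] by simp
  note [measurable] = measurable_first_nonpos_time[OF Y']
  have "T_min \<alpha> (\<lambda>t. Y t \<omega>) =
      (if \<bar>I \<omega>\<bar> = \<infinity> then \<infinity> else if ereal (min (Y 0 \<omega>) 0) = I \<omega> then 0 else first_nonpos_time (\<lambda>t. Y' t \<omega>))"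
    if \<omega>: "\<omega> \<in> space N" for \<omega>
  proof (cases "\<bar>I \<omega>\<bar> = \<infinity>")
    case True
    then have empty: "{t. 0 \<le> t \<and> ereal (min (Y t \<omega>) (left_lim0 (\<lambda>t. Y t \<omega>) t) + \<alpha> * t) = I \<omega>} = {}"
      using True by (auto dest: sym)
    then show ?thesis using True unfolding T_min_def I_def[symmetric] empty by (simp add: top_ereal_def)
  next
    case False
    then obtain m where m: "I \<omega> = ereal m" by auto
    have f: "cadlag_on {0..} (\<lambda>t. Y t \<omega>)" using cadlag_processD(2)[OF Y \<omega>] .
    have 1: "lower_value (\<lambda>t. Y' t \<omega>) t = lower_value (\<lambda>t. Y t \<omega>) t + (\<alpha> * t - m)" if "t > 0" for t
      unfolding Y'_def m real_of_ereal.simps using that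
      by (subst lower_value_add_continuous[OF f]) (auto intro!: continuous_intros)
    have 2: "m \<le> lower_value (\<lambda>t. Y t \<omega>) t + \<alpha> * t" if "t > 0" for t
      using that m by (intro future_infimum_le_lower_value[OF f]) (auto simp: I_def)
    have "{t. 0 < t \<and> lower_value (\<lambda>t. Y t \<omega>) t + \<alpha> * t = m} = {t. 0 < t \<and> lower_value (\<lambda>t. Y' t \<omega>) t \<le> 0}"
      using 1 2 by (force simp: algebra_simps)
    then show ?thesis
      unfolding T_min_def I_def[symmetric] Inf_ereal_split_zero first_nonpos_time_def using m
      by (simp add: lower_value_def left_lim0_def)
  qed
  then show ?thesis by (subst measurable_cong) measurable
qed


section \<open>The space of cadlag paths, stopping and shifting\<close>

lemma measurable_Some: "Some \<in> borel \<rightarrow>\<^sub>M borel_cemetery"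
  unfolding borel_cemetery_def
proof (rule measurable_measure_of)
  show "Some -` y \<inter> space borel \<in> sets (borel :: real measure)" if "y \<in> (`) Some ` sets borel" for y :: "real option set"
    using that by (auto simp: inj_vimage_image_eq)
qed auto

lemma space_borel_cemetery: "space borel_cemetery = UNIV"
  by (simp add: borel_cemetery_def)

lemma measurable_killed:
  assumes [measurable]: "Measurable.pred N P" "u \<in> borel_measurable N"
  shows "(\<lambda>\<omega>. if P \<omega> then Some (u \<omega>) else None) \<in> N \<rightarrow>\<^sub>M borel_cemetery"
proof -
  note [measurable] = measurable_Some
  have [measurable]: "None \<in> space borel_cemetery" by (simp add: space_borel_cemetery)
  show ?thesis by measurable
qed

lemma measurable_two_piece_killed:
  assumes [measurable]: "Measurable.pred N P" "Measurable.pred N Q" "u \<in> borel_measurable N" "v \<in> borel_measurable N"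
  shows "(\<lambda>\<omega>. if P \<omega> then Some (u \<omega>) else if Q \<omega> then Some (v \<omega>) else None) \<in> N \<rightarrow>\<^sub>M borel_cemetery"
proof -
  note [measurable] = measurable_Some
  have [measurable]: "None \<in> space borel_cemetery" by (simp add: space_borel_cemetery)
  show ?thesis by measurable
qed

lemma measurable_Z_path:
  assumes Y: "cadlag_process N Y" and Y': "cadlag_process N Y'" and \<gamma>[measurable]: "\<gamma> \<in> borel_measurable N"
  shows "half_line_path (\<lambda>t \<omega>. Z_path \<alpha> (\<gamma> \<omega>) (\<lambda>s. Y s \<omega>) (\<lambda>s. Y' s \<omega>) t) \<in> N \<rightarrow>\<^sub>M killed_path_space"
  unfolding half_line_path_def
proof (rule measurable_restrict)
  fix t :: real assume "t \<in> {0..}"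
  then have t: "t \<ge> 0" by simp
  define T where "T \<omega> = T_hit \<alpha> (\<lambda>s. Y s \<omega>) (\<gamma> \<omega>)" for \<omega>
  define S where "S \<omega> = T_min \<alpha> (\<lambda>s. Y' s \<omega>)" for \<omega>
  have [measurable]: "T \<in> borel_measurable N" unfolding T_def by (rule measurable_T_hit[OF Y \<gamma>])
  have T0: "0 \<le> T \<omega>" for \<omega> by (simp add: T_def T_hit_nonneg)
  have [measurable]: "S \<in> borel_measurable N" unfolding S_def by (rule measurable_T_min[OF Y'])
  have [measurable]: "Y t \<in> borel_measurable N" using cadlag_processD(1)[OF Y t] .
  have [measurable]: "(\<lambda>\<omega>. Y (real_of_ereal (T \<omega>)) \<omega>) \<in> borel_measurable N"
    by (intro cadlag_process_at_random_time[OF Y]) (simp_all add: T0 real_of_ereal_pos)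
  have [measurable]: "(\<lambda>\<omega>. Y' (max 0 (t - real_of_ereal (T \<omega>))) \<omega>) \<in> borel_measurable N"
    by (intro cadlag_process_at_random_time[OF Y']) auto
  have "(\<lambda>\<omega>. if ereal t \<le> T \<omega> then Some (Y t \<omega>) else if ereal t \<le> T \<omega> + S \<omega>
      then Some (Y' (max 0 (t - real_of_ereal (T \<omega>))) \<omega> + Y (real_of_ereal (T \<omega>)) \<omega>) else None)
    \<in> N \<rightarrow>\<^sub>M borel_cemetery"
    by (intro measurable_two_piece_killed) measurable
  also have "?this \<longleftrightarrow> (\<lambda>\<omega>. Z_path \<alpha> (\<gamma> \<omega>) (\<lambda>s. Y s \<omega>) (\<lambda>s. Y' s \<omega>) t) \<in> N \<rightarrow>\<^sub>M borel_cemetery"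
  proof (rule measurable_cong)
    fix \<omega>
    have "max 0 (t - real_of_ereal (T \<omega>)) = t - real_of_ereal (T \<omega>)" if "\<not> ereal t \<le> T \<omega>"
      using that t by (cases "T \<omega>") auto
    then show "(if ereal t \<le> T \<omega> then Some (Y t \<omega>) else if ereal t \<le> T \<omega> + S \<omega>
      then Some (Y' (max 0 (t - real_of_ereal (T \<omega>))) \<omega> + Y (real_of_ereal (T \<omega>)) \<omega>) else None)
      = Z_path \<alpha> (\<gamma> \<omega>) (\<lambda>s. Y s \<omega>) (\<lambda>s. Y' s \<omega>) t"
      unfolding Z_path_def Let_def T_def S_def by auto
  qed
  finally show "(\<lambda>\<omega>. Z_path \<alpha> (\<gamma> \<omega>) (\<lambda>s. Y s \<omega>) (\<lambda>s. Y' s \<omega>) t) \<in> N \<rightarrow>\<^sub>M borel_cemetery" .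
qed

text \<open>Hitting times and minima are not measurable on the full product space, whose events depend on
countably many coordinates, but they are on its trace on the cadlag paths. Laws on the two spaces
determine each other for processes with cadlag paths.\<close>

definition cadlag_space :: "(real \<Rightarrow> real) measure" where
  "cadlag_space = restrict_space path_space {f. cadlag_on {0..} f}"

lemma space_cadlag_space: "f \<in> space cadlag_space \<longleftrightarrow> f \<in> extensional {0..} \<and> cadlag_on {0..} f"
  by (auto simp: cadlag_space_def space_restrict_space space_PiM PiE_def)

lemma cadlag_restrict: "cadlag_on {0..} (restrict f {0..}) \<longleftrightarrow> cadlag_on {0..} f"
  by (rule cadlag_cong) simp

lemma measurable_cadlag_spaceI:
  assumes "cadlag_process N Y"
  shows "half_line_path Y \<in> N \<rightarrow>\<^sub>M cadlag_space"
  unfolding cadlag_space_def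
proof (rule measurable_restrict_space2)
  show "half_line_path Y \<in> space N \<rightarrow> {f. cadlag_on {0..} f}"
    using cadlag_processD(2)[OF assms] by (auto simp: half_line_path_def cadlag_restrict)
  show "half_line_path Y \<in> N \<rightarrow>\<^sub>M path_space"
    unfolding half_line_path_def using cadlag_processD(1)[OF assms] by (intro measurable_restrict) auto
qed

lemma cadlag_process_coordinate: "cadlag_process cadlag_space (\<lambda>t f. f t)"
  unfolding cadlag_process_def
proof safe
  fix t :: real assume "0 \<le> t"
  then show "(\<lambda>f. f t) \<in> borel_measurable cadlag_space"
    unfolding cadlag_space_def by (intro measurable_restrict_space1 measurable_component_singleton) auto
qed (simp add: space_cadlag_space)

lemma cadlag_process_compose:
  assumes g: "g \<in> N \<rightarrow>\<^sub>M cadlag_space"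
  shows "cadlag_process N (\<lambda>t \<omega>. g \<omega> t)"
  unfolding cadlag_process_def
proof safe
  fix t :: real assume "0 \<le> t"
  from measurable_compose[OF g cadlag_processD(1)[OF cadlag_process_coordinate this]]
  show "(\<lambda>\<omega>. g \<omega> t) \<in> borel_measurable N" .
next
  fix \<omega> assume "\<omega> \<in> space N"
  then have "g \<omega> \<in> space cadlag_space" by (rule measurable_space[OF g])
  then show "cadlag_on {0..} (\<lambda>t. g \<omega> t)" by (simp add: space_cadlag_space)
qed

definition stop_path :: "ereal \<Rightarrow> (real \<Rightarrow> real) \<Rightarrow> real \<Rightarrow> real" where
  "stop_path T f = (\<lambda>u\<in>{0..}. f (if ereal u \<le> T then u else real_of_ereal T))"

definition shift_path :: "real \<Rightarrow> (real \<Rightarrow> real) \<Rightarrow> real \<Rightarrow> real" where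
  "shift_path s f = (\<lambda>u\<in>{0..}. f (s + u) - f s)"

lemma shift_path_cadlag: "cadlag_on {0..} f \<Longrightarrow> s \<ge> 0 \<Longrightarrow> cadlag_on {0..} (shift_path s f)"
  unfolding shift_path_def cadlag_restrict by (rule cadlag_shift)

lemma stop_path_cadlag:
  assumes "cadlag_on {0..} f" "T \<ge> 0"
  shows "cadlag_on {0..} (stop_path T f)"
proof (cases T)
  case (real c)
  have "cadlag_on {0..} (\<lambda>u. f (min u c))" using assms real by (intro cadlag_stop) auto
  also have "(\<lambda>u. f (min u c)) = (\<lambda>u. f (if ereal u \<le> T then u else real_of_ereal T))"
    using real by (auto simp: min_def)
  finally show ?thesis unfolding stop_path_def cadlag_restrict .
qed (use assms in \<open>auto simp: stop_path_def cadlag_restrict\<close>)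

lemma measurable_stop_path:
  assumes T[measurable]: "T \<in> borel_measurable N" "\<And>\<omega>. \<omega> \<in> space N \<Longrightarrow> 0 \<le> T \<omega>"
    and g: "g \<in> N \<rightarrow>\<^sub>M cadlag_space"
  shows "(\<lambda>\<omega>. stop_path (T \<omega>) (g \<omega>)) \<in> N \<rightarrow>\<^sub>M cadlag_space"
proof -
  note Y = cadlag_process_compose[OF g]
  have "cadlag_process N (\<lambda>u \<omega>. stop_path (T \<omega>) (g \<omega>) u)"
    unfolding cadlag_process_def
  proof safe
    fix u :: real assume u: "0 \<le> u"
    have "(\<lambda>\<omega>. g \<omega> (if ereal u \<le> T \<omega> then u else real_of_ereal (T \<omega>))) \<in> borel_measurable N"
      using T u by (intro cadlag_process_at_random_time[OF Y]) (auto simp: real_of_ereal_pos)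
    then show "(\<lambda>\<omega>. stop_path (T \<omega>) (g \<omega>) u) \<in> borel_measurable N" using u by (simp add: stop_path_def)
  next
    fix \<omega> assume "\<omega> \<in> space N"
    then show "cadlag_on {0..} (stop_path (T \<omega>) (g \<omega>))"
      using cadlag_processD(2)[OF Y] T by (intro stop_path_cadlag) auto
  qed
  note measurable_cadlag_spaceI[OF this]
  also have "half_line_path (\<lambda>u \<omega>. stop_path (T \<omega>) (g \<omega>) u) = (\<lambda>\<omega>. stop_path (T \<omega>) (g \<omega>))"
    by (auto simp: half_line_path_def stop_path_def fun_eq_iff)
  finally show ?thesis .
qed

lemma measurable_shift_path:
  assumes T[measurable]: "T \<in> borel_measurable N" "\<And>\<omega>. \<omega> \<in> space N \<Longrightarrow> 0 \<le> T \<omega>"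
    and g: "g \<in> N \<rightarrow>\<^sub>M cadlag_space"
  shows "(\<lambda>\<omega>. shift_path (T \<omega>) (g \<omega>)) \<in> N \<rightarrow>\<^sub>M cadlag_space"
proof -
  note Y = cadlag_process_compose[OF g]
  have "cadlag_process N (\<lambda>u \<omega>. shift_path (T \<omega>) (g \<omega>) u)"
    unfolding cadlag_process_def
  proof safe
    fix u :: real assume u: "0 \<le> u"
    have "(\<lambda>\<omega>. g \<omega> (T \<omega> + u) - g \<omega> (T \<omega>)) \<in> borel_measurable N"
      using T u by (intro borel_measurable_diff cadlag_process_at_random_time[OF Y]) auto
    then show "(\<lambda>\<omega>. shift_path (T \<omega>) (g \<omega>) u) \<in> borel_measurable N" using u by (simp add: shift_path_def)
  next
    fix \<omega> assume "\<omega> \<in> space N"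
    then show "cadlag_on {0..} (shift_path (T \<omega>) (g \<omega>))"
      using cadlag_processD(2)[OF Y] T by (intro shift_path_cadlag) auto
  qed
  note measurable_cadlag_spaceI[OF this]
  also have "half_line_path (\<lambda>u \<omega>. shift_path (T \<omega>) (g \<omega>) u) = (\<lambda>\<omega>. shift_path (T \<omega>) (g \<omega>))"
    by (auto simp: half_line_path_def shift_path_def fun_eq_iff)
  finally show ?thesis .
qed

section \<open>The minorant as a functional of a two-sided path\<close>

definition two_sided_cadlag_process :: "'a measure \<Rightarrow> (real \<Rightarrow> 'a \<Rightarrow> real) \<Rightarrow> bool" where
  "two_sided_cadlag_process N Y \<longleftrightarrow> (\<forall>t. Y t \<in> borel_measurable N) \<and>
     (\<forall>\<omega>\<in>space N. cadlag_on UNIV (\<lambda>t. Y t \<omega>))"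

lemma two_sided_cadlag_processD:
  assumes "two_sided_cadlag_process N Y"
  shows "Y t \<in> borel_measurable N" "\<omega> \<in> space N \<Longrightarrow> cadlag_on UNIV (\<lambda>t. Y t \<omega>)"
  using assms by (auto simp: two_sided_cadlag_process_def)

lemma two_sided_cadlag_process_half_line: "two_sided_cadlag_process N Y \<Longrightarrow> cadlag_process N Y"
  by (auto simp: two_sided_cadlag_process_def cadlag_process_def cadlag_UNIV_imp_half_line)

lemma measurable_I_minus:
  assumes Y: "two_sided_cadlag_process N Y"
  shows "(\<lambda>\<omega>. I_minus \<alpha> (\<lambda>t. Y t \<omega>)) \<in> borel_measurable N"
    and I_minus_rational: "\<omega> \<in> space N \<Longrightarrow>
      I_minus \<alpha> (\<lambda>t. Y t \<omega>) = (INF u\<in>{..0} \<inter> \<rat>. ereal (Y u \<omega> - \<alpha> * u))"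
proof -
  have m: "(\<lambda>\<omega>. INF u\<in>{..0} \<inter> \<rat>. ereal (Y u \<omega> - \<alpha> * u)) \<in> borel_measurable N"
  proof (rule borel_measurable_INF)
    show "countable ({..0} \<inter> \<rat> :: real set)" by (rule countable_subset[OF _ countable_rat]) auto
    fix u :: real
    have [measurable]: "Y u \<in> borel_measurable N" using two_sided_cadlag_processD(1)[OF Y] .
    show "(\<lambda>\<omega>. ereal (Y u \<omega> - \<alpha> * u)) \<in> borel_measurable N" by measurable
  qed
  show eq: "I_minus \<alpha> (\<lambda>t. Y t \<omega>) = (INF u\<in>{..0} \<inter> \<rat>. ereal (Y u \<omega> - \<alpha> * u))"
    if "\<omega> \<in> space N" for \<omega>
    unfolding I_minus_def
  proof (rule cadlag_INF_eq_rational_INF)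
    fix t :: real
    have "((\<lambda>u. Y u \<omega> + (- \<alpha> * u)) \<longlongrightarrow> Y t \<omega> + (- \<alpha> * t)) (at_right t)"
      using two_sided_cadlag_processD(2)[OF Y that]
      by (intro tendsto_at_right_add_continuous continuous_intros) (auto simp: cadlag_UNIV_iff)
    then show "((\<lambda>u. Y u \<omega> - \<alpha> * u) \<longlongrightarrow> Y t \<omega> - \<alpha> * t) (at_right t)" by simp
    assume "t \<in> {..0}"
    then show "t \<in> \<rat> \<or> (\<exists>e>0. {t<..<t + e} \<subseteq> {..0})"
      by (cases "t = 0") (auto intro!: exI[of _ "-t"])
  qed
  show "(\<lambda>\<omega>. I_minus \<alpha> (\<lambda>t. Y t \<omega>)) \<in> borel_measurable N"
    by (subst measurable_cong[OF eq]) (auto intro: m)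
qed

lemma measurable_lipschitz_minorant:
  assumes Y: "two_sided_cadlag_process N Y"
  shows "(\<lambda>\<omega>. lipschitz_minorant \<alpha> (\<lambda>t. Y t \<omega>) t) \<in> borel_measurable N"
proof -
  have m: "(\<lambda>\<omega>. INF u\<in>UNIV \<inter> \<rat>. ereal (Y u \<omega> + \<alpha> * \<bar>t - u\<bar>)) \<in> borel_measurable N"
  proof (rule borel_measurable_INF)
    show "countable (UNIV \<inter> \<rat> :: real set)" by (rule countable_subset[OF _ countable_rat]) auto
    fix u :: real
    have [measurable]: "Y u \<in> borel_measurable N" using two_sided_cadlag_processD(1)[OF Y] .
    show "(\<lambda>\<omega>. ereal (Y u \<omega> + \<alpha> * \<bar>t - u\<bar>)) \<in> borel_measurable N" by measurable
  qed
  have eq: "lipschitz_minorant \<alpha> (\<lambda>t. Y t \<omega>) t = (INF u\<in>UNIV \<inter> \<rat>. ereal (Y u \<omega> + \<alpha> * \<bar>t - u\<bar>))"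
    if "\<omega> \<in> space N" for \<omega>
    unfolding lipschitz_minorant_def
  proof (rule cadlag_INF_eq_rational_INF)
    show "((\<lambda>u. Y u \<omega> + \<alpha> * \<bar>t - u\<bar>) \<longlongrightarrow> Y s \<omega> + \<alpha> * \<bar>t - s\<bar>) (at_right s)" for s
      using two_sided_cadlag_processD(2)[OF Y that]
      by (intro tendsto_at_right_add_continuous continuous_intros) (auto simp: cadlag_UNIV_iff)
  qed (auto intro!: exI[of _ 1])
  show ?thesis by (subst measurable_cong[OF eq], assumption) (rule m)
qed

lemma lipschitz_minorant_le_add:
  "0 \<le> \<alpha> \<Longrightarrow> lipschitz_minorant \<alpha> f t \<le> lipschitz_minorant \<alpha> f s + ereal (\<alpha> * \<bar>t - s\<bar>)"
proof -
  assume \<alpha>: "0 \<le> \<alpha>"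
  have "lipschitz_minorant \<alpha> f t - ereal (\<alpha> * \<bar>t - s\<bar>) \<le> lipschitz_minorant \<alpha> f s"
    unfolding lipschitz_minorant_def[of _ _ s]
  proof (rule INF_greatest)
    fix u
    have "lipschitz_minorant \<alpha> f t \<le> ereal (f u + \<alpha> * \<bar>t - u\<bar>)"
      unfolding lipschitz_minorant_def by (rule INF_lower) simp
    also have "\<alpha> * \<bar>t - u\<bar> \<le> \<alpha> * (\<bar>t - s\<bar> + \<bar>s - u\<bar>)" by (rule mult_left_mono) (use \<alpha> in auto)
    then have "ereal (f u + \<alpha> * \<bar>t - u\<bar>) \<le> ereal (f u + \<alpha> * \<bar>s - u\<bar>) + ereal (\<alpha> * \<bar>t - s\<bar>)"
      by (simp add: distrib_left)
    finally show "lipschitz_minorant \<alpha> f t - ereal (\<alpha> * \<bar>t - s\<bar>) \<le> ereal (f u + \<alpha> * \<bar>s - u\<bar>)"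
      by (subst ereal_minus_le) auto
  qed
  then show ?thesis by (subst (asm) ereal_minus_le) auto
qed

text \<open>A continuous real-valued minorant can be subtracted from the path, so that contact times become
zeros of lower values. Where the minorant is \<open>-\<infinity>\<close> there is no contact at all.\<close>

lemma lipschitz_minorant_dichotomy:
  assumes "0 \<le> \<alpha>"
  shows "(\<forall>t. lipschitz_minorant \<alpha> f t = -\<infinity>) \<or>
    (\<exists>m. (\<forall>t. lipschitz_minorant \<alpha> f t = ereal (m t)) \<and> continuous_on UNIV m)"
proof -
  have lt: "lipschitz_minorant \<alpha> f t \<noteq> \<infinity>" for t
  proof -
    have "lipschitz_minorant \<alpha> f t \<le> ereal (f t + \<alpha> * \<bar>t - t\<bar>)"
      unfolding lipschitz_minorant_def by (rule INF_lower) simp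
    then show ?thesis by auto
  qed
  show ?thesis
  proof (cases "\<exists>s. lipschitz_minorant \<alpha> f s = -\<infinity>")
    case True
    then obtain s where "lipschitz_minorant \<alpha> f s = -\<infinity>" by blast
    then have "lipschitz_minorant \<alpha> f t = -\<infinity>" for t
      using lipschitz_minorant_le_add[OF assms, of f t s] by simp
    then show ?thesis by blast
  next
    case False
    define m where "m t = real_of_ereal (lipschitz_minorant \<alpha> f t)" for t
    have m: "lipschitz_minorant \<alpha> f t = ereal (m t)" for t
      unfolding m_def using False lt[of t] by (cases "lipschitz_minorant \<alpha> f t") auto
    have "m t \<le> m s + \<alpha> * \<bar>t - s\<bar>" for s t
      using lipschitz_minorant_le_add[OF assms, of f t s] m by simp
    then have "dist (m s) (m t) \<le> \<alpha> * dist s t" for s t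
      unfolding dist_real_def by (smt (verit) abs_minus_commute)
    then have "\<alpha>-lipschitz_on UNIV m" using assms by (intro lipschitz_onI) auto
    then have "continuous_on UNIV m" by (rule lipschitz_on_continuous_on)
    then show ?thesis using m by blast
  qed
qed

lemma contact_set_eq_nonpos:
  assumes f: "cadlag_on UNIV f" and \<alpha>: "0 \<le> \<alpha>" and m: "\<And>t. lipschitz_minorant \<alpha> f t = ereal (m t)" "continuous_on UNIV m"
  shows "contact_set \<alpha> f \<inter> {0<..} = {t. 0 < t \<and> lower_value (\<lambda>t. f t - m t) t \<le> 0}"
proof -
  have eq: "lower_value (\<lambda>t. f t - m t) t = min (f t) (Lim (at_left t) f) - m t" if "t > 0" for t
    using lower_value_add_continuous[OF cadlag_UNIV_imp_half_line[OF f], of "\<lambda>t. - m t" t] m that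
    by (simp add: continuous_on_minus lower_value_def left_lim0_def)
  have le: "m s \<le> f s" for s
  proof -
    have "lipschitz_minorant \<alpha> f s \<le> ereal (f s + \<alpha> * \<bar>s - s\<bar>)"
      unfolding lipschitz_minorant_def by (rule INF_lower) simp
    then show ?thesis by (simp add: m)
  qed
  have ge: "m t \<le> min (f t) (Lim (at_left t) f)" for t
  proof -
    have "(f \<longlongrightarrow> Lim (at_left t) f) (at_left t)"
      using f by (intro tendsto_Lim_at_left) (auto simp: cadlag_UNIV_iff)
    then have "m t \<le> Lim (at_left t) f"
      using continuous_on_UNIV_tendsto_within[OF m(2)]
      by (rule tendsto_le[rotated]) (simp_all add: le)
    then show ?thesis using le[of t] by simp
  qed
  have "t \<in> contact_set \<alpha> f \<longleftrightarrow> lower_value (\<lambda>t. f t - m t) t \<le> 0" if "t > 0" for t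
  proof -
    have "t \<in> contact_set \<alpha> f \<longleftrightarrow> m t = min (f t) (Lim (at_left t) f)"
      unfolding contact_set_def mem_Collect_eq m(1) ereal.inject ..
    also have "\<dots> \<longleftrightarrow> min (f t) (Lim (at_left t) f) - m t \<le> 0"
      using ge[of t] by linarith
    finally show ?thesis unfolding eq[OF that] .
  qed
  then show ?thesis by auto
qed

lemma measurable_D_time:
  assumes Y: "two_sided_cadlag_process N Y" and \<alpha>: "0 \<le> \<alpha>"
  shows "(\<lambda>\<omega>. D_time \<alpha> (\<lambda>t. Y t \<omega>)) \<in> borel_measurable N"
proof -
  define L where "L t \<omega> = lipschitz_minorant \<alpha> (\<lambda>t. Y t \<omega>) t" for t \<omega>
  have [measurable]: "L t \<in> borel_measurable N" for t
    unfolding L_def by (rule measurable_lipschitz_minorant[OF Y])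
  define c where "c t \<omega> = - real_of_ereal (L t \<omega>)" for t \<omega>
  have L: "(\<forall>t. L t \<omega> = -\<infinity>) \<or> (\<exists>m. (\<forall>t. L t \<omega> = ereal (m t)) \<and> continuous_on UNIV m)" for \<omega>
    unfolding L_def by (rule lipschitz_minorant_dichotomy[OF \<alpha>])
  have c: "continuous_on UNIV (\<lambda>t. c t \<omega>)" for \<omega>
    using L[of \<omega>] by (auto simp: c_def continuous_on_minus)
  have [measurable]: "c t \<in> borel_measurable N" for t unfolding c_def by measurable
  have Y': "cadlag_process N (\<lambda>t \<omega>. Y t \<omega> + c t \<omega>)"
    by (intro cadlag_process_add_continuous two_sided_cadlag_process_half_line[OF Y] c) measurable
  note [measurable] = measurable_first_nonpos_time[OF Y']
  have "D_time \<alpha> (\<lambda>t. Y t \<omega>) = (if L 0 \<omega> = -\<infinity> then \<infinity> else first_nonpos_time (\<lambda>t. Y t \<omega> + c t \<omega>))"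
    if "\<omega> \<in> space N" for \<omega>
  proof (cases "L 0 \<omega> = -\<infinity>")
    case True
    then have "\<forall>t. L t \<omega> = -\<infinity>" using L[of \<omega>] by auto
    then have "lipschitz_minorant \<alpha> (\<lambda>t. Y t \<omega>) t = -\<infinity>" for t unfolding L_def by blast
    then have "contact_set \<alpha> (\<lambda>t. Y t \<omega>) = {}" unfolding contact_set_def by (simp del: ereal_min)
    then show ?thesis using True by (simp add: D_time_def top_ereal_def)
  next
    case False
    then obtain m where m: "\<And>t. L t \<omega> = ereal (m t)" "continuous_on UNIV m" using L[of \<omega>] by auto
    show ?thesis
      using contact_set_eq_nonpos[OF two_sided_cadlag_processD(2)[OF Y that] \<alpha> m[unfolded L_def]] m
      by (simp add: D_time_def first_nonpos_time_def c_def)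
  qed
  then show ?thesis by (subst measurable_cong) measurable
qed

lemma pred_zero_mem_contact_set:
  assumes Y: "two_sided_cadlag_process N Y"
  shows "Measurable.pred N (\<lambda>\<omega>. 0 \<in> contact_set \<alpha> (\<lambda>t. Y t \<omega>))"
proof -
  note [measurable] = measurable_lipschitz_minorant[OF Y] two_sided_cadlag_processD(1)[OF Y]
  have [measurable]: "(\<lambda>\<omega>. Lim (at_left 0) (\<lambda>t. Y t \<omega>)) \<in> borel_measurable N"
  proof (rule borel_measurable_LIMSEQ_real)
    fix \<omega> assume "\<omega> \<in> space N"
    then have "((\<lambda>t. Y t \<omega>) \<longlongrightarrow> Lim (at_left 0) (\<lambda>t. Y t \<omega>)) (at_left 0)"
      using two_sided_cadlag_processD(2)[OF Y] by (intro tendsto_Lim_at_left) (auto simp: cadlag_UNIV_iff)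
    moreover have "filterlim (\<lambda>n. - inverse (real (Suc n))) (at_left 0) sequentially"
      unfolding filterlim_at using tendsto_minus[OF LIMSEQ_inverse_real_of_nat] by simp
    ultimately show "(\<lambda>n. Y (- inverse (real (Suc n))) \<omega>) \<longlonglongrightarrow> Lim (at_left 0) (\<lambda>t. Y t \<omega>)"
      by (rule filterlim_compose)
  qed measurable
  show ?thesis unfolding contact_set_def mem_Collect_eq by measurable
qed


section \<open>Independence of past and future, stationarity\<close>

lemma strict_mono_enumeration:
  assumes "finite F" "F \<noteq> {}"
  obtains n and \<tau> :: "nat \<Rightarrow> real" where "strict_mono_on {..n} \<tau>" "\<tau> ` {..n} = F"
proof
  define l where "l = sorted_list_of_set F"
  have l: "length l = card F" "set l = F" "sorted_wrt (<) l" using assms by (auto simp: l_def)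
  then have n: "{..card F - 1} = {..<length l}" using assms card_gt_0_iff by (metis Suc_diff_1 card_gt_0_iff lessThan_Suc_atMost)
  show "strict_mono_on {..card F - 1} ((!) l)"
    unfolding n by (rule strict_mono_onI) (use l(3) in \<open>auto simp: sorted_wrt_iff_nth_less\<close>)
  show "(!) l ` {..card F - 1} = F"
    unfolding n using l(2) by (auto simp: set_conv_nth)
qed

lemma PiM_cylinder_preimage:
  assumes Y: "Y \<in> N \<rightarrow>\<^sub>M Pi\<^sub>M I M" and J: "J \<subseteq> I"
  shows "Y -` prod_emb I M J (Pi\<^sub>E J A) \<inter> space N = {\<omega>\<in>space N. \<forall>j\<in>J. Y \<omega> j \<in> A j}"
proof -
  have "Y \<omega> \<in> extensional I" "\<forall>i\<in>I. Y \<omega> i \<in> space (M i)" if "\<omega> \<in> space N" for \<omega>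
    using measurable_space[OF Y that] by (auto simp: space_PiM PiE_def)
  then show ?thesis using J by (auto simp: prod_emb_iff PiE_iff)
qed

text \<open>The cylinder sets are stable under intersection and generate the product, so independence may be
tested on them.\<close>

lemma (in prob_space) indep_var_PiM_I:
  assumes Y: "Y \<in> M \<rightarrow>\<^sub>M Pi\<^sub>M I S" and Y': "Y' \<in> M \<rightarrow>\<^sub>M Pi\<^sub>M I' S'"
    and cyl: "\<And>J J' A B. finite J \<Longrightarrow> J \<subseteq> I \<Longrightarrow> finite J' \<Longrightarrow> J' \<subseteq> I' \<Longrightarrow>
      (\<And>j. j \<in> J \<Longrightarrow> A j \<in> sets (S j)) \<Longrightarrow> (\<And>j. j \<in> J' \<Longrightarrow> B j \<in> sets (S' j)) \<Longrightarrow>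
      prob ({\<omega>\<in>space M. \<forall>j\<in>J. Y \<omega> j \<in> A j} \<inter> {\<omega>\<in>space M. \<forall>j\<in>J'. Y' \<omega> j \<in> B j}) =
      prob {\<omega>\<in>space M. \<forall>j\<in>J. Y \<omega> j \<in> A j} * prob {\<omega>\<in>space M. \<forall>j\<in>J'. Y' \<omega> j \<in> B j}"
  shows "indep_var (Pi\<^sub>M I S) Y (Pi\<^sub>M I' S') Y'"
proof -
  define E where "E = {Y -` C \<inter> space M |C. C \<in> prod_algebra I S}"
  define E' where "E' = {Y' -` C \<inter> space M |C. C \<in> prod_algebra I' S'}"
  have gen: "sigma_sets (space M) {Z -` C \<inter> space M |C. C \<in> sets (Pi\<^sub>M K R)} =
      sigma_sets (space M) {Z -` C \<inter> space M |C. C \<in> prod_algebra K R}"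
    if Z: "Z \<in> M \<rightarrow>\<^sub>M Pi\<^sub>M K R" for Z :: "'a \<Rightarrow> 'x \<Rightarrow> 'y" and K and R :: "'x \<Rightarrow> 'y measure"
  proof -
    have "Z \<in> space M \<rightarrow> (\<Pi>\<^sub>E i\<in>K. space (R i))" using measurable_space[OF Z] by (auto simp: space_PiM)
    note commute = sigma_sets_vimage_commute[OF this, of "prod_algebra K R"]
    show ?thesis
      unfolding sets_PiM commute by (rule sigma_sets_sigma_sets_eq) auto
  qed
  have stable: "Int_stable {Z -` C \<inter> space M |C. C \<in> prod_algebra K R}" for Z :: "'a \<Rightarrow> 'x \<Rightarrow> 'y" and K and R :: "'x \<Rightarrow> 'y measure"
  proof (rule Int_stableI, safe)
    fix C D assume "C \<in> prod_algebra K R" "D \<in> prod_algebra K R"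
    then have "C \<inter> D \<in> prod_algebra K R" using Int_stable_prod_algebra by (auto simp: Int_stable_def)
    then show "\<exists>Ca. Z -` C \<inter> space M \<inter> (Z -` D \<inter> space M) = Z -` Ca \<inter> space M \<and> Ca \<in> prod_algebra K R"
      by (intro exI[of _ "C \<inter> D"]) auto
  qed
  have "indep_set E E'"
    unfolding indep_sets2_eq
  proof (intro conjI ballI)
    show "E \<subseteq> events" unfolding E_def using Y by (auto intro!: measurable_sets simp: sets_PiM)
    show "E' \<subseteq> events" unfolding E'_def using Y' by (auto intro!: measurable_sets simp: sets_PiM)
    fix a b assume "a \<in> E" "b \<in> E'"
    then obtain C D where C: "a = Y -` C \<inter> space M" "C \<in> prod_algebra I S"
      and D: "b = Y' -` D \<inter> space M" "D \<in> prod_algebra I' S'" by (auto simp: E_def E'_def)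
    from C(2) obtain J A where JA: "C = prod_emb I S J (Pi\<^sub>E J A)" "finite J" "J \<subseteq> I" "\<And>j. j \<in> J \<Longrightarrow> A j \<in> sets (S j)"
      by (elim prod_algebraE) blast
    from D(2) obtain J' B where JB: "D = prod_emb I' S' J' (Pi\<^sub>E J' B)" "finite J'" "J' \<subseteq> I'" "\<And>j. j \<in> J' \<Longrightarrow> B j \<in> sets (S' j)"
      by (elim prod_algebraE) blast
    show "prob (a \<inter> b) = prob a * prob b"
      unfolding C D JA(1) JB(1) PiM_cylinder_preimage[OF Y JA(3)] PiM_cylinder_preimage[OF Y' JB(3)]
      by (rule cyl) (use JA JB in auto)
  qed
  from indep_set_sigma_sets[OF this] stable
  have "indep_set (sigma_sets (space M) E) (sigma_sets (space M) E')" unfolding E_def E'_def by blast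
  then show ?thesis
    unfolding indep_var_eq gen[OF Y] gen[OF Y'] using Y Y' by (simp add: E_def E'_def)
qed

context two_sided_levy
begin

lemma measurable_path_UNIV: "(\<lambda>\<omega> u. X (c u) \<omega> - X s \<omega>) \<in> M \<rightarrow>\<^sub>M Pi\<^sub>M UNIV (\<lambda>_. borel)"
  using random_variable_X by (intro measurable_PiM_single') auto

lemma two_sided_cadlag_process_X: "two_sided_cadlag_process M X"
  unfolding two_sided_cadlag_process_def using random_variable_X cadlag_X by auto

lemma two_sided_cadlag_process_shift: "two_sided_cadlag_process M (\<lambda>u \<omega>. X (s + u) \<omega> - X s \<omega>)"
  unfolding two_sided_cadlag_process_def
proof safe
  show "(\<lambda>\<omega>. X (s + t) \<omega> - X s \<omega>) \<in> borel_measurable M" for t using random_variable_X by measurable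
  fix \<omega> assume "\<omega> \<in> space M"
  then have X: "((\<lambda>t. X t \<omega>) \<longlongrightarrow> X t \<omega>) (at_right t)" "\<exists>l. ((\<lambda>t. X t \<omega>) \<longlongrightarrow> l) (at_left t)" for t
    using cadlag_X by (auto simp: cadlag_UNIV_iff)
  have "((\<lambda>u. X (s + u) \<omega> - X s \<omega>) \<longlongrightarrow> X (s + t) \<omega> - X s \<omega>) (at_right t)" for t
    by (intro tendsto_diff tendsto_const filterlim_compose[OF X(1) filterlim_shift_at_right])
  moreover have "\<exists>l. ((\<lambda>u. X (s + u) \<omega> - X s \<omega>) \<longlongrightarrow> l) (at_left t)" for t
  proof -
    obtain l where "((\<lambda>t. X t \<omega>) \<longlongrightarrow> l) (at_left (s + t))" using X(2) by blast
    from tendsto_diff[OF filterlim_compose[OF this filterlim_shift_at_left] tendsto_const] show ?thesis by blast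
  qed
  ultimately show "cadlag_on UNIV (\<lambda>t. X (s + t) \<omega> - X s \<omega>)" by (simp add: cadlag_UNIV_iff)
qed

lemma cadlag_process_shift: "cadlag_process M (\<lambda>u \<omega>. X (s + u) \<omega> - X s \<omega>)"
  by (rule two_sided_cadlag_process_half_line[OF two_sided_cadlag_process_shift])

lemma cadlag_process_X: "cadlag_process M X"
  by (rule two_sided_cadlag_process_half_line[OF two_sided_cadlag_process_X])

lemma measurable_half_line_shift: "half_line_path (\<lambda>u \<omega>. X (s + u) \<omega> - X s \<omega>) \<in> M \<rightarrow>\<^sub>M path_space"
  unfolding half_line_path_def using random_variable_X by (intro measurable_restrict) measurable

text \<open>Finitely many times before and after \<open>s\<close>, together with \<open>s\<close> itself, are enumerated increasingly. The
values before \<open>s\<close> are then partial sums of the increments with index below that of \<open>s\<close>, the values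
after \<open>s\<close> partial sums of the remaining increments, and the increments are independent.\<close>

lemma indep_past_future:
  "indep_var (Pi\<^sub>M UNIV (\<lambda>_. borel)) (\<lambda>\<omega> u. X (min u s) \<omega> - X s \<omega>)
     path_space (half_line_path (\<lambda>u \<omega>. X (s + u) \<omega> - X s \<omega>))"
proof (rule indep_var_PiM_I[OF measurable_path_UNIV measurable_half_line_shift])
  fix J K :: "real set" and A B :: "real \<Rightarrow> real set"
  assume J: "finite J" and K: "finite K" "K \<subseteq> {0..}"
    and A: "\<And>j. j \<in> J \<Longrightarrow> A j \<in> sets borel" and B: "\<And>j. j \<in> K \<Longrightarrow> B j \<in> sets borel"
  define F where "F = insert s ((\<lambda>u. min u s) ` J \<union> (\<lambda>u. s + u) ` K)"
  have "finite F" "F \<noteq> {}" using J K by (auto simp: F_def)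
  then obtain n :: nat and \<tau> :: "nat \<Rightarrow> real" where \<tau>: "strict_mono_on {..n} \<tau>" "\<tau> ` {..n} = F" by (rule strict_mono_enumeration)
  have ordered: "i \<le> j" if "\<tau> i \<le> \<tau> j" "i \<le> n" "j \<le> n" for i j
  proof (rule ccontr)
    assume "\<not> i \<le> j"
    then have "\<tau> j < \<tau> i" using that by (intro strict_mono_onD[OF \<tau>(1)]) auto
    then show False using that by simp
  qed
  obtain k where k: "k \<le> n" "\<tau> k = s" using \<tau>(2) by (force simp: F_def)
  have "\<exists>m\<le>k. \<tau> m = min u s" if "u \<in> J" for u
  proof -
    have "min u s \<in> \<tau> ` {..n}" unfolding \<tau>(2) F_def using that by blast
    then obtain m where "m \<le> n" "\<tau> m = min u s" by auto
    with ordered[of m k] k show ?thesis by auto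
  qed
  then have "\<forall>u\<in>J. \<exists>m. m \<le> k \<and> \<tau> m = min u s" by blast
  from bchoice[OF this] obtain p where p: "\<And>u. u \<in> J \<Longrightarrow> p u \<le> k \<and> \<tau> (p u) = min u s" by blast
  have "\<exists>m\<in>{k..n}. \<tau> m = s + u" if "u \<in> K" for u
  proof -
    have "s + u \<in> \<tau> ` {..n}" unfolding \<tau>(2) F_def using that by blast
    then obtain m where "m \<le> n" "\<tau> m = s + u" by auto
    moreover have "u \<ge> 0" using that K by auto
    ultimately show ?thesis using ordered[of k m] k by auto
  qed
  then have "\<forall>u\<in>K. \<exists>m. k \<le> m \<and> m \<le> n \<and> \<tau> m = s + u" by (meson atLeastAtMost_iff)
  from bchoice[OF this] obtain q where q: "\<And>u. u \<in> K \<Longrightarrow> k \<le> q u \<and> q u \<le> n \<and> \<tau> (q u) = s + u" by blast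
  define \<Delta> where "\<Delta> i \<omega> = X (\<tau> (Suc i)) \<omega> - X (\<tau> i) \<omega>" for i \<omega>
  have tele: "(\<Sum>i=a..<b. \<Delta> i \<omega>) = X (\<tau> b) \<omega> - X (\<tau> a) \<omega>" if "a \<le> b" for a b \<omega>
    unfolding \<Delta>_def using that by (rule sum_Suc_diff')
  have ind: "indep_vars (\<lambda>_. borel) \<Delta> {..<n}" unfolding \<Delta>_def by (rule independent_increments[OF \<tau>(1)])
  define P where "P = {d\<in>space (Pi\<^sub>M {..<k} (\<lambda>_. borel)). \<forall>u\<in>J. - (\<Sum>i=p u..<k. d i) \<in> A u}"
  define Q where "Q = {d\<in>space (Pi\<^sub>M {k..<n} (\<lambda>_. borel)). \<forall>u\<in>K. (\<Sum>i=k..<q u. d i) \<in> B u}"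
  have "P \<in> sets (Pi\<^sub>M {..<k} (\<lambda>_. borel))"
    unfolding P_def
  proof (rule sets.sets_Collect_finite_All[OF _ J])
    fix u assume "u \<in> J"
    have [measurable]: "(\<lambda>d. \<Sum>i=p u..<k. (d i :: real)) \<in> borel_measurable (Pi\<^sub>M {..<k} (\<lambda>_. borel))"
      by (intro borel_measurable_sum measurable_component_singleton) auto
    have [measurable]: "A u \<in> sets borel" using A \<open>u \<in> J\<close> .
    show "{d \<in> space (Pi\<^sub>M {..<k} (\<lambda>_. borel)). - (\<Sum>i=p u..<k. d i) \<in> A u} \<in> sets (Pi\<^sub>M {..<k} (\<lambda>_. borel))"
      by measurable
  qed
  moreover have "Q \<in> sets (Pi\<^sub>M {k..<n} (\<lambda>_. borel))"
    unfolding Q_def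
  proof (rule sets.sets_Collect_finite_All[OF _ K(1)])
    fix u assume "u \<in> K"
    have [measurable]: "(\<lambda>d. \<Sum>i=k..<q u. (d i :: real)) \<in> borel_measurable (Pi\<^sub>M {k..<n} (\<lambda>_. borel))"
      using q[OF \<open>u \<in> K\<close>] by (intro borel_measurable_sum measurable_component_singleton) auto
    have [measurable]: "B u \<in> sets borel" using B \<open>u \<in> K\<close> .
    show "{d \<in> space (Pi\<^sub>M {k..<n} (\<lambda>_. borel)). (\<Sum>i=k..<q u. d i) \<in> B u} \<in> sets (Pi\<^sub>M {k..<n} (\<lambda>_. borel))"
      by measurable
  qed
  ultimately
  have "prob ((\<lambda>\<omega>. (restrict (\<lambda>i. \<Delta> i \<omega>) {..<k}, restrict (\<lambda>i. \<Delta> i \<omega>) {k..<n})) -` (P \<times> Q) \<inter> space M) =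
    prob ((\<lambda>\<omega>. restrict (\<lambda>i. \<Delta> i \<omega>) {..<k}) -` P \<inter> space M) *
    prob ((\<lambda>\<omega>. restrict (\<lambda>i. \<Delta> i \<omega>) {k..<n}) -` Q \<inter> space M)"
    using k by (intro indep_varD[OF indep_var_restrict[OF ind]]) auto
  moreover have split: "(\<lambda>\<omega>. (restrict (\<lambda>i. \<Delta> i \<omega>) {..<k}, restrict (\<lambda>i. \<Delta> i \<omega>) {k..<n})) -` (P \<times> Q) \<inter> space M =
    ((\<lambda>\<omega>. restrict (\<lambda>i. \<Delta> i \<omega>) {..<k}) -` P \<inter> space M) \<inter> ((\<lambda>\<omega>. restrict (\<lambda>i. \<Delta> i \<omega>) {k..<n}) -` Q \<inter> space M)"
    by auto
  moreover have "(\<lambda>\<omega>. restrict (\<lambda>i. \<Delta> i \<omega>) {..<k}) -` P \<inter> space M = {\<omega>\<in>space M. \<forall>u\<in>J. X (min u s) \<omega> - X s \<omega> \<in> A u}"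
  proof -
    have "- (\<Sum>i=p u..<k. restrict (\<lambda>i. \<Delta> i \<omega>) {..<k} i) = X (min u s) \<omega> - X s \<omega>" if "u \<in> J" for u \<omega>
      using tele[of "p u" k \<omega>] p[OF that] k by simp
    then show ?thesis by (auto simp: P_def space_PiM)
  qed
  moreover have "(\<lambda>\<omega>. restrict (\<lambda>i. \<Delta> i \<omega>) {k..<n}) -` Q \<inter> space M =
      {\<omega>\<in>space M. \<forall>u\<in>K. half_line_path (\<lambda>u \<omega>. X (s + u) \<omega> - X s \<omega>) \<omega> u \<in> B u}"
  proof -
    have "(\<Sum>i=k..<q u. restrict (\<lambda>i. \<Delta> i \<omega>) {k..<n} i) = half_line_path (\<lambda>u \<omega>. X (s + u) \<omega> - X s \<omega>) \<omega> u"
      if "u \<in> K" for u \<omega>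
    proof -
      have "u \<ge> 0" using that K by auto
      have "(\<Sum>i=k..<q u. restrict (\<lambda>i. \<Delta> i \<omega>) {k..<n} i) = (\<Sum>i=k..<q u. \<Delta> i \<omega>)"
        using q[OF that] by (intro sum.cong) auto
      then show ?thesis
        using tele[of k "q u" \<omega>] q[OF that] k \<open>u \<ge> 0\<close> by (simp add: half_line_path_def)
    qed
    then show ?thesis by (auto simp: Q_def space_PiM)
  qed
  ultimately show "prob ({\<omega>\<in>space M. \<forall>j\<in>J. X (min j s) \<omega> - X s \<omega> \<in> A j} \<inter>
      {\<omega>\<in>space M. \<forall>j\<in>K. half_line_path (\<lambda>u \<omega>. X (s + u) \<omega> - X s \<omega>) \<omega> j \<in> B j}) =
      prob {\<omega>\<in>space M. \<forall>j\<in>J. X (min j s) \<omega> - X s \<omega> \<in> A j} *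
      prob {\<omega>\<in>space M. \<forall>j\<in>K. half_line_path (\<lambda>u \<omega>. X (s + u) \<omega> - X s \<omega>) \<omega> j \<in> B j}"
    by (simp only:)
qed


text \<open>A finite-dimensional distribution of the shifted process is the image of the product of its increment
laws, and by stationarity these do not depend on the shift \<open>s\<close>, which is absent from the right-hand
side.\<close>

lemma shift_cylinder_probability:
  assumes s: "strict_mono_on {..n} \<tau>" and n: "0 < (n::nat)" and k: "k \<le> n" "\<tau> k = 0"
    and p: "\<And>j. j \<in> J \<Longrightarrow> p j \<le> n \<and> \<tau> (p j) = j"
    and J: "finite J" and A: "\<And>j. j \<in> J \<Longrightarrow> A j \<in> sets borel"
  defines "G \<equiv> \<lambda>d j. (\<Sum>i<p j. d i) - (\<Sum>i<k. d i)"
  shows "emeasure M {\<omega>\<in>space M. \<forall>j\<in>J. X (s + j) \<omega> - X s \<omega> \<in> A j} =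
    emeasure (\<Pi>\<^sub>M i\<in>{..<n}. distr M borel (X (\<tau> (Suc i) - \<tau> i)))
      {d\<in>space (Pi\<^sub>M {..<n} (\<lambda>_. borel)). \<forall>j\<in>J. G d j \<in> A j}"
proof -
  define \<Delta> where "\<Delta> i \<omega> = X (s + \<tau> (Suc i)) \<omega> - X (s + \<tau> i) \<omega>" for i \<omega>
  define D where "D \<omega> = (\<lambda>i\<in>{..<n}. \<Delta> i \<omega>)" for \<omega>
  have mono: "strict_mono_on {..n} (\<lambda>i. s + \<tau> i)"
    using s by (auto simp: strict_mono_on_def)
  have ind: "indep_vars (\<lambda>_. borel) \<Delta> {..<n}" unfolding \<Delta>_def by (rule independent_increments[OF mono])
  have rv[measurable]: "random_variable borel (\<Delta> i)" for i unfolding \<Delta>_def using random_variable_X by measurable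
  have D[measurable]: "D \<in> M \<rightarrow>\<^sub>M Pi\<^sub>M {..<n} (\<lambda>_. borel)" unfolding D_def by measurable
  have ne: "{..<n} \<noteq> {}" using n by (auto simp: lessThan_empty_iff)
  have "distr M (Pi\<^sub>M {..<n} (\<lambda>_. borel)) D = (\<Pi>\<^sub>M i\<in>{..<n}. distr M borel (\<Delta> i))"
    using ind ne indep_vars_iff_distr_eq_PiM[where I="{..<n}" and M'="\<lambda>_. borel" and X=\<Delta>, OF _ rv] by (simp add: D_def[abs_def])
  also have "\<dots> = (\<Pi>\<^sub>M i\<in>{..<n}. distr M borel (X (\<tau> (Suc i) - \<tau> i)))"
  proof (rule PiM_cong[OF refl])
    fix i assume "i \<in> {..<n}"
    then have "\<tau> i < \<tau> (Suc i)" using s by (auto simp: strict_mono_on_def)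
    then show "distr M borel (\<Delta> i) = distr M borel (X (\<tau> (Suc i) - \<tau> i))"
      unfolding \<Delta>_def by (subst stationary_increments) auto
  qed
  finally have law: "distr M (Pi\<^sub>M {..<n} (\<lambda>_. borel)) D = (\<Pi>\<^sub>M i\<in>{..<n}. distr M borel (X (\<tau> (Suc i) - \<tau> i)))" .
  have C: "{d\<in>space (Pi\<^sub>M {..<n} (\<lambda>_. borel)). \<forall>j\<in>J. G d j \<in> A j} \<in> sets (Pi\<^sub>M {..<n} (\<lambda>_. borel))"
  proof (rule sets.sets_Collect_finite_All[OF _ J])
    fix u assume "u \<in> J"
    have [measurable]: "(\<lambda>d. G d u) \<in> borel_measurable (Pi\<^sub>M {..<n} (\<lambda>_. borel))"
      unfolding G_def using p[OF \<open>u \<in> J\<close>] k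
      by (intro borel_measurable_diff borel_measurable_sum measurable_component_singleton) auto
    have [measurable]: "A u \<in> sets borel" using A \<open>u \<in> J\<close> .
    show "{d \<in> space (Pi\<^sub>M {..<n} (\<lambda>_. borel)). G d u \<in> A u} \<in> sets (Pi\<^sub>M {..<n} (\<lambda>_. borel))"
      by measurable
  qed
  have tele: "(\<Sum>i<m. D \<omega> i) = X (s + \<tau> m) \<omega> - X (s + \<tau> 0) \<omega>" if "m \<le> n" for m \<omega>
  proof -
    have "(\<Sum>i<m. D \<omega> i) = (\<Sum>i<m. \<Delta> i \<omega>)" using that by (intro sum.cong) (auto simp: D_def)
    then show ?thesis unfolding \<Delta>_def by (simp add: sum_lessThan_telescope[of "\<lambda>m. X (s + \<tau> m) \<omega>"])
  qed
  have "G (D \<omega>) j = X (s + j) \<omega> - X s \<omega>" if "j \<in> J" for j \<omega>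
    unfolding G_def using tele[of "p j" \<omega>] tele[of k \<omega>] p[OF that] k by simp
  then have "{\<omega>\<in>space M. \<forall>j\<in>J. X (s + j) \<omega> - X s \<omega> \<in> A j} =
      D -` {d\<in>space (Pi\<^sub>M {..<n} (\<lambda>_. borel)). \<forall>j\<in>J. G d j \<in> A j} \<inter> space M"
    using measurable_space[OF D] by auto
  then show ?thesis unfolding law[symmetric] using C by (simp add: emeasure_distr)
qed

lemma shift_law:
  "distr M (Pi\<^sub>M UNIV (\<lambda>_. borel)) (\<lambda>\<omega> u. X (s + u) \<omega> - X s \<omega>) = distr M (Pi\<^sub>M UNIV (\<lambda>_. borel)) (\<lambda>\<omega> u. X u \<omega>)"
  (is "?P = ?Q")
proof (rule measure_eqI_PiM_infinite)
  show "finite_measure ?P" by (intro finite_measure_distr measurable_path_UNIV)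
  fix A :: "real \<Rightarrow> real set" and J assume J: "finite J" and A: "\<And>i. i \<in> J \<Longrightarrow> A i \<in> sets (borel :: real measure)"
  \<comment> \<open>time \<open>0\<close> serves as the origin of the partial sums; the second point ensures that there is at least one increment\<close>
  have "finite (insert 0 (insert 1 J))" "insert 0 (insert 1 J) \<noteq> {}" using J by auto
  then obtain n :: nat and \<tau> :: "nat \<Rightarrow> real"
    where \<tau>: "strict_mono_on {..n} \<tau>" "\<tau> ` {..n} = insert 0 (insert 1 J)" by (rule strict_mono_enumeration)
  have hit: "\<exists>m. m \<le> n \<and> \<tau> m = j" if "j \<in> insert 0 (insert 1 J)" for j
    using that unfolding \<tau>(2)[symmetric] by auto
  obtain k where k: "k \<le> n" "\<tau> k = 0" using hit[of 0] by auto
  obtain l where l: "l \<le> n" "\<tau> l = 1" using hit[of 1] by auto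
  have n: "0 < n" using k l by (cases n) auto
  have "\<forall>j\<in>J. \<exists>m. m \<le> n \<and> \<tau> m = j" using hit by blast
  from bchoice[OF this] obtain p where p: "\<And>j. j \<in> J \<Longrightarrow> p j \<le> n \<and> \<tau> (p j) = j" by blast
  have cyl: "emeasure (distr M (Pi\<^sub>M UNIV (\<lambda>_. borel)) (\<lambda>\<omega> u. X (r + u) \<omega> - X r \<omega>))
      (prod_emb UNIV (\<lambda>_. borel) J (Pi\<^sub>E J A)) = emeasure M {\<omega>\<in>space M. \<forall>j\<in>J. X (r + j) \<omega> - X r \<omega> \<in> A j}" for r
  proof -
    note m = measurable_path_UNIV[where c="\<lambda>u. r + u" and s=r]
    show ?thesis
      by (subst emeasure_distr[OF m sets_PiM_I])
        (use J A PiM_cylinder_preimage[OF m, of J A] in auto)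
  qed
  have "X 0 \<omega> = 0" if "\<omega> \<in> space M" for \<omega> using X_zero that by auto
  then have Q: "?Q = distr M (Pi\<^sub>M UNIV (\<lambda>_. borel)) (\<lambda>\<omega> u. X (0 + u) \<omega> - X 0 \<omega>)"
    by (intro distr_cong) auto
  show "emeasure ?P (prod_emb UNIV (\<lambda>_. borel) J (Pi\<^sub>E J A)) = emeasure ?Q (prod_emb UNIV (\<lambda>_. borel) J (Pi\<^sub>E J A))"
    unfolding Q cyl
    using shift_cylinder_probability[OF \<tau>(1) n k p J A, where s=s] shift_cylinder_probability[OF \<tau>(1) n k p J A, where s=0]
    by simp
qed auto

end


section \<open>The law of the path on the half-line\<close>

lemma vimage_cadlag_space:
  assumes Y: "Y \<in> N \<rightarrow>\<^sub>M cadlag_space"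
  shows "{Y -` A \<inter> space N |A. A \<in> sets cadlag_space} = {Y -` A \<inter> space N |A. A \<in> sets path_space}"
proof -
  have c: "cadlag_on {0..} (Y \<omega>)" if "\<omega> \<in> space N" for \<omega>
    using measurable_space[OF Y that] by (simp add: space_cadlag_space)
  have e: "Y -` ({f. cadlag_on {0..} f} \<inter> A) \<inter> space N = Y -` A \<inter> space N" for A using c by auto
  have "sets cadlag_space = (\<inter>) {f. cadlag_on {0..} f} ` sets path_space"
    unfolding cadlag_space_def by (rule sets_restrict_space)
  then show ?thesis unfolding Setcompr_eq_image by (simp only: image_image e)
qed

lemma measurable_cadlag_space_path_space:
  "Y \<in> N \<rightarrow>\<^sub>M cadlag_space \<Longrightarrow> Y \<in> N \<rightarrow>\<^sub>M path_space"
  unfolding cadlag_space_def by (auto simp: measurable_restrict_space2_iff)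

lemma distr_cadlag_space_eqI:
  assumes Y: "Y \<in> N \<rightarrow>\<^sub>M cadlag_space" and Z: "Z \<in> N' \<rightarrow>\<^sub>M cadlag_space"
    and eq: "distr N path_space Y = distr N' path_space Z"
  shows "distr N cadlag_space Y = distr N' cadlag_space Z"
proof (rule measure_eqI)
  fix A assume "A \<in> sets (distr N cadlag_space Y)"
  then have A: "A \<in> sets cadlag_space" by simp
  then obtain B where B: "B \<in> sets path_space" "A = {f. cadlag_on {0..} f} \<inter> B"
    unfolding cadlag_space_def by (auto simp: sets_restrict_space)
  have v: "V -` A \<inter> space L = V -` B \<inter> space L" if V: "V \<in> L \<rightarrow>\<^sub>M cadlag_space" for V and L :: "'x measure"
    using measurable_space[OF V] by (auto simp: B space_cadlag_space)
  have "emeasure (distr N cadlag_space Y) A = emeasure (distr N path_space Y) B"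
    using A B Y v[OF Y] by (simp add: emeasure_distr measurable_cadlag_space_path_space)
  also have "\<dots> = emeasure (distr N' cadlag_space Z) A"
    using A B Z v[OF Z] unfolding eq by (simp add: emeasure_distr measurable_cadlag_space_path_space)
  finally show "emeasure (distr N cadlag_space Y) A = emeasure (distr N' cadlag_space Z) A" .
qed simp

text \<open>The Markov property at fixed times, on path space. It also contains stationarity: the second marginal
on the left is the law of the shifted path.\<close>

locale levy_law = prob_space W for W :: "(real \<Rightarrow> real) measure" +
  assumes sets_W: "sets W = sets cadlag_space"
    and starts_at_zero: "AE f in W. f 0 = 0"
    and markov: "\<And>b. 0 \<le> b \<Longrightarrow>
      distr W (cadlag_space \<Otimes>\<^sub>M cadlag_space) (\<lambda>f. (stop_path (ereal b) f, shift_path b f)) =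
      distr W cadlag_space (stop_path (ereal b)) \<Otimes>\<^sub>M W"

lemma stop_half_line_path:
  "0 \<le> b \<Longrightarrow> stop_path (ereal b) (half_line_path Y \<omega>) = half_line_path (\<lambda>u \<omega>. Y (min u b) \<omega>) \<omega>"
  by (auto simp: stop_path_def half_line_path_def min_def)

lemma shift_half_line_path:
  "0 \<le> b \<Longrightarrow> shift_path b (half_line_path Y \<omega>) = half_line_path (\<lambda>u \<omega>. Y (b + u) \<omega> - Y b \<omega>) \<omega>"
  by (auto simp: shift_path_def half_line_path_def)

lemma measurable_stop_path_const: "0 \<le> b \<Longrightarrow> stop_path (ereal b) \<in> cadlag_space \<rightarrow>\<^sub>M cadlag_space"
  using measurable_stop_path[of "\<lambda>_. ereal b" cadlag_space "\<lambda>f. f"] by simp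

lemma measurable_shift_path_const: "0 \<le> b \<Longrightarrow> shift_path b \<in> cadlag_space \<rightarrow>\<^sub>M cadlag_space"
  using measurable_shift_path[of "\<lambda>_. b" cadlag_space "\<lambda>f. f"] by simp

context two_sided_levy
begin

definition path_law :: "(real \<Rightarrow> real) measure" where
  "path_law = distr M cadlag_space (half_line_path X)"

lemma measurable_half_line_X: "half_line_path X \<in> M \<rightarrow>\<^sub>M cadlag_space"
  by (rule measurable_cadlag_spaceI[OF cadlag_process_X])

lemma distr_shift: "distr M cadlag_space (half_line_path (\<lambda>u \<omega>. X (s + u) \<omega> - X s \<omega>)) = path_law"
  unfolding path_law_def
proof (rule distr_cadlag_space_eqI)
  show "half_line_path (\<lambda>u \<omega>. X (s + u) \<omega> - X s \<omega>) \<in> M \<rightarrow>\<^sub>M cadlag_space"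
    by (rule measurable_cadlag_spaceI[OF cadlag_process_shift])
  show "half_line_path X \<in> M \<rightarrow>\<^sub>M cadlag_space" by (rule measurable_half_line_X)
  define r :: "(real \<Rightarrow> real) \<Rightarrow> real \<Rightarrow> real" where "r f = restrict f {0..}" for f
  have r: "r \<in> Pi\<^sub>M UNIV (\<lambda>_. borel) \<rightarrow>\<^sub>M path_space" unfolding r_def by measurable
  have m: "(\<lambda>\<omega> u. X u \<omega>) \<in> M \<rightarrow>\<^sub>M Pi\<^sub>M UNIV (\<lambda>_. borel)"
    using random_variable_X by (intro measurable_PiM_single') auto
  have "distr M path_space (half_line_path (\<lambda>u \<omega>. X (s + u) \<omega> - X s \<omega>)) =
      distr (distr M (Pi\<^sub>M UNIV (\<lambda>_. borel)) (\<lambda>\<omega> u. X (s + u) \<omega> - X s \<omega>)) path_space r"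
    by (subst distr_distr[OF r measurable_path_UNIV]) (simp add: comp_def r_def half_line_path_def[abs_def])
  also have "\<dots> = distr (distr M (Pi\<^sub>M UNIV (\<lambda>_. borel)) (\<lambda>\<omega> u. X u \<omega>)) path_space r"
    unfolding shift_law ..
  also have "\<dots> = distr M path_space (half_line_path X)"
    by (subst distr_distr[OF r m]) (simp add: comp_def r_def half_line_path_def[abs_def])
  finally show "distr M path_space (half_line_path (\<lambda>u \<omega>. X (s + u) \<omega> - X s \<omega>)) = distr M path_space (half_line_path X)" .
qed

lemma indep_var_of_past_and_future:
  assumes "h \<in> Pi\<^sub>M UNIV (\<lambda>_. borel) \<rightarrow>\<^sub>M S"
  shows "indep_var S (\<lambda>\<omega>. h (\<lambda>u. X (min u s) \<omega> - X s \<omega>)) cadlag_space (half_line_path (\<lambda>u \<omega>. X (s + u) \<omega> - X s \<omega>))"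
proof -
  note m = measurable_cadlag_spaceI[OF cadlag_process_shift]
  have "indep_var S (h \<circ> (\<lambda>\<omega> u. X (min u s) \<omega> - X s \<omega>)) path_space (id \<circ> half_line_path (\<lambda>u \<omega>. X (s + u) \<omega> - X s \<omega>))"
    by (rule indep_var_compose[OF indep_past_future assms]) simp
  then show ?thesis unfolding indep_var_eq vimage_cadlag_space[OF m] using m by (simp add: comp_def)
qed

lemma levy_law_path_law: "levy_law path_law"
proof -
  interpret W: prob_space path_law
    unfolding path_law_def by (rule prob_space_distr[OF measurable_half_line_X])
  show ?thesis
  proof
    show "sets path_law = sets cadlag_space" by (simp add: path_law_def)
    have [measurable]: "(\<lambda>f. f 0) \<in> borel_measurable cadlag_space"
      using cadlag_processD(1)[OF cadlag_process_coordinate] by simp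
    show "AE f in path_law. f 0 = 0"
      unfolding path_law_def
      by (subst AE_distr_iff[OF measurable_half_line_X]) (measurable, simp add: half_line_path_def X_zero)
    fix b :: real assume b: "0 \<le> b"
    note stop = measurable_stop_path_const[OF b] and shift = measurable_shift_path_const[OF b]
    define Y where "Y = (\<lambda>\<omega>. stop_path (ereal b) (half_line_path X \<omega>))"
    define h :: "(real \<Rightarrow> real) \<Rightarrow> real \<Rightarrow> real" where "h g = (\<lambda>u\<in>{0..}. g u - g 0)" for g
    have h: "h \<in> Pi\<^sub>M UNIV (\<lambda>_. borel) \<rightarrow>\<^sub>M path_space" unfolding h_def by measurable
    have Y: "Y \<in> M \<rightarrow>\<^sub>M cadlag_space" unfolding Y_def by (rule measurable_compose[OF measurable_half_line_X stop])
    have Yh: "Y \<omega> = h (\<lambda>u. X (min u b) \<omega> - X b \<omega>)" if "\<omega> \<in> space M" for \<omega>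
      using b X_zero[OF that] unfolding Y_def stop_half_line_path[OF b] unfolding half_line_path_def h_def by auto
    have "indep_var path_space Y cadlag_space (half_line_path (\<lambda>u \<omega>. X (b + u) \<omega> - X b \<omega>)) \<longleftrightarrow>
        indep_var path_space (\<lambda>\<omega>. h (\<lambda>u. X (min u b) \<omega> - X b \<omega>)) cadlag_space (half_line_path (\<lambda>u \<omega>. X (b + u) \<omega> - X b \<omega>))"
      unfolding indep_var_eq using Yh
      by (intro arg_cong2[where f="(\<and>)"] arg_cong2[where f=indep_set] refl measurable_cong arg_cong2[where f=sigma_sets])
        (auto intro!: Collect_cong ex_cong1 simp: vimage_def)
    then have "indep_var path_space Y cadlag_space (half_line_path (\<lambda>u \<omega>. X (b + u) \<omega> - X b \<omega>))"
      using indep_var_of_past_and_future[OF h] by blast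
    then have "indep_var cadlag_space Y cadlag_space (half_line_path (\<lambda>u \<omega>. X (b + u) \<omega> - X b \<omega>))"
      unfolding indep_var_eq vimage_cadlag_space[OF Y] using Y by simp
    then have ind: "distr M cadlag_space Y \<Otimes>\<^sub>M path_law =
        distr M (cadlag_space \<Otimes>\<^sub>M cadlag_space) (\<lambda>\<omega>. (Y \<omega>, half_line_path (\<lambda>u \<omega>. X (b + u) \<omega> - X b \<omega>) \<omega>))"
      unfolding indep_var_distribution_eq distr_shift by simp
    have "distr path_law (cadlag_space \<Otimes>\<^sub>M cadlag_space) (\<lambda>f. (stop_path (ereal b) f, shift_path b f)) =
       distr M (cadlag_space \<Otimes>\<^sub>M cadlag_space) (\<lambda>\<omega>. (Y \<omega>, half_line_path (\<lambda>u \<omega>. X (b + u) \<omega> - X b \<omega>) \<omega>))"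
      unfolding path_law_def
      by (subst distr_distr[OF measurable_Pair[OF stop shift] measurable_half_line_X])
        (simp add: comp_def Y_def shift_half_line_path[OF b])
    also have "\<dots> = distr path_law cadlag_space (stop_path (ereal b)) \<Otimes>\<^sub>M path_law"
      unfolding ind[symmetric] path_law_def
      by (subst distr_distr[OF stop measurable_half_line_X]) (simp add: comp_def Y_def)
    finally show "distr path_law (cadlag_space \<Otimes>\<^sub>M cadlag_space) (\<lambda>f. (stop_path (ereal b) f, shift_path b f)) =
        distr path_law cadlag_space (stop_path (ereal b)) \<Otimes>\<^sub>M path_law" .
  qed
qed

end

lemma tendsto_prod_ennreal:
  fixes g :: "'x \<Rightarrow> 'y \<Rightarrow> real"
  assumes "\<And>j. j \<in> J \<Longrightarrow> (g j \<longlongrightarrow> l j) F" "\<And>j x. j \<in> J \<Longrightarrow> 0 \<le> g j x" "\<And>j. j \<in> J \<Longrightarrow> 0 \<le> l j"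
  shows "((\<lambda>x. \<Prod>j\<in>J. ennreal (g j x)) \<longlongrightarrow> (\<Prod>j\<in>J. ennreal (l j))) F"
proof -
  have "((\<lambda>x. ennreal (\<Prod>j\<in>J. g j x)) \<longlongrightarrow> ennreal (\<Prod>j\<in>J. l j)) F"
    by (intro tendsto_ennrealI tendsto_prod assms)
  then show ?thesis using assms by (simp add: prod_ennreal)
qed

text \<open>Continuous test functions are needed because strong Markov at a general time is a limit of strong
Markov at grid times, along which the shifted paths converge only pointwise.\<close>

lemma cadlag_space_test_function_eqI:
  assumes P: "sets P = sets cadlag_space" "finite_measure P" and Q: "sets Q = sets cadlag_space" "finite_measure Q"
    and eq: "\<And>J \<phi>. finite J \<Longrightarrow> J \<subseteq> {0..} \<Longrightarrow> (\<And>j. continuous_on UNIV (\<phi> j)) \<Longrightarrow>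
      (\<And>j x. 0 \<le> \<phi> j x \<and> \<phi> j x \<le> (1::real)) \<Longrightarrow>
      (\<integral>\<^sup>+f. (\<Prod>j\<in>J. ennreal (\<phi> j (f j))) \<partial>P) = (\<integral>\<^sup>+f. (\<Prod>j\<in>J. ennreal (\<phi> j (f j))) \<partial>Q)"
  shows "P = Q"
proof -
  have coord: "(\<lambda>f. f j) \<in> borel_measurable R" if "sets R = sets cadlag_space" "j \<ge> 0" for j and R :: "(real \<Rightarrow> real) measure"
    using cadlag_processD(1)[OF cadlag_process_coordinate that(2)] by (simp cong: measurable_cong_sets add: that(1))
  \<comment> \<open>the probabilities of cylinders over open half-lines, which form a generator\<close>
  have cyl: "emeasure P {f\<in>space P. \<forall>j\<in>J. f j < a j} = emeasure Q {f\<in>space Q. \<forall>j\<in>J. f j < a j}"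
    if J: "finite J" "J \<subseteq> {0..}" for J a
  proof -
    \<comment> \<open>increases to the indicator of the half-line below \<open>a j\<close>\<close>
    define \<phi> where "\<phi> m j x = min 1 (max 0 (real m * (a j - x)))" for m j x
    have lim: "(\<lambda>m. \<integral>\<^sup>+f. (\<Prod>j\<in>J. ennreal (\<phi> m j (f j))) \<partial>R) \<longlonglongrightarrow> emeasure R {f\<in>space R. \<forall>j\<in>J. f j < a j}"
      if R: "sets R = sets cadlag_space" "finite_measure R" for R
    proof -
      interpret R: finite_measure R by fact
      have [measurable]: "(\<lambda>f. f j) \<in> borel_measurable R" if "j \<in> J" for j using coord[OF R(1)] J that by auto
      have S: "{f\<in>space R. \<forall>j\<in>J. f j < a j} \<in> sets R"
        by (rule sets.sets_Collect_finite_All[OF _ J(1)]) measurable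
      have "(\<lambda>m. \<integral>\<^sup>+f. (\<Prod>j\<in>J. ennreal (\<phi> m j (f j))) \<partial>R) \<longlonglongrightarrow>
          (\<integral>\<^sup>+f. indicator {f\<in>space R. \<forall>j\<in>J. f j < a j} f \<partial>R)"
      proof (rule nn_integral_dominated_convergence[where w="\<lambda>_. 1"])
        show "(\<lambda>f. \<Prod>j\<in>J. ennreal (\<phi> m j (f j))) \<in> borel_measurable R" for m
          unfolding \<phi>_def by (intro borel_measurable_prod_ennreal) measurable
        show "AE f in R. (\<Prod>j\<in>J. ennreal (\<phi> m j (f j))) \<le> 1" for m
          by (intro AE_I2 prod_le_1) (auto simp: \<phi>_def)
        show "(\<integral>\<^sup>+f. 1 \<partial>R) < \<infinity>" by (simp add: R.emeasure_finite less_top[symmetric])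
        show "AE f in R. (\<lambda>m. \<Prod>j\<in>J. ennreal (\<phi> m j (f j))) \<longlonglongrightarrow> indicator {f\<in>space R. \<forall>j\<in>J. f j < a j} f"
        proof (rule AE_I2)
          fix f assume f: "f \<in> space R"
          have "(\<lambda>m. \<phi> m j (f j)) \<longlonglongrightarrow> indicator {..<a j} (f j)" for j
          proof (cases "f j < a j")
            case True
            have "\<forall>\<^sub>F m in sequentially. 1 \<le> real m * (a j - f j)"
            proof (rule eventually_sequentiallyI[of "nat \<lceil>1 / (a j - f j)\<rceil>"])
              fix m assume "nat \<lceil>1 / (a j - f j)\<rceil> \<le> m"
              then have "1 / (a j - f j) \<le> real m" by linarith
              then show "1 \<le> real m * (a j - f j)" using True by (simp add: pos_divide_le_eq)
            qed
            then have "\<forall>\<^sub>F m in sequentially. \<phi> m j (f j) = 1" by eventually_elim (simp add: \<phi>_def)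
            then show ?thesis using True by (simp add: tendsto_eventually)
          next
            case False
            then have "real m * (a j - f j) \<le> 0" for m by (intro mult_nonneg_nonpos) auto
            then have "\<phi> m j (f j) = 0" for m by (simp add: \<phi>_def max.absorb1)
            then show ?thesis using False by simp
          qed
          then have "(\<lambda>m. \<Prod>j\<in>J. ennreal (\<phi> m j (f j))) \<longlonglongrightarrow> (\<Prod>j\<in>J. ennreal (indicator {..<a j} (f j)))"
            by (intro tendsto_prod_ennreal) (auto simp: \<phi>_def)
          also have "(\<Prod>j\<in>J. ennreal (indicator {..<a j} (f j))) = indicator {f\<in>space R. \<forall>j\<in>J. f j < a j} f"
            using J(1) f by (auto simp: indicator_def prod_zero_iff intro!: prod.neutral)
          finally show "(\<lambda>m. \<Prod>j\<in>J. ennreal (\<phi> m j (f j))) \<longlonglongrightarrow> indicator {f\<in>space R. \<forall>j\<in>J. f j < a j} f" .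
        qed
      qed (use S in simp_all)
      then show ?thesis using S by simp
    qed
    have "(\<integral>\<^sup>+f. (\<Prod>j\<in>J. ennreal (\<phi> m j (f j))) \<partial>P) = (\<integral>\<^sup>+f. (\<Prod>j\<in>J. ennreal (\<phi> m j (f j))) \<partial>Q)" for m
      by (rule eq[OF J]) (auto simp: \<phi>_def intro!: continuous_intros)
    then show ?thesis using LIMSEQ_unique[OF lim[OF P]] lim[OF Q] by simp
  qed
  define cyl_set where "cyl_set j A = {f\<in>(\<Pi>\<^sub>E i\<in>{0::real..}. UNIV :: real set). \<forall>i\<in>j. f i \<in> A i}" for j A
  define G where "G = {cyl_set j A |A j.
    j \<in> {j. finite j \<and> j \<subseteq> {0..}} \<and> A \<in> Pi j (\<lambda>_. range lessThan)}"
  have half: "\<exists>a. \<forall>i\<in>j. A i = {..<a i}" if "A \<in> Pi j (\<lambda>_. range lessThan)" for A and j :: "real set"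
    using that by (intro bchoice) (auto simp: Pi_iff image_iff)
  have G: "sets path_space = sigma_sets (\<Pi>\<^sub>E i\<in>{0..}. UNIV) G"
  proof -
    have "sets path_space = sets (\<Pi>\<^sub>M i\<in>{0::real..}. sigma (UNIV :: real set) (range lessThan))"
      by (simp only: borel_Iio)
    also have "\<dots> = sets (sigma (\<Pi>\<^sub>E i\<in>{0..}. UNIV) G)"
      unfolding G_def cyl_set_def
    proof (rule sets_PiM_sigma)
      show "\<exists>S\<subseteq>range lessThan. countable S \<and> (UNIV :: real set) = \<Union> S"
        using reals_Archimedean2
        by (intro exI[of _ "range (\<lambda>n::nat. {..<real n})"]) auto
    qed auto
    also have "\<dots> = sigma_sets (\<Pi>\<^sub>E i\<in>{0..}. UNIV) G"
      by (rule sets_measure_of) (auto simp: G_def cyl_set_def)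
    finally show ?thesis .
  qed
  have m: "(\<lambda>f. f) \<in> R \<rightarrow>\<^sub>M path_space" if "sets R = sets cadlag_space" for R :: "(real \<Rightarrow> real) measure"
    by (rule measurable_cadlag_space_path_space) (simp add: measurable_ident_sets[OF that])
  have "distr P path_space (\<lambda>f. f) = distr Q path_space (\<lambda>f. f)"
  proof (rule measure_eqI_generator_eq[where E=G and A="\<lambda>_. \<Pi>\<^sub>E i\<in>{0..}. UNIV"])
    show "Int_stable G"
    proof (rule Int_stableI)
      fix a b assume "a \<in> G" "b \<in> G"
      then obtain j A k B where a: "a = cyl_set j A" "finite j" "j \<subseteq> {0..}"
          "A \<in> Pi j (\<lambda>_. range lessThan)"
        and b: "b = cyl_set k B" "finite k" "k \<subseteq> {0..}"
          "B \<in> Pi k (\<lambda>_. range lessThan)" unfolding G_def by blast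
      obtain \<alpha> \<beta> where ab: "\<forall>i\<in>j. A i = {..<\<alpha> i}" "\<forall>i\<in>k. B i = {..<\<beta> i}" using half[OF a(4)] half[OF b(4)] by blast
      define C where "C i = {..<(if i \<in> j then if i \<in> k then min (\<alpha> i) (\<beta> i) else \<alpha> i else \<beta> i)}" for i
      have "a \<inter> b = cyl_set (j \<union> k) C"
        using ab unfolding a(1) b(1) C_def cyl_set_def by (auto split: if_splits)
      then show "a \<inter> b \<in> G"
        unfolding G_def using a b by (intro CollectI exI[of _ C] exI[of _ "j \<union> k"]) (auto simp: C_def)
    qed
    show "emeasure (distr P path_space (\<lambda>f. f)) a = emeasure (distr Q path_space (\<lambda>f. f)) a" if aG: "a \<in> G" for a
    proof -
      obtain j A where a: "a = cyl_set j A" "finite j" "j \<subseteq> {0..}"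
          "A \<in> Pi j (\<lambda>_. range lessThan)" using aG unfolding G_def by blast
      obtain \<alpha> where A: "\<forall>i\<in>j. A i = {..<\<alpha> i}" using half[OF a(4)] by blast
      have "a \<in> sets path_space" unfolding G using aG by auto
      then have "emeasure (distr R path_space (\<lambda>f. f)) a = emeasure R {f\<in>space R. \<forall>i\<in>j. f i < \<alpha> i}"
        if R: "sets R = sets cadlag_space" for R
        using m[OF R] sets_eq_imp_space_eq[OF R] A
        by (subst emeasure_distr) (auto simp: a(1) cyl_set_def space_cadlag_space PiE_def intro!: arg_cong[where f="emeasure R"])
      then show ?thesis using cyl[OF a(2,3)] P(1) Q(1) by simp
    qed
    show "range (\<lambda>_. \<Pi>\<^sub>E i\<in>{0..}. UNIV) \<subseteq> G" unfolding G_def by (auto simp: cyl_set_def intro!: exI[of _ "{}"])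
    show "emeasure (distr P path_space (\<lambda>f. f)) (\<Pi>\<^sub>E i\<in>{0..}. UNIV) \<noteq> \<infinity>"
      using finite_measure.emeasure_finite[OF finite_measure.finite_measure_distr[OF P(2) m[OF P(1)]]] by simp
  qed (auto simp: G G_def cyl_set_def)
  then have "distr P cadlag_space (\<lambda>f. f) = distr Q cadlag_space (\<lambda>f. f)"
    by (intro distr_cadlag_space_eqI measurable_ident_sets P Q)
  then show ?thesis using distr_id2[of cadlag_space P] distr_id2[of cadlag_space Q] P Q by simp
qed


section \<open>The strong Markov property\<close>

text \<open>A stopping time expressed without a filtration: whether \<open>T f < b\<close>, and the value of \<open>T f\<close> in this case,
can be read off from the path stopped at time \<open>b\<close>.\<close>

definition stopping_functional :: "((real \<Rightarrow> real) \<Rightarrow> ereal) \<Rightarrow> bool" where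
  "stopping_functional T \<longleftrightarrow> T \<in> borel_measurable cadlag_space \<and> (\<forall>f. 0 \<le> T f) \<and>
     (\<forall>f\<in>space cadlag_space. \<forall>b\<ge>0. T f < ereal b \<or> T (stop_path (ereal b) f) < ereal b \<longrightarrow>
        T (stop_path (ereal b) f) = T f)"

lemma stopping_functionalD:
  assumes "stopping_functional T"
  shows "T \<in> borel_measurable cadlag_space" "0 \<le> T f"
    and "f \<in> space cadlag_space \<Longrightarrow> 0 \<le> b \<Longrightarrow> T f < ereal b \<or> T (stop_path (ereal b) f) < ereal b \<Longrightarrow>
      T (stop_path (ereal b) f) = T f"
  using assms by (auto simp: stopping_functional_def)

text \<open>Up to time \<open>b\<close> exclusively the path and the stopped path have the same lower values.\<close>

lemma T_hit_stop_path:
  assumes f: "cadlag_on {0..} f" and b: "0 \<le> b"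
    and less: "T_hit \<alpha> f \<gamma> < ereal b \<or> T_hit \<alpha> (stop_path (ereal b) f) \<gamma> < ereal b"
  shows "T_hit \<alpha> (stop_path (ereal b) f) \<gamma> = T_hit \<alpha> f \<gamma>"
proof -
  let ?g = "stop_path (ereal b) f"
  have lv: "lower_value ?g t = lower_value f t" if "0 \<le> t" "t < b" for t
    unfolding lower_value_def using that
    by (subst left_lim0_cong[of t ?g f]) (auto simp: stop_path_def)
  have le: "T_hit \<alpha> h \<gamma> \<le> T_hit \<alpha> h' \<gamma>"
    if "T_hit \<alpha> h' \<gamma> < ereal b" "\<And>t. 0 \<le> t \<Longrightarrow> t < b \<Longrightarrow> lower_value h t = lower_value h' t" for h h'
  proof (rule dense_ge)
    fix y assume y: "T_hit \<alpha> h' \<gamma> < y"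
    then have "T_hit \<alpha> h' \<gamma> < min y (ereal b)" using that by simp
    then obtain t where t: "0 \<le> t" "lower_value h' t - \<alpha> * t \<le> \<gamma>" "ereal t < min y (ereal b)"
      unfolding T_hit_eq Inf_ereal_image_less_iff by auto
    then have "lower_value h t - \<alpha> * t \<le> \<gamma>" using that(2)[of t] by simp
    then have "T_hit \<alpha> h \<gamma> \<le> ereal t" unfolding T_hit_eq using t by (intro Inf_lower) auto
    then show "T_hit \<alpha> h \<gamma> \<le> y" using t by (auto intro: order_trans less_imp_le)
  qed
  show ?thesis
  proof (cases "T_hit \<alpha> f \<gamma> < ereal b")
    case True
    then have 1: "T_hit \<alpha> ?g \<gamma> \<le> T_hit \<alpha> f \<gamma>" by (rule le) (rule lv)
    then have "T_hit \<alpha> ?g \<gamma> < ereal b" using True by simp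
    then have "T_hit \<alpha> f \<gamma> \<le> T_hit \<alpha> ?g \<gamma>" by (rule le) (simp add: lv)
    with 1 show ?thesis by simp
  next
    case False
    then have 2: "T_hit \<alpha> ?g \<gamma> < ereal b" using less by simp
    then have "T_hit \<alpha> f \<gamma> \<le> T_hit \<alpha> ?g \<gamma>" by (rule le) (simp add: lv)
    then show ?thesis using False 2 by simp
  qed
qed

lemma stopping_functional_T_hit: "stopping_functional (\<lambda>f. T_hit \<alpha> f \<gamma>)"
  unfolding stopping_functional_def
  using measurable_T_hit[OF cadlag_process_coordinate, of "\<lambda>_. \<gamma>"] T_hit_stop_path T_hit_nonneg
  by (auto simp: space_cadlag_space)

lemma stop_path_stop_path:
  assumes "0 \<le> T" "T < ereal b"
  shows "stop_path T (stop_path (ereal b) f) = stop_path T f"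
proof -
  obtain c where c: "T = ereal c" "0 \<le> c" "c < b" using assms by (cases T) auto
  then show ?thesis by (auto simp: stop_path_def fun_eq_iff)
qed

lemma measurable_stop_at:
  assumes "stopping_functional T"
  shows "(\<lambda>f. stop_path (T f) f) \<in> cadlag_space \<rightarrow>\<^sub>M cadlag_space"
  by (intro measurable_stop_path) (auto simp: stopping_functionalD[OF assms])

lemma measurable_shift_at:
  assumes "stopping_functional T"
  shows "(\<lambda>f. shift_path (real_of_ereal (T f)) f) \<in> cadlag_space \<rightarrow>\<^sub>M cadlag_space"
proof (intro measurable_shift_path)
  have [measurable]: "T \<in> borel_measurable cadlag_space" by (rule stopping_functionalD[OF assms])
  show "(\<lambda>f. real_of_ereal (T f)) \<in> borel_measurable cadlag_space" by measurable
  show "0 \<le> real_of_ereal (T f)" for f using stopping_functionalD(2)[OF assms] by (intro real_of_ereal_pos)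
qed simp

context levy_law
begin

lemma space_W: "space W = space cadlag_space"
  by (rule sets_eq_imp_space_eq[OF sets_W])

lemma measurable_W: "(g \<in> W \<rightarrow>\<^sub>M S) = (g \<in> cadlag_space \<rightarrow>\<^sub>M S)"
  by (simp add: measurable_cong_sets[OF sets_W refl])

lemma nn_integral_markov:
  assumes b: "0 \<le> b" and \<phi>: "\<phi> \<in> borel_measurable cadlag_space" and \<psi>: "\<psi> \<in> borel_measurable cadlag_space"
  shows "(\<integral>\<^sup>+f. \<phi> (stop_path (ereal b) f) * \<psi> (shift_path b f) \<partial>W) =
    (\<integral>\<^sup>+f. \<phi> (stop_path (ereal b) f) \<partial>W) * (\<integral>\<^sup>+f. \<psi> f \<partial>W)"
proof -
  note stop = measurable_stop_path_const[OF b] and shift = measurable_shift_path_const[OF b]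
  note [measurable] = \<phi> \<psi>
  have s1: "stop_path (ereal b) \<in> W \<rightarrow>\<^sub>M cadlag_space" and s2: "shift_path b \<in> W \<rightarrow>\<^sub>M cadlag_space"
    using stop shift by (simp_all add: measurable_W)
  have "(\<integral>\<^sup>+f. \<phi> (stop_path (ereal b) f) * \<psi> (shift_path b f) \<partial>W) =
    (\<integral>\<^sup>+p. \<phi> (fst p) * \<psi> (snd p) \<partial>distr W (cadlag_space \<Otimes>\<^sub>M cadlag_space) (\<lambda>f. (stop_path (ereal b) f, shift_path b f)))"
    by (subst nn_integral_distr) (auto intro!: measurable_Pair s1 s2)
  also have "\<dots> = (\<integral>\<^sup>+p. \<phi> (fst p) * \<psi> (snd p) \<partial>(distr W cadlag_space (stop_path (ereal b)) \<Otimes>\<^sub>M W))"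
    unfolding markov[OF b] ..
  also have "\<dots> = (\<integral>\<^sup>+x. \<integral>\<^sup>+y. \<phi> x * \<psi> y \<partial>W \<partial>distr W cadlag_space (stop_path (ereal b)))"
    by (subst nn_integral_fst[symmetric])
      (auto simp: measurable_W intro!: borel_measurable_times_ennreal measurable_compose[OF measurable_fst] measurable_compose[OF measurable_snd])
  also have "\<dots> = (\<integral>\<^sup>+x. \<phi> x * (\<integral>\<^sup>+y. \<psi> y \<partial>W) \<partial>distr W cadlag_space (stop_path (ereal b)))"
    by (simp add: nn_integral_cmult measurable_W \<psi>)
  also have "\<dots> = (\<integral>\<^sup>+x. \<phi> x \<partial>distr W cadlag_space (stop_path (ereal b))) * (\<integral>\<^sup>+f. \<psi> f \<partial>W)"
    by (simp add: nn_integral_multc)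
  also have "\<dots> = (\<integral>\<^sup>+f. \<phi> (stop_path (ereal b) f) \<partial>W) * (\<integral>\<^sup>+f. \<psi> f \<partial>W)"
    by (subst nn_integral_distr[OF s1]) simp_all
  finally show ?thesis .
qed

lemma distr_shift_path: "0 \<le> b \<Longrightarrow> distr W cadlag_space (shift_path b) = W"
proof -
  assume b: "0 \<le> b"
  have s2: "shift_path b \<in> W \<rightarrow>\<^sub>M cadlag_space" using measurable_shift_path_const[OF b] by (simp add: measurable_W)
  show ?thesis
  proof (rule measure_eqI)
    fix A assume "A \<in> sets (distr W cadlag_space (shift_path b))"
    then have A: "A \<in> sets cadlag_space" by simp
    have "emeasure (distr W cadlag_space (shift_path b)) A = (\<integral>\<^sup>+f. 1 * indicator A (shift_path b f) \<partial>W)"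
      using A nn_integral_distr[OF s2, of "indicator A"] by simp
    also have "\<dots> = emeasure W A"
      using nn_integral_markov[OF b, of "\<lambda>_. 1" "indicator A"] A by (simp add: sets_W emeasure_space_1)
    finally show "emeasure (distr W cadlag_space (shift_path b)) A = emeasure W A" .
  qed (simp add: sets_W)
qed

definition stopped_event :: "((real \<Rightarrow> real) \<Rightarrow> ereal) \<Rightarrow> (real \<Rightarrow> real) set \<Rightarrow> (real \<Rightarrow> real) set" where
  "stopped_event T A = {f\<in>space cadlag_space. T f < \<infinity> \<and> stop_path (T f) f \<in> A}"

lemma sets_stopped_event:
  assumes T: "stopping_functional T" and A: "A \<in> sets cadlag_space"
  shows "stopped_event T A \<in> sets cadlag_space"
proof -
  note [measurable] = measurable_stop_at[OF T] stopping_functionalD(1)[OF T] A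
  show ?thesis unfolding stopped_event_def by measurable
qed

text \<open>The grid time takes countably many values \<open>b k\<close>. On the event \<open>E k\<close> that it equals \<open>b k\<close>, the stopping
time is below \<open>b k\<close>, so \<open>E k\<close> is an event of the path stopped at \<open>b k\<close> and the Markov property at the
fixed time \<open>b k\<close> applies. Summation over \<open>k\<close> gives the claim.\<close>

lemma nn_integral_strong_markov_grid:
  assumes T: "stopping_functional T" and A: "A \<in> sets cadlag_space" and \<psi>: "\<psi> \<in> borel_measurable cadlag_space"
  shows "(\<integral>\<^sup>+f. indicator (stopped_event T A) f * \<psi> (shift_path (time_grid n (real_of_ereal (T f))) f) \<partial>W) =
    emeasure W (stopped_event T A) * (\<integral>\<^sup>+f. \<psi> f \<partial>W)"
proof -
  define b where "b k = (real k + 1) / real (Suc n)" for k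
  have b: "0 \<le> b k" for k by (simp add: b_def)
  \<comment> \<open>the event that the grid time equals \<open>b k\<close>\<close>
  define E where "E k = {f\<in>space cadlag_space. ereal (real k / real (Suc n)) \<le> T f \<and> T f < ereal (b k) \<and> stop_path (T f) f \<in> A}" for k
  note [measurable] = measurable_stop_at[OF T] stopping_functionalD(1)[OF T] A \<psi>
  have E[measurable]: "E k \<in> sets cadlag_space" for k unfolding E_def by measurable
  have E_stop: "stop_path (ereal (b k)) f \<in> E k \<longleftrightarrow> f \<in> E k" if f: "f \<in> space cadlag_space" for f k
  proof -
    let ?g = "stop_path (ereal (b k)) f"
    have g: "?g \<in> space cadlag_space" using measurable_space[OF measurable_stop_path_const[OF b] f] .
    show ?thesis
    proof (cases "T f < ereal (b k) \<or> T ?g < ereal (b k)")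
      case True
      then have eq: "T ?g = T f" using stopping_functionalD(3)[OF T f b] by blast
      then have "stop_path (T ?g) ?g = stop_path (T f) f"
        using True stopping_functionalD(2)[OF T] by (simp add: stop_path_stop_path)
      then show ?thesis using f g eq by (simp add: E_def)
    qed (auto simp: E_def)
  qed
  have sum_E: "(\<Sum>k. indicator (E k) f * c k) =
      indicator (stopped_event T A) f * c (nat \<lfloor>real (Suc n) * real_of_ereal (T f)\<rfloor>)"
    if f: "f \<in> space cadlag_space" for f and c :: "nat \<Rightarrow> ennreal"
  proof (cases "f \<in> stopped_event T A")
    case True
    then obtain t where t: "T f = ereal t" "0 \<le> t" using stopping_functionalD(2)[OF T, of f]
      by (cases "T f") (auto simp: stopped_event_def)
    define k where "k = nat \<lfloor>real (Suc n) * t\<rfloor>"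
    have "f \<in> E l \<longleftrightarrow> l = k" for l
    proof -
      have "f \<in> E l \<longleftrightarrow> real l / real (Suc n) \<le> t \<and> t < (real l + 1) / real (Suc n)"
        using True t by (auto simp: E_def b_def stopped_event_def)
      also have "\<dots> \<longleftrightarrow> real l \<le> real (Suc n) * t \<and> real (Suc n) * t < real l + 1"
        by (simp add: pos_divide_le_eq pos_less_divide_eq mult.commute del: of_nat_Suc)
      also have "\<dots> \<longleftrightarrow> \<lfloor>real (Suc n) * t\<rfloor> = int l" by (simp add: floor_eq_iff del: of_nat_Suc)
      also have "\<dots> \<longleftrightarrow> l = k" unfolding k_def using t by (auto simp del: of_nat_Suc)
      finally show ?thesis .
    qed
    then have "(\<Sum>l. indicator (E l) f * c l) = (\<Sum>l\<in>{k}. indicator (E l) f * c l)"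
      by (intro suminf_finite) auto
    then show ?thesis using True t \<open>\<And>l. f \<in> E l \<longleftrightarrow> l = k\<close> by (simp add: k_def del: of_nat_Suc)
  next
    case False
    then have "f \<notin> E k" for k by (auto simp: E_def stopped_event_def less_ereal.simps)
    then show ?thesis using False by simp
  qed
  have grid: "time_grid n (real_of_ereal (T f)) = b (nat \<lfloor>real (Suc n) * real_of_ereal (T f)\<rfloor>)" for f
    using stopping_functionalD(2)[OF T, of f] by (simp add: time_grid_def b_def real_of_ereal_pos del: of_nat_Suc)
  have m: "(\<lambda>f. \<psi> (shift_path (b k) f)) \<in> borel_measurable cadlag_space" for k
    by (rule measurable_compose[OF measurable_shift_path_const[OF b] \<psi>])
  have "(\<integral>\<^sup>+f. indicator (stopped_event T A) f * \<psi> (shift_path (time_grid n (real_of_ereal (T f))) f) \<partial>W) =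
      (\<integral>\<^sup>+f. (\<Sum>k. indicator (E k) f * \<psi> (shift_path (b k) f)) \<partial>W)"
    by (rule nn_integral_cong) (simp add: space_W sum_E grid)
  also have "\<dots> = (\<Sum>k. \<integral>\<^sup>+f. indicator (E k) f * \<psi> (shift_path (b k) f) \<partial>W)"
    by (rule nn_integral_suminf) (use m in \<open>simp add: measurable_W\<close>)
  also have "\<dots> = (\<Sum>k. emeasure W (E k) * (\<integral>\<^sup>+f. \<psi> f \<partial>W))"
  proof (rule suminf_cong)
    fix k
    have ind: "indicator (E k) f = indicator (E k) (stop_path (ereal (b k)) f)" if "f \<in> space cadlag_space" for f
      using E_stop[OF that] by (simp add: indicator_def)
    have "(\<integral>\<^sup>+f. indicator (E k) f * \<psi> (shift_path (b k) f) \<partial>W) =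
       (\<integral>\<^sup>+f. indicator (E k) (stop_path (ereal (b k)) f) * \<psi> (shift_path (b k) f) \<partial>W)"
      by (rule nn_integral_cong) (simp add: space_W ind)
    also have "\<dots> = (\<integral>\<^sup>+f. indicator (E k) (stop_path (ereal (b k)) f) \<partial>W) * (\<integral>\<^sup>+f. \<psi> f \<partial>W)"
      by (rule nn_integral_markov[OF b _ \<psi>]) measurable
    also have "(\<integral>\<^sup>+f. indicator (E k) (stop_path (ereal (b k)) f) \<partial>W) = (\<integral>\<^sup>+f. indicator (E k) f \<partial>W)"
      by (rule nn_integral_cong) (simp add: space_W ind)
    finally show "(\<integral>\<^sup>+f. indicator (E k) f * \<psi> (shift_path (b k) f) \<partial>W) = emeasure W (E k) * (\<integral>\<^sup>+f. \<psi> f \<partial>W)"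
      using E by (simp add: sets_W)
  qed
  also have "\<dots> = (\<Sum>k. emeasure W (E k)) * (\<integral>\<^sup>+f. \<psi> f \<partial>W)" by (rule ennreal_suminf_multc)
  also have "(\<Sum>k. emeasure W (E k)) = emeasure W (stopped_event T A)"
  proof -
    have "(\<Sum>k. emeasure W (E k)) = (\<Sum>k. \<integral>\<^sup>+f. indicator (E k) f * 1 \<partial>W)" using E by (simp add: sets_W)
    also have "\<dots> = (\<integral>\<^sup>+f. (\<Sum>k. indicator (E k) f * 1) \<partial>W)"
      by (rule nn_integral_suminf[symmetric]) (simp add: measurable_W)
    also have "\<dots> = (\<integral>\<^sup>+f. indicator (stopped_event T A) f * 1 \<partial>W)"
      by (rule nn_integral_cong) (simp only: space_W sum_E)
    finally show ?thesis using sets_stopped_event[OF T A] by (simp add: sets_W)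
  qed
  finally show ?thesis .
qed

text \<open>The previous lemma is a statement about grid times that decrease to the stopping time. For test
functions that are products of continuous functions of finitely many coordinates the limit can be
taken by right-continuity and dominated convergence, and such functions determine a finite measure.\<close>

theorem strong_markov:
  assumes T: "stopping_functional T" and A: "A \<in> sets cadlag_space" and \<psi>': "\<psi>' \<in> borel_measurable cadlag_space"
  shows "(\<integral>\<^sup>+f. indicator (stopped_event T A) f * \<psi>' (shift_path (real_of_ereal (T f)) f) \<partial>W) =
    emeasure W (stopped_event T A) * (\<integral>\<^sup>+f. \<psi>' f \<partial>W)"
proof -
  let ?G = "stopped_event T A" and ?s = "\<lambda>f. shift_path (real_of_ereal (T f)) f"
  have G[measurable]: "?G \<in> sets W" using sets_stopped_event[OF T A] by (simp add: sets_W)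
  have s[measurable]: "?s \<in> W \<rightarrow>\<^sub>M cadlag_space" using measurable_shift_at[OF T] by (simp add: measurable_W)
  define P where "P = distr (density W (indicator ?G)) cadlag_space ?s"
  define Q where "Q = density W (\<lambda>_. emeasure W ?G)"
  have dens: "finite_measure (density W (indicator ?G))"
    by (rule finite_measureI) (simp add: emeasure_density emeasure_eq_measure)
  have "P = Q"
  proof (rule cadlag_space_test_function_eqI)
    show "sets P = sets cadlag_space" "sets Q = sets cadlag_space" by (simp_all add: P_def Q_def sets_W)
    show "finite_measure P" unfolding P_def by (intro finite_measure.finite_measure_distr[OF dens]) simp
    show "finite_measure Q" unfolding Q_def
      by (rule finite_measureI) (simp add: emeasure_density nn_integral_cmult emeasure_space_1)
    fix J :: "real set" and \<phi> :: "real \<Rightarrow> real \<Rightarrow> real"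
    assume J: "finite J" "J \<subseteq> {0..}" and \<phi>: "\<And>j. continuous_on UNIV (\<phi> j)" "\<And>j x. 0 \<le> \<phi> j x \<and> \<phi> j x \<le> 1"
    define \<psi> where "\<psi> f = (\<Prod>j\<in>J. ennreal (\<phi> j (f j)))" for f
    have \<phi>m: "\<phi> j \<in> borel_measurable borel" for j by (rule borel_measurable_continuous_onI[OF \<phi>(1)])
    have \<psi>[measurable]: "\<psi> \<in> borel_measurable cadlag_space"
      unfolding \<psi>_def using J cadlag_processD(1)[OF cadlag_process_coordinate]
      by (intro borel_measurable_prod_ennreal measurable_compose[OF _ measurable_ennreal] measurable_compose[OF _ \<phi>m]) auto
    have "(\<integral>\<^sup>+f. \<psi> f \<partial>P) = (\<integral>\<^sup>+f. indicator ?G f * \<psi> (?s f) \<partial>W)"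
      unfolding P_def by (subst nn_integral_distr) (simp_all add: nn_integral_density)
    moreover have "(\<integral>\<^sup>+f. \<psi> f \<partial>Q) = emeasure W ?G * (\<integral>\<^sup>+f. \<psi> f \<partial>W)"
      unfolding Q_def by (simp add: nn_integral_density nn_integral_cmult measurable_W)
    moreover have "(\<lambda>n. \<integral>\<^sup>+f. indicator ?G f * \<psi> (shift_path (time_grid n (real_of_ereal (T f))) f) \<partial>W) \<longlonglongrightarrow>
        (\<integral>\<^sup>+f. indicator ?G f * \<psi> (?s f) \<partial>W)"
    proof (rule nn_integral_dominated_convergence[where w="\<lambda>_. 1"])
      have [measurable]: "T \<in> borel_measurable W" using stopping_functionalD(1)[OF T] by (simp add: measurable_W)
      show "(\<lambda>f. indicator ?G f * \<psi> (shift_path (time_grid n (real_of_ereal (T f))) f)) \<in> borel_measurable W" for n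
      proof -
        have "(\<lambda>f. shift_path (time_grid n (real_of_ereal (T f))) f) \<in> W \<rightarrow>\<^sub>M cadlag_space"
        proof (rule measurable_shift_path)
          show "(\<lambda>f. time_grid n (real_of_ereal (T f))) \<in> borel_measurable W"
            unfolding time_grid_def by measurable
          show "0 \<le> time_grid n (real_of_ereal (T f))" for f
            using time_grid_greater[of "real_of_ereal (T f)" n] stopping_functionalD(2)[OF T, of f]
              real_of_ereal_pos[of "T f"] by linarith
        qed (simp add: measurable_W)
        then show ?thesis by measurable
      qed
      show "(\<lambda>f. indicator ?G f * \<psi> (?s f)) \<in> borel_measurable W" by measurable
      show "AE f in W. indicator ?G f * \<psi> (shift_path (time_grid n (real_of_ereal (T f))) f) \<le> 1" for n
      proof (rule AE_I2)
        fix f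
        have "\<psi> g \<le> 1" for g unfolding \<psi>_def by (rule prod_le_1) (use \<phi> in auto)
        then show "indicator ?G f * \<psi> (shift_path (time_grid n (real_of_ereal (T f))) f) \<le> 1"
          by (simp add: indicator_def)
      qed
      show "(\<integral>\<^sup>+f. 1 \<partial>W) < \<infinity>" by (simp add: emeasure_space_1)
      show "AE f in W. (\<lambda>n. indicator ?G f * \<psi> (shift_path (time_grid n (real_of_ereal (T f))) f)) \<longlonglongrightarrow> indicator ?G f * \<psi> (?s f)"
      proof (rule AE_I2)
        fix f assume "f \<in> space W"
        then have f: "cadlag_on {0..} f" by (simp add: space_W space_cadlag_space)
        define t where "t = real_of_ereal (T f)"
        have t: "0 \<le> t" unfolding t_def using stopping_functionalD(2)[OF T] by (rule real_of_ereal_pos)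
        have lim: "(\<lambda>n. f (j + time_grid n t)) \<longlonglongrightarrow> f (j + t)" if "0 \<le> j" for j
          using filterlim_compose[OF cadlag_right_limit[OF f] filterlim_compose[OF filterlim_shift_at_right time_grid_tendsto]]
            that t by simp
        have "(\<lambda>n. shift_path (time_grid n t) f j) \<longlonglongrightarrow> shift_path t f j" if "j \<in> J" for j
          using tendsto_diff[OF lim[of j] lim[of 0]] that J by (auto simp: shift_path_def add.commute)
        then have "(\<lambda>n. \<phi> j (shift_path (time_grid n t) f j)) \<longlonglongrightarrow> \<phi> j (shift_path t f j)" if "j \<in> J" for j
          using \<phi>(1)[of j] that by (intro isCont_tendsto_compose[where g="\<phi> j"]) (auto simp: continuous_on_eq_continuous_at)
        then have "(\<lambda>n. \<psi> (shift_path (time_grid n t) f)) \<longlonglongrightarrow> \<psi> (shift_path t f)"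
          unfolding \<psi>_def using \<phi>(2) by (intro tendsto_prod_ennreal) auto
        then show "(\<lambda>n. indicator ?G f * \<psi> (shift_path (time_grid n (real_of_ereal (T f))) f)) \<longlonglongrightarrow> indicator ?G f * \<psi> (?s f)"
          unfolding t_def[symmetric] by (cases "f \<in> ?G") auto
      qed
    qed simp
    ultimately show "(\<integral>\<^sup>+f. (\<Prod>j\<in>J. ennreal (\<phi> j (f j))) \<partial>P) = (\<integral>\<^sup>+f. (\<Prod>j\<in>J. ennreal (\<phi> j (f j))) \<partial>Q)"
      unfolding nn_integral_strong_markov_grid[OF T A \<psi>] LIMSEQ_const_iff \<psi>_def[symmetric] by simp
  qed
  have "(\<integral>\<^sup>+f. \<psi>' f \<partial>P) = (\<integral>\<^sup>+f. indicator ?G f * \<psi>' (?s f) \<partial>W)"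
    unfolding P_def using \<psi>' by (subst nn_integral_distr) (simp_all add: nn_integral_density)
  moreover have "(\<integral>\<^sup>+f. \<psi>' f \<partial>Q) = emeasure W ?G * (\<integral>\<^sup>+f. \<psi>' f \<partial>W)"
    unfolding Q_def using \<psi>' by (simp add: nn_integral_density nn_integral_cmult measurable_W)
  ultimately show ?thesis using \<open>P = Q\<close> by simp
qed

corollary strong_markov_law:
  assumes T: "stopping_functional T" and fin: "AE f in W. T f < \<infinity>"
  shows "distr W (cadlag_space \<Otimes>\<^sub>M cadlag_space) (\<lambda>f. (stop_path (T f) f, shift_path (real_of_ereal (T f)) f)) =
    distr W cadlag_space (\<lambda>f. stop_path (T f) f) \<Otimes>\<^sub>M W"
proof (rule pair_measure_eqI[symmetric])
  have m1: "(\<lambda>f. stop_path (T f) f) \<in> W \<rightarrow>\<^sub>M cadlag_space"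
    and m2: "(\<lambda>f. shift_path (real_of_ereal (T f)) f) \<in> W \<rightarrow>\<^sub>M cadlag_space"
    using measurable_stop_at[OF T] measurable_shift_at[OF T] by (simp_all add: measurable_W)
  show "sigma_finite_measure (distr W cadlag_space (\<lambda>f. stop_path (T f) f))"
    by (intro finite_measure.axioms(1) finite_measure_distr m1)
  show "sigma_finite_measure W" by unfold_locales
  show "sets (distr W cadlag_space (\<lambda>f. stop_path (T f) f) \<Otimes>\<^sub>M W) =
      sets (distr W (cadlag_space \<Otimes>\<^sub>M cadlag_space) (\<lambda>f. (stop_path (T f) f, shift_path (real_of_ereal (T f)) f)))"
    by (simp add: sets_W cong: sets_pair_measure_cong)
  fix A B assume "A \<in> sets (distr W cadlag_space (\<lambda>f. stop_path (T f) f))" "B \<in> sets W"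
  then have A: "A \<in> sets cadlag_space" and B: "B \<in> sets cadlag_space" by (simp_all add: sets_W)
  have G: "stopped_event T A \<in> sets W" using sets_stopped_event[OF T A] by (simp add: sets_W)
  have "emeasure (distr W cadlag_space (\<lambda>f. stop_path (T f) f)) A = emeasure W (stopped_event T A)"
    unfolding emeasure_distr[OF m1 A]
    by (rule emeasure_eq_AE)
      (use fin measurable_sets[OF m1 A] G in \<open>auto simp: stopped_event_def space_W elim!: eventually_mono\<close>)
  moreover have "emeasure (distr W (cadlag_space \<Otimes>\<^sub>M cadlag_space) (\<lambda>f. (stop_path (T f) f, shift_path (real_of_ereal (T f)) f))) (A \<times> B) =
      (\<integral>\<^sup>+f. indicator (stopped_event T A) f * indicator B (shift_path (real_of_ereal (T f)) f) \<partial>W)"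
  proof -
    have "emeasure (distr W (cadlag_space \<Otimes>\<^sub>M cadlag_space) (\<lambda>f. (stop_path (T f) f, shift_path (real_of_ereal (T f)) f))) (A \<times> B)
       = (\<integral>\<^sup>+p. indicator (A \<times> B) p \<partial>distr W (cadlag_space \<Otimes>\<^sub>M cadlag_space) (\<lambda>f. (stop_path (T f) f, shift_path (real_of_ereal (T f)) f)))"
      using A B by simp
    also have "\<dots> = (\<integral>\<^sup>+f. indicator (A \<times> B) (stop_path (T f) f, shift_path (real_of_ereal (T f)) f) \<partial>W)"
      using A B by (intro nn_integral_distr measurable_Pair m1 m2) auto
    also have "\<dots> = (\<integral>\<^sup>+f. indicator (stopped_event T A) f * indicator B (shift_path (real_of_ereal (T f)) f) \<partial>W)"
      by (rule nn_integral_cong_AE)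
        (use fin AE_space in \<open>eventually_elim, auto simp: stopped_event_def space_W indicator_def\<close>)
    finally show ?thesis .
  qed
  ultimately show "emeasure (distr W cadlag_space (\<lambda>f. stop_path (T f) f)) A * emeasure W B =
      emeasure (distr W (cadlag_space \<Otimes>\<^sub>M cadlag_space) (\<lambda>f. (stop_path (T f) f, shift_path (real_of_ereal (T f)) f))) (A \<times> B)"
    using strong_markov[OF T A, of "indicator B"] B by (simp add: sets_W)
qed

end


section \<open>No upward jump at a hitting time\<close>

lemma T_hit_antimono: "\<gamma> \<le> \<gamma>' \<Longrightarrow> T_hit \<alpha> f \<gamma>' \<le> T_hit \<alpha> f \<gamma>"
  unfolding T_hit_eq by (intro Inf_superset_mono image_mono) auto

lemma left_lim0_tendsto_right_value:
  assumes f: "cadlag_on {0..} f" and t: "0 \<le> t"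
  shows "(left_lim0 f \<longlongrightarrow> f t) (at_right t)"
proof (rule tendstoI)
  fix e :: real assume e: "0 < e"
  then have "\<forall>\<^sub>F s in at_right t. dist (f s) (f t) < e / 2"
    using cadlag_right_limit[OF f t] by (intro tendstoD) auto
  then obtain d where d: "0 < d" "\<forall>s. t < s \<and> s < t + d \<longrightarrow> dist (f s) (f t) < e / 2"
    using eventually_at_right_imp_ball by blast
  have "dist (left_lim0 f s) (f t) < e" if s: "t < s" "s < t + d" for s
  proof -
    have "((\<lambda>u. dist (f u) (f t)) \<longlongrightarrow> dist (left_lim0 f s) (f t)) (at_left s)"
      using s t by (intro tendsto_dist tendsto_const cadlag_left_limit[OF f]) auto
    moreover have "\<forall>\<^sub>F u in at_left s. dist (f u) (f t) \<le> e / 2"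
      unfolding eventually_at_left_field
      using s d(2) by (intro exI[of _ t]) (auto intro: less_imp_le)
    ultimately have "dist (left_lim0 f s) (f t) \<le> e / 2" by (intro tendsto_upperbound) auto
    then show ?thesis using e by simp
  qed
  then show "\<forall>\<^sub>F s in at_right t. dist (left_lim0 f s) (f t) < e"
    unfolding eventually_at_right_field using d(1) by (intro exI[of _ "t + d"]) auto
qed

text \<open>If the path jumps upwards at the hitting time, then the level is reached by the left limit, so
every higher level is hit strictly before. The limit of these earlier hitting times cannot be smaller
than the hitting time of the level itself, by lower semicontinuity.\<close>

lemma T_hit_level_approximation:
  assumes f: "cadlag_on {0..} f" and T: "T_hit \<alpha> f \<gamma> = ereal t" and t: "0 < t" and jump: "left_lim0 f t < f t"
  shows "\<exists>s. (\<forall>n. T_hit \<alpha> f (\<gamma> + 1 / real (Suc n)) = ereal (s n)) \<and> filterlim s (at_left t) sequentially"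
proof -
  note hit = T_hit_attained[OF f T]
  have l: "left_lim0 f t - \<alpha> * t \<le> \<gamma>" using hit(2) jump by (simp add: lower_value_def)
  have "\<exists>r. T_hit \<alpha> f (\<gamma> + 1 / real (Suc n)) = ereal r \<and> 0 \<le> r \<and> r < t" for n
  proof -
    have "((\<lambda>u. f u - \<alpha> * u) \<longlongrightarrow> left_lim0 f t - \<alpha> * t) (at_left t)"
      by (intro tendsto_intros cadlag_left_limit[OF f t])
    then have "\<forall>\<^sub>F u in at_left t. f u - \<alpha> * u < \<gamma> + 1 / real (Suc n)"
      by (rule order_tendstoD) (rule le_less_trans[OF l], simp)
    from eventually_at_left_rational[OF this t] obtain u where u: "0 < u" "u < t" "f u - \<alpha> * u < \<gamma> + 1 / real (Suc n)"
      by auto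
    then have "lower_value f u - \<alpha> * u \<le> \<gamma> + 1 / real (Suc n)" using lower_value_le[of f u] by simp
    then have "T_hit \<alpha> f (\<gamma> + 1 / real (Suc n)) \<le> ereal u" unfolding T_hit_eq using u by (intro Inf_lower) auto
    moreover have "0 \<le> T_hit \<alpha> f (\<gamma> + 1 / real (Suc n))" by (rule T_hit_nonneg)
    ultimately show ?thesis using u by (cases "T_hit \<alpha> f (\<gamma> + 1 / real (Suc n))") auto
  qed
  then obtain s where s: "\<And>n. T_hit \<alpha> f (\<gamma> + 1 / real (Suc n)) = ereal (s n)" "\<And>n. 0 \<le> s n" "\<And>n. s n < t"
    using choice[of "\<lambda>n r. T_hit \<alpha> f (\<gamma> + 1 / real (Suc n)) = ereal r \<and> 0 \<le> r \<and> r < t"] by blast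
  have "incseq s"
  proof (rule incseq_SucI)
    fix n
    have "1 / real (Suc (Suc n)) \<le> 1 / real (Suc n)" by (simp add: frac_le)
    then have "T_hit \<alpha> f (\<gamma> + 1 / real (Suc n)) \<le> T_hit \<alpha> f (\<gamma> + 1 / real (Suc (Suc n)))"
      by (intro T_hit_antimono) simp
    then show "s n \<le> s (Suc n)" by (simp only: s(1) ereal_less_eq)
  qed
  moreover have "\<forall>n. s n \<le> t" using s(3) less_imp_le by blast
  ultimately obtain r where r: "s \<longlonglongrightarrow> r" "\<forall>n. s n \<le> r" using incseq_convergent by blast
  have "r \<le> t" using r(1) s(3) less_imp_le by (intro LIMSEQ_le_const2[OF r(1)]) blast
  have "0 \<le> r" using order_trans[OF s(2) r(2)[rule_format, of 0]] .
  have "\<not> r < t"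
  proof
    assume "r < t"
    define g where "g u = f u + (- \<alpha> * u)" for u
    have g: "cadlag_on {0..} g" unfolding g_def by (intro cadlag_add_continuous f continuous_intros)
    have lg: "lower_value g u = lower_value f u - \<alpha> * u" if "u \<ge> 0" for u
      unfolding g_def using that by (subst lower_value_add_continuous[OF f]) (auto intro!: continuous_intros)
    have inv: "(\<lambda>n. \<gamma> + 1 / real (Suc n)) \<longlonglongrightarrow> \<gamma>"
      using tendsto_add[OF tendsto_const[of \<gamma>] LIMSEQ_inverse_real_of_nat] by (simp add: inverse_eq_divide)
    have "lower_value g r \<le> \<gamma>"
    proof (rule lower_value_sequential_limit[OF g r(1) s(2) _ inv])
      show "lower_value g (s n) \<le> \<gamma> + 1 / real (Suc n)" for n
        using T_hit_attained(2)[OF f s(1)] lg[OF s(2)] by simp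
    qed
    then show False using hit(3)[OF \<open>0 \<le> r\<close> \<open>r < t\<close>] lg[OF \<open>0 \<le> r\<close>] by simp
  qed
  then have "r = t" using \<open>r \<le> t\<close> by simp
  then have "filterlim s (at_left t) sequentially"
    unfolding filterlim_at using r(1) s(3) by (auto simp: less_imp_neq)
  then show ?thesis using s(1) by blast
qed

text \<open>The increment over a time span \<open>1/(k+1)\<close> after the hitting time of the level \<open>\<gamma> + 1/(n+1)\<close>, truncated
at \<open>1\<close>. As first \<open>n\<close> and then \<open>k\<close> grows, it tends to the size of the jump at the hitting time of \<open>\<gamma>\<close>
whenever this jump is upward. Unlike the event of such a jump, this expression is evidently measurable,
jointly in the level and the path.\<close>

definition jump_gauge :: "real \<Rightarrow> real \<Rightarrow> (real \<Rightarrow> real) \<Rightarrow> ennreal" where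
  "jump_gauge \<alpha> \<gamma> f = liminf (\<lambda>k. liminf (\<lambda>n.
     let T = T_hit \<alpha> f (\<gamma> + 1 / real (Suc n)) in
     if T < \<infinity> then ennreal (min 1 \<bar>f (real_of_ereal T + 1 / real (Suc k)) - f (real_of_ereal T)\<bar>) else 0))"

lemma jump_gauge_pos:
  assumes f: "cadlag_on {0..} f" and T: "T_hit \<alpha> f \<gamma> = ereal t" and t: "0 < t" and jump: "left_lim0 f t < f t"
  shows "jump_gauge \<alpha> \<gamma> f \<noteq> 0"
proof -
  obtain s where s: "\<And>n. T_hit \<alpha> f (\<gamma> + 1 / real (Suc n)) = ereal (s n)" "filterlim s (at_left t) sequentially"
    using T_hit_level_approximation[OF assms] by blast
  have "(\<lambda>n. ennreal (min 1 \<bar>f (s n + u) - f (s n)\<bar>)) \<longlonglongrightarrow> ennreal (min 1 \<bar>left_lim0 f (t + u) - left_lim0 f t\<bar>)"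
    if "0 < u" for u
  proof -
    have "(\<lambda>n. f (u + s n)) \<longlonglongrightarrow> left_lim0 f (u + t)"
      using that t by (intro filterlim_compose[OF cadlag_left_limit[OF f] filterlim_compose[OF filterlim_shift_at_left s(2)]]) auto
    moreover have "(\<lambda>n. f (s n)) \<longlonglongrightarrow> left_lim0 f t"
      by (rule filterlim_compose[OF cadlag_left_limit[OF f t] s(2)])
    ultimately show ?thesis by (intro tendsto_ennrealI tendsto_min tendsto_const tendsto_rabs tendsto_diff) (simp_all add: add.commute)
  qed
  then have "liminf (\<lambda>n. ennreal (min 1 \<bar>f (s n + 1 / real (Suc k)) - f (s n)\<bar>)) =
      ennreal (min 1 \<bar>left_lim0 f (t + 1 / real (Suc k)) - left_lim0 f t\<bar>)" for k
    by (intro lim_imp_Liminf) auto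
  then have eq: "jump_gauge \<alpha> \<gamma> f = liminf (\<lambda>k. ennreal (min 1 \<bar>left_lim0 f (t + 1 / real (Suc k)) - left_lim0 f t\<bar>))"
    by (simp add: jump_gauge_def s(1) del: of_nat_Suc)
  have "filterlim (\<lambda>k. t + 1 / real (Suc k)) (at_right t) sequentially"
    unfolding filterlim_at
    using tendsto_add[OF tendsto_const[of t] LIMSEQ_inverse_real_of_nat] by (simp add: inverse_eq_divide)
  from filterlim_compose[OF left_lim0_tendsto_right_value[OF f] this]
  have "(\<lambda>k. left_lim0 f (t + 1 / real (Suc k))) \<longlonglongrightarrow> f t" using t by simp
  then have "(\<lambda>k. ennreal (min 1 \<bar>left_lim0 f (t + 1 / real (Suc k)) - left_lim0 f t\<bar>)) \<longlonglongrightarrow> ennreal (min 1 \<bar>f t - left_lim0 f t\<bar>)"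
    by (intro tendsto_ennrealI tendsto_min tendsto_const tendsto_rabs tendsto_diff)
  then have "jump_gauge \<alpha> \<gamma> f = ennreal (min 1 \<bar>f t - left_lim0 f t\<bar>)"
    unfolding eq by (intro lim_imp_Liminf) auto
  then show ?thesis using jump by (simp add: ennreal_eq_0_iff min_def)
qed

lemma measurable_jump_term:
  assumes Y: "cadlag_process N Y" and \<gamma>[measurable]: "\<gamma> \<in> borel_measurable N"
  shows "(\<lambda>\<omega>. let T = T_hit \<alpha> (\<lambda>t. Y t \<omega>) (\<gamma> \<omega> + 1 / real (Suc n)) in
     if T < \<infinity> then ennreal (min 1 \<bar>Y (real_of_ereal T + 1 / real (Suc k)) \<omega> - Y (real_of_ereal T) \<omega>\<bar>) else 0)
    \<in> borel_measurable N"
proof -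
  define T where "T \<omega> = T_hit \<alpha> (\<lambda>t. Y t \<omega>) (\<gamma> \<omega> + 1 / real (Suc n))" for \<omega>
  have [measurable]: "T \<in> borel_measurable N" unfolding T_def by (intro measurable_T_hit[OF Y]) measurable
  have T0: "0 \<le> T \<omega>" for \<omega> by (simp add: T_def T_hit_nonneg)
  have [measurable]: "(\<lambda>\<omega>. Y (real_of_ereal (T \<omega>)) \<omega>) \<in> borel_measurable N"
      "(\<lambda>\<omega>. Y (real_of_ereal (T \<omega>) + 1 / real (Suc k)) \<omega>) \<in> borel_measurable N"
    using T0 by (auto intro!: cadlag_process_at_random_time[OF Y] add_nonneg_nonneg simp: real_of_ereal_pos simp del: of_nat_Suc)
  show ?thesis unfolding T_def[symmetric] Let_def by measurable
qed

lemma measurable_jump_gauge: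
  assumes Y: "cadlag_process N Y" and \<gamma>: "\<gamma> \<in> borel_measurable N"
  shows "(\<lambda>\<omega>. jump_gauge \<alpha> (\<gamma> \<omega>) (\<lambda>t. Y t \<omega>)) \<in> borel_measurable N"
  unfolding jump_gauge_def using measurable_jump_term[OF Y \<gamma>] by (intro borel_measurable_liminf)

context levy_law
begin

text \<open>By the strong Markov property at the approximating hitting times, the expectation of each term is at
most that of the increment of the path over \<open>[0, 1/(k+1)]\<close>, which tends to \<open>0\<close> by right-continuity at
\<open>0\<close>. Fatou's lemma transfers this to the iterated lower limit.\<close>

lemma AE_jump_gauge: "AE f in W. jump_gauge \<alpha> \<gamma> f = 0"
proof -
  have Y: "cadlag_process W (\<lambda>t f. f t)"
    using cadlag_process_coordinate by (simp add: cadlag_process_def space_W measurable_W)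
  define osc where "osc k n f = (let T = T_hit \<alpha> f (\<gamma> + 1 / real (Suc n)) in
     if T < \<infinity> then ennreal (min 1 \<bar>f (real_of_ereal T + 1 / real (Suc k)) - f (real_of_ereal T)\<bar>) else 0)" for k n f
  have osc[measurable]: "osc k n \<in> borel_measurable W" for k n
    unfolding osc_def using measurable_jump_term[OF Y, of "\<lambda>_. \<gamma>"] by simp
  define c where "c k = (\<integral>\<^sup>+f. ennreal (min 1 \<bar>f (1 / real (Suc k))\<bar>) \<partial>W)" for k
  have osc_le: "(\<integral>\<^sup>+f. osc k n f \<partial>W) \<le> c k" for k n
  proof -
    define T where "T f = T_hit \<alpha> f (\<gamma> + 1 / real (Suc n))" for f
    have T: "stopping_functional T" unfolding T_def by (rule stopping_functional_T_hit)
    define \<psi> where "\<psi> f = ennreal (min 1 \<bar>f (1 / real (Suc k))\<bar>)" for f :: "real \<Rightarrow> real"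
    have [measurable]: "(\<lambda>f. f (1 / real (Suc k))) \<in> borel_measurable cadlag_space"
      by (rule cadlag_processD(1)[OF cadlag_process_coordinate]) simp
    have \<psi>: "\<psi> \<in> borel_measurable cadlag_space" unfolding \<psi>_def by measurable
    have "(\<integral>\<^sup>+f. osc k n f \<partial>W) = (\<integral>\<^sup>+f. indicator (stopped_event T (space cadlag_space)) f * \<psi> (shift_path (real_of_ereal (T f)) f) \<partial>W)"
    proof (rule nn_integral_cong)
      fix f assume "f \<in> space W"
      then have f: "f \<in> space cadlag_space" by (simp add: space_W)
      have "stop_path (T f) f \<in> space cadlag_space" by (rule measurable_space[OF measurable_stop_at[OF T] f])
      then show "osc k n f = indicator (stopped_event T (space cadlag_space)) f * \<psi> (shift_path (real_of_ereal (T f)) f)"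
        using f by (simp add: osc_def T_def[symmetric] Let_def \<psi>_def stopped_event_def shift_path_def indicator_def del: of_nat_Suc)
    qed
    also have "\<dots> = emeasure W (stopped_event T (space cadlag_space)) * (\<integral>\<^sup>+f. \<psi> f \<partial>W)"
      by (rule strong_markov[OF T _ \<psi>]) simp
    also have "\<dots> \<le> 1 * (\<integral>\<^sup>+f. \<psi> f \<partial>W)" by (intro mult_right_mono emeasure_le_1) simp
    finally show ?thesis by (simp add: c_def \<psi>_def)
  qed
  have c: "c \<longlonglongrightarrow> 0"
  proof -
    have "c \<longlonglongrightarrow> (\<integral>\<^sup>+f. 0 \<partial>W)"
      unfolding c_def
    proof (rule nn_integral_dominated_convergence[where w="\<lambda>_. 1"])
      show "(\<lambda>f. ennreal (min 1 \<bar>f (1 / real (Suc k))\<bar>)) \<in> borel_measurable W" for k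
      proof -
        have [measurable]: "(\<lambda>f. f (1 / real (Suc k))) \<in> borel_measurable W" by (rule cadlag_processD(1)[OF Y]) simp
        show ?thesis by measurable
      qed
      show "AE f in W. ennreal (min 1 \<bar>f (1 / real (Suc k))\<bar>) \<le> 1" for k
        by (simp add: ennreal_le_1)
      show "AE f in W. (\<lambda>k. ennreal (min 1 \<bar>f (1 / real (Suc k))\<bar>)) \<longlonglongrightarrow> 0"
        using starts_at_zero AE_space
      proof eventually_elim
        case (elim f)
        then have f: "cadlag_on {0..} f" by (simp add: space_W space_cadlag_space)
        have "filterlim (\<lambda>k. 1 / real (Suc k)) (at_right 0) sequentially"
          unfolding filterlim_at using LIMSEQ_inverse_real_of_nat by (simp add: inverse_eq_divide)
        from filterlim_compose[OF cadlag_right_limit[OF f] this] elim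
        have "(\<lambda>k. f (1 / real (Suc k))) \<longlonglongrightarrow> 0" by simp
        then have "(\<lambda>k. ennreal (min 1 \<bar>f (1 / real (Suc k))\<bar>)) \<longlonglongrightarrow> ennreal (min 1 \<bar>0\<bar>)"
          by (intro tendsto_ennrealI tendsto_min tendsto_const tendsto_rabs)
        then show ?case by simp
      qed
    qed (simp_all add: emeasure_space_1)
    then show ?thesis by simp
  qed
  have "(\<integral>\<^sup>+f. jump_gauge \<alpha> \<gamma> f \<partial>W) \<le> liminf (\<lambda>k. \<integral>\<^sup>+f. liminf (\<lambda>n. osc k n f) \<partial>W)"
    unfolding jump_gauge_def osc_def[symmetric] by (rule nn_integral_liminf) measurable
  also have "\<dots> \<le> liminf c"
  proof (rule Liminf_mono, rule always_eventually, rule allI)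
    fix k
    have "(\<integral>\<^sup>+f. liminf (\<lambda>n. osc k n f) \<partial>W) \<le> liminf (\<lambda>n. \<integral>\<^sup>+f. osc k n f \<partial>W)" by (rule nn_integral_liminf) measurable
    also have "\<dots> \<le> liminf (\<lambda>n. c k)" by (rule Liminf_mono) (simp add: osc_le)
    finally show "(\<integral>\<^sup>+f. liminf (\<lambda>n. osc k n f) \<partial>W) \<le> c k" by (simp add: Liminf_const)
  qed
  also have "liminf c = 0" using c by (rule lim_imp_Liminf[rotated]) simp
  finally have "(\<integral>\<^sup>+f. jump_gauge \<alpha> \<gamma> f \<partial>W) = 0" by simp
  moreover have "(\<lambda>f. jump_gauge \<alpha> \<gamma> f) \<in> borel_measurable W"
    using measurable_jump_gauge[OF Y, of "\<lambda>_. \<gamma>"] by simp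
  ultimately show ?thesis by (simp add: nn_integral_0_iff_AE)
qed

lemma AE_no_upward_jump_at_hitting_time:
  "AE f in W. \<forall>t. T_hit \<alpha> f \<gamma> = ereal t \<longrightarrow> 0 < t \<longrightarrow> f t \<le> left_lim0 f t"
  using AE_jump_gauge[of \<alpha> \<gamma>] AE_space
proof eventually_elim
  case (elim f)
  then have "cadlag_on {0..} f" by (simp add: space_W space_cadlag_space)
  then show ?case using jump_gauge_pos elim by (meson not_le)
qed

end


section \<open>Linear growth of the path\<close>

text \<open>The maximum of the partial sums of \<open>\<xi>\<close> along the unit shifts, including the empty sum. The recursion is
the identity from which the maximal ergodic inequality is read off.\<close>

primrec walk_max :: "((real \<Rightarrow> real) \<Rightarrow> real) \<Rightarrow> nat \<Rightarrow> (real \<Rightarrow> real) \<Rightarrow> real" where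
  "walk_max \<xi> 0 f = 0"
| "walk_max \<xi> (Suc n) f = max 0 (\<xi> f + walk_max \<xi> n (shift_path 1 f))"

lemma walk_max_nonneg: "0 \<le> walk_max \<xi> n f"
  by (cases n) auto

lemma walk_max_mono: "m \<le> n \<Longrightarrow> walk_max \<xi> m f \<le> walk_max \<xi> n f"
proof -
  have "walk_max \<xi> n f \<le> walk_max \<xi> (Suc n) f" for n
  proof (induction n arbitrary: f)
    case (Suc n)
    then show ?case using Suc[of "shift_path 1 f"] unfolding walk_max.simps(2)[of \<xi> n f] walk_max.simps(2)[of \<xi> "Suc n" f]
      by linarith
  qed simp
  then show "m \<le> n \<Longrightarrow> walk_max \<xi> m f \<le> walk_max \<xi> n f" by (rule lift_Suc_mono_le)
qed

definition walk :: "real \<Rightarrow> real \<Rightarrow> nat \<Rightarrow> (real \<Rightarrow> real) \<Rightarrow> real" where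
  "walk \<sigma> \<beta> k f = \<sigma> * (f (real k) - f 0) + \<beta> * real k"

lemma walk_0: "walk \<sigma> \<beta> 0 f = 0"
  by (simp add: walk_def)

lemma walk_Suc: "walk \<sigma> \<beta> (Suc k) f = walk \<sigma> \<beta> 1 f + walk \<sigma> \<beta> k (shift_path 1 f)"
  by (simp add: walk_def shift_path_def algebra_simps)

lemma walk_le_walk_max: "walk \<sigma> \<beta> k f \<le> walk_max (walk \<sigma> \<beta> 1) k f"
proof (induction k arbitrary: f)
  case (Suc k)
  then show ?case unfolding walk_Suc walk_max.simps(2) using Suc[of "shift_path 1 f"] by linarith
qed (simp add: walk_0)

definition walk_unbounded :: "real \<Rightarrow> real \<Rightarrow> (real \<Rightarrow> real) set" where
  "walk_unbounded \<sigma> \<beta> = {f\<in>space cadlag_space. \<forall>c::nat. \<exists>k. real c < walk \<sigma> \<beta> k f}"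

lemma space_cadlag_space_shift: "f \<in> space cadlag_space \<Longrightarrow> 0 \<le> b \<Longrightarrow> shift_path b f \<in> space cadlag_space"
  by (rule measurable_space[OF measurable_shift_path_const])

lemma shift_mem_walk_unbounded:
  assumes f: "f \<in> space cadlag_space"
  shows "shift_path 1 f \<in> walk_unbounded \<sigma> \<beta> \<longleftrightarrow> f \<in> walk_unbounded \<sigma> \<beta>"
proof -
  define x where "x = walk \<sigma> \<beta> 1 f"
  have step: "walk \<sigma> \<beta> (Suc k) f = x + walk \<sigma> \<beta> k (shift_path 1 f)" for k unfolding x_def by (rule walk_Suc)
  have "\<exists>k. real c < walk \<sigma> \<beta> k (shift_path 1 f)" if *: "\<forall>c::nat. \<exists>k. real c < walk \<sigma> \<beta> k f" for c :: nat
  proof -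
    obtain c' :: nat where c': "real c + \<bar>x\<bar> < real c'" using reals_Archimedean2 by blast
    obtain k where k: "real c' < walk \<sigma> \<beta> k f" using * by blast
    have "k \<noteq> 0"
    proof
      assume "k = 0"
      then show False using k by (simp add: walk_0)
    qed
    then obtain j where j: "k = Suc j" using not0_implies_Suc by blast
    have "real c < walk \<sigma> \<beta> j (shift_path 1 f)" using k step[of j] c' unfolding j by linarith
    then show ?thesis by blast
  qed
  moreover have "\<exists>k. real c < walk \<sigma> \<beta> k f" if *: "\<forall>c::nat. \<exists>k. real c < walk \<sigma> \<beta> k (shift_path 1 f)" for c :: nat
  proof -
    obtain c' :: nat where c': "real c + \<bar>x\<bar> < real c'" using reals_Archimedean2 by blast
    obtain k where k: "real c' < walk \<sigma> \<beta> k (shift_path 1 f)" using * by blast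
    have "real c < walk \<sigma> \<beta> (Suc k) f" using k step[of k] c' by linarith
    then show ?thesis by blast
  qed
  ultimately show ?thesis
    unfolding walk_unbounded_def mem_Collect_eq using f space_cadlag_space_shift[OF f, of 1] by auto
qed

lemma measurable_walk[measurable]: "walk \<sigma> \<beta> k \<in> borel_measurable cadlag_space"
proof -
  have [measurable]: "(\<lambda>f. f (real k)) \<in> borel_measurable cadlag_space" for k
    by (rule cadlag_processD(1)[OF cadlag_process_coordinate]) simp
  have [measurable]: "(\<lambda>f. f 0) \<in> borel_measurable cadlag_space"
    by (rule cadlag_processD(1)[OF cadlag_process_coordinate]) simp
  show ?thesis unfolding walk_def by measurable
qed

lemma sets_walk_unbounded[measurable]: "walk_unbounded \<sigma> \<beta> \<in> sets cadlag_space"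
  unfolding walk_unbounded_def by measurable

context levy_law
begin

lemma integrable_shift_iff:
  fixes g :: "(real \<Rightarrow> real) \<Rightarrow> real"
  assumes "g \<in> borel_measurable cadlag_space" "0 \<le> b"
  shows "integrable W (\<lambda>f. g (shift_path b f)) \<longleftrightarrow> integrable W g"
    and "(\<integral>f. g (shift_path b f) \<partial>W) = (\<integral>f. g f \<partial>W :: real)"
proof -
  have s: "shift_path b \<in> W \<rightarrow>\<^sub>M cadlag_space" using measurable_shift_path_const[OF assms(2)] by (simp add: measurable_W)
  show "integrable W (\<lambda>f. g (shift_path b f)) \<longleftrightarrow> integrable W g"
    unfolding integrable_distr_eq[OF s assms(1), symmetric] distr_shift_path[OF assms(2)] ..
  show "(\<integral>f. g (shift_path b f) \<partial>W) = (\<integral>f. g f \<partial>W :: real)"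
    unfolding integral_distr[OF s assms(1), symmetric] distr_shift_path[OF assms(2)] ..
qed

lemma integrable_walk_max:
  assumes "integrable W \<xi>"
  shows "integrable W (walk_max \<xi> n)"
proof (induction n)
  case (Suc n)
  have "walk_max \<xi> n \<in> borel_measurable cadlag_space"
    using borel_measurable_integrable[OF Suc] by (simp add: measurable_W)
  from integrable_shift_iff(1)[OF this, of 1] Suc
  have "integrable W (\<lambda>f. walk_max \<xi> n (shift_path 1 f))" by simp
  from integrable_max[OF integrable_const Bochner_Integration.integrable_add[OF assms this], of 0]
  show ?case unfolding walk_max.simps(2)[abs_def] .
next
  case 0
  have "walk_max \<xi> 0 = (\<lambda>_. 0)" by auto
  then show ?case by simp
qed

lemma indep_var_stop_shift:
  assumes "0 \<le> b"
  shows "indep_var cadlag_space (stop_path (ereal b)) cadlag_space (shift_path b)"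
  unfolding indep_var_distribution_eq distr_shift_path[OF assms] markov[OF assms] measurable_W
  using measurable_stop_path_const[OF assms] measurable_shift_path_const[OF assms] by blast

text \<open>The maximal ergodic inequality on the shift-invariant event \<open>A\<close> that the walk is unbounded above.
With \<open>M\<^sub>n\<close> the running maximum and \<open>\<theta>\<close> the unit shift, the first step \<open>\<xi>\<close> equals \<open>M\<^sub>n\<^sub>+\<^sub>1 - M\<^sub>n \<circ> \<theta>\<close> where
\<open>M\<^sub>n\<^sub>+\<^sub>1 > 0\<close>, whence \<open>E[\<xi>; A, M\<^sub>n\<^sub>+\<^sub>1 > 0] \<ge> E[M\<^sub>n; A] - E[M\<^sub>n \<circ> \<theta>; A] = 0\<close>. On \<open>A\<close> the maximum is eventually
positive, so \<open>E[\<xi>; A] \<ge> 0\<close>. But \<open>A\<close> is an event of the shifted path and hence independent of \<open>\<xi>\<close>, so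
\<open>E[\<xi>; A] = E[\<xi>] P(A)\<close>, and the mean of \<open>\<xi>\<close> is negative.\<close>

lemma prob_walk_unbounded:
  assumes int: "integrable W (walk \<sigma> \<beta> 1)" and neg: "(\<integral>f. walk \<sigma> \<beta> 1 f \<partial>W) < 0"
  shows "prob (walk_unbounded \<sigma> \<beta>) = 0"
proof -
  let ?A = "walk_unbounded \<sigma> \<beta>" and ?\<xi> = "walk \<sigma> \<beta> 1" and ?\<theta> = "shift_path 1"
  let ?M = "walk_max (walk \<sigma> \<beta> 1)"
  have A[measurable]: "?A \<in> sets W" using sets_walk_unbounded by (simp add: sets_W)
  have \<theta>: "?\<theta> \<in> W \<rightarrow>\<^sub>M cadlag_space" using measurable_shift_path_const[of 1] by (simp add: measurable_W)
  have M_int: "integrable W (?M n)" for n by (rule integrable_walk_max[OF int])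
  have M_meas: "?M n \<in> borel_measurable cadlag_space" for n
    using borel_measurable_integrable[OF M_int] by (simp add: measurable_W)
  note [measurable] = borel_measurable_integrable[OF M_int] borel_measurable_integrable[OF int]
  have ind: "indicator ?A (?\<theta> f) = (indicator ?A f :: real)" if "f \<in> space W" for f
    using shift_mem_walk_unbounded[of f \<sigma> \<beta>] that by (simp add: space_W indicator_def)
  have term_meas: "(\<lambda>f. indicator ?A f * (?\<xi> f * indicator {f\<in>space W. 0 < ?M (Suc n) f} f)) \<in> borel_measurable W" for n
  proof -
    define g where "g = ?M (Suc n)"
    have [measurable]: "g \<in> borel_measurable W" unfolding g_def by (rule borel_measurable_integrable[OF M_int])
    show ?thesis unfolding g_def[symmetric] by measurable
  qed
  have pos: "0 \<le> (\<integral>f. indicator ?A f * (?\<xi> f * indicator {f\<in>space W. 0 < ?M (Suc n) f} f) \<partial>W)" for n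
  proof -
    have AM: "integrable W (\<lambda>f. indicator ?A f * ?M n f)"
      using integrable_real_mult_indicator[OF A M_int] by (simp add: mult.commute)
    have "(\<lambda>f. indicator ?A f * ?M n f) \<in> borel_measurable cadlag_space"
      using borel_measurable_integrable[OF AM] by (simp add: measurable_W)
    note sh = integrable_shift_iff[OF this, of 1]
    have "integrable W (\<lambda>f. indicator ?A (?\<theta> f) * ?M n (?\<theta> f))" using sh(1) AM by simp
    then have AM': "integrable W (\<lambda>f. indicator ?A f * ?M n (?\<theta> f))"
      by (rule Bochner_Integration.integrable_cong[THEN iffD1, OF refl, rotated]) (simp only: ind)
    have "(\<integral>f. indicator ?A f * ?M n (?\<theta> f) \<partial>W) = (\<integral>f. indicator ?A (?\<theta> f) * ?M n (?\<theta> f) \<partial>W)"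
      by (rule Bochner_Integration.integral_cong[OF refl]) (simp only: ind)
    also have "\<dots> = (\<integral>f. indicator ?A f * ?M n f \<partial>W)" by (rule sh(2)) simp
    finally have "(\<integral>f. indicator ?A f * ?M n (?\<theta> f) \<partial>W) = (\<integral>f. indicator ?A f * ?M n f \<partial>W)" .
    then have "0 = (\<integral>f. indicator ?A f * ?M n f - indicator ?A f * ?M n (?\<theta> f) \<partial>W)"
      using AM AM' by simp
    also have "\<dots> \<le> (\<integral>f. indicator ?A f * (?\<xi> f * indicator {f\<in>space W. 0 < ?M (Suc n) f} f) \<partial>W)"
    proof (rule integral_mono)
      show "integrable W (\<lambda>f. indicator ?A f * ?M n f - indicator ?A f * ?M n (?\<theta> f))" using AM AM' by simp
      show "integrable W (\<lambda>f. indicator ?A f * (?\<xi> f * indicator {f\<in>space W. 0 < ?M (Suc n) f} f))"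
      proof (rule Bochner_Integration.integrable_bound[OF int])
        show "(\<lambda>f. indicator ?A f * (?\<xi> f * indicator {f\<in>space W. 0 < ?M (Suc n) f} f)) \<in> borel_measurable W"
          by (simp only: term_meas)
      qed (auto simp: indicator_def)
      fix f assume f: "f \<in> space W"
      have "?M n f \<le> ?M (Suc n) f" by (rule walk_max_mono) simp
      then show "indicator ?A f * ?M n f - indicator ?A f * ?M n (?\<theta> f) \<le> indicator ?A f * (?\<xi> f * indicator {f\<in>space W. 0 < ?M (Suc n) f} f)"
        using f walk_max_nonneg[of ?\<xi> n "?\<theta> f"]
        unfolding walk_max.simps(2) by (cases "f \<in> ?A"; cases "0 < ?\<xi> f + ?M n (?\<theta> f)") (auto simp: indicator_def)
    qed
    finally show ?thesis .
  qed
  have "(\<lambda>n. \<integral>f. indicator ?A f * (?\<xi> f * indicator {f\<in>space W. 0 < ?M (Suc n) f} f) \<partial>W) \<longlonglongrightarrow> (\<integral>f. indicator ?A f * ?\<xi> f \<partial>W)"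
  proof (rule integral_dominated_convergence[where w="\<lambda>f. \<bar>?\<xi> f\<bar>"])
    show "integrable W (\<lambda>f. \<bar>?\<xi> f\<bar>)" using int by simp
    show "AE f in W. (\<lambda>n. indicator ?A f * (?\<xi> f * indicator {f\<in>space W. 0 < ?M (Suc n) f} f)) \<longlonglongrightarrow> indicator ?A f * ?\<xi> f"
    proof (rule AE_I2)
      fix f assume f: "f \<in> space W"
      show "(\<lambda>n. indicator ?A f * (?\<xi> f * indicator {f\<in>space W. 0 < ?M (Suc n) f} f)) \<longlonglongrightarrow> indicator ?A f * ?\<xi> f"
      proof (cases "f \<in> ?A")
        case True
        then obtain k where "real 0 < walk \<sigma> \<beta> k f" unfolding walk_unbounded_def by blast
        then have k: "0 < ?M k f" using walk_le_walk_max[of \<sigma> \<beta> k f] by simp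
        have "0 < ?M (Suc n) f" if "k \<le> n" for n using walk_max_mono[of k "Suc n" ?\<xi> f] that k by linarith
        then have "\<forall>\<^sub>F n in sequentially. indicator ?A f * (?\<xi> f * indicator {f\<in>space W. 0 < ?M (Suc n) f} f) = indicator ?A f * ?\<xi> f"
          using f by (intro eventually_sequentiallyI[of k]) (simp add: indicator_def del: walk_max.simps)
        then show ?thesis by (rule tendsto_eventually)
      qed simp
    qed
    show "(\<lambda>f. indicator ?A f * ?\<xi> f) \<in> borel_measurable W" by measurable
    show "AE f in W. norm (indicator ?A f * (?\<xi> f * indicator {f\<in>space W. 0 < ?M (Suc n) f} f)) \<le> \<bar>?\<xi> f\<bar>" for n
      by (auto simp: indicator_def)
  qed (simp only: term_meas)
  then have "0 \<le> (\<integral>f. indicator ?A f * ?\<xi> f \<partial>W)" using pos by (intro LIMSEQ_le_const) auto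
  also have "\<dots> = (\<integral>f. ?\<xi> (stop_path (ereal 1) f) * indicator ?A (?\<theta> f) \<partial>W)"
    by (rule Bochner_Integration.integral_cong) (auto simp: ind walk_def stop_path_def)
  also have "\<dots> = (\<integral>f. ?\<xi> (stop_path (ereal 1) f) \<partial>W) * (\<integral>f. indicator ?A (?\<theta> f) \<partial>W)"
  proof (rule indep_var_lebesgue_integral)
    show "indep_var borel (\<lambda>f. ?\<xi> (stop_path (ereal 1) f)) borel (\<lambda>f. indicator ?A (?\<theta> f) :: real)"
      using indep_var_compose[OF indep_var_stop_shift[of 1], of ?\<xi> borel "indicator ?A :: _ \<Rightarrow> real" borel] by (simp add: comp_def)
    show "integrable W (\<lambda>f. ?\<xi> (stop_path (ereal 1) f))"
      using int by (simp add: walk_def[abs_def] stop_path_def)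
    show "integrable W (\<lambda>f. indicator ?A (?\<theta> f) :: real)"
      by (subst Bochner_Integration.integrable_cong[OF refl ind]) (auto simp: emeasure_eq_measure)
  qed
  also have "(\<integral>f. ?\<xi> (stop_path (ereal 1) f) \<partial>W) = (\<integral>f. ?\<xi> f \<partial>W)"
    by (simp add: walk_def stop_path_def)
  also have "(\<integral>f. indicator ?A (?\<theta> f) \<partial>W) = prob ?A"
    using ind by (simp cong: Bochner_Integration.integral_cong)
  finally have "0 \<le> (\<integral>f. ?\<xi> f \<partial>W) * prob ?A" .
  then show ?thesis using neg measure_nonneg[of W ?A] by (simp add: zero_le_mult_iff)
qed

lemma AE_integer_times_bounded_below:
  assumes int: "integrable W (\<lambda>f. f 1)" and drift: "0 < \<sigma> * (\<integral>f. f 1 \<partial>W) + \<beta>"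
  shows "AE f in W. \<exists>c::nat. \<forall>k::nat. - real c \<le> \<sigma> * f (real k) + \<beta> * real k"
proof -
  have Y: "cadlag_process W (\<lambda>t f. f t)"
    using cadlag_process_coordinate by (simp add: cadlag_process_def space_W measurable_W)
  have [measurable]: "(\<lambda>f. f 0) \<in> borel_measurable W" using cadlag_processD(1)[OF Y] by simp
  have "integrable W (\<lambda>f. f 0) \<and> (\<integral>f. f 0 \<partial>W) = 0"
    using starts_at_zero integrable_cong_AE[of "\<lambda>f. f 0" W "\<lambda>_. 0"] integral_cong_AE[of "\<lambda>f. f 0" W "\<lambda>_. 0"] by simp
  then have "integrable W (walk (-\<sigma>) (-\<beta>) 1)" "(\<integral>f. walk (-\<sigma>) (-\<beta>) 1 f \<partial>W) < 0"
    using int drift by (simp_all add: walk_def[abs_def] prob_space)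
  from prob_walk_unbounded[OF this]
  have "AE f in W. f \<notin> walk_unbounded (-\<sigma>) (-\<beta>)"
    using sets_walk_unbounded by (intro AE_not_in) (auto simp: null_sets_def emeasure_eq_measure sets_W)
  then show ?thesis using starts_at_zero AE_space
  proof eventually_elim
    case (elim f)
    then obtain c :: nat where "\<forall>k. walk (-\<sigma>) (-\<beta>) k f \<le> real c"
      by (auto simp: walk_unbounded_def space_W not_less)
    moreover have "walk (-\<sigma>) (-\<beta>) k f = - (\<sigma> * f (real k) + \<beta> * real k)" for k
      using elim by (simp add: walk_def)
    ultimately have *: "- (\<sigma> * f (real k) + \<beta> * real k) \<le> real c" for k by metis
    have "- real c \<le> \<sigma> * f (real k) + \<beta> * real k" for k using *[of k] by linarith
    then show ?case by blast
  qed
qed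

end


lemma cadlag_uminus: "cadlag_on {0..} f \<Longrightarrow> cadlag_on {0..} (\<lambda>t. - f t)"
  using tendsto_minus unfolding cadlag_half_line_iff by blast

lemma cadlag_bounded_above_unit_interval:
  assumes f: "cadlag_on {0..} f"
  shows "\<exists>a::nat. \<forall>s\<in>{0..1}. f s - f 0 \<le> real a"
proof -
  have "cadlag_on {0..} (\<lambda>t. - f t)" using f by (rule cadlag_uminus)
  from lower_value_attains_minimum[OF this, of 0 1] obtain t
    where t: "\<forall>s\<in>{0..1}. lower_value (\<lambda>t. - f t) t \<le> lower_value (\<lambda>t. - f t) s" by auto
  obtain a :: nat where a: "- lower_value (\<lambda>t. - f t) t - f 0 < real a" using reals_Archimedean2 by blast
  have "f s - f 0 \<le> real a" if "s \<in> {0..1}" for s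
    using bspec[OF t that] lower_value_le[of "\<lambda>t. - f t" s] a by linarith
  then show ?thesis by blast
qed

text \<open>Used to pass from real times to integer times: if the path is low at some time and its
continuation after that time is in this set, then it is still low at the next integer.\<close>

definition rise_bounded :: "real \<Rightarrow> (real \<Rightarrow> real) set" where
  "rise_bounded a = {f\<in>space cadlag_space. \<forall>s\<in>{0..1}. f s - f 0 \<le> a}"

lemma sets_rise_bounded[measurable]: "rise_bounded a \<in> sets cadlag_space"
proof -
  have "rise_bounded a = {f\<in>space cadlag_space. \<forall>q\<in>\<rat> \<inter> {0..1}. f q - f 0 \<le> a}"
  proof (rule set_eqI, rule iffI)
    fix f assume f: "f \<in> {f\<in>space cadlag_space. \<forall>q\<in>\<rat> \<inter> {0..1}. f q - f 0 \<le> a}"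
    then have c: "cadlag_on {0..} f" by (simp add: space_cadlag_space)
    have "f s - f 0 \<le> a" if s: "s \<in> {0..1}" for s
    proof (cases "s = 1")
      case True
      then show ?thesis using f by auto
    next
      case False
      show ?thesis
      proof (rule ccontr)
        assume "\<not> f s - f 0 \<le> a"
        then have "a + f 0 < f s" by simp
        then have "\<forall>\<^sub>F u in at_right s. a + f 0 < f u"
          using s by (intro order_tendstoD(1)[OF cadlag_right_limit[OF c]]) auto
        from eventually_at_right_rational[OF this, of "1 - s"] False s obtain q
          where "q \<in> \<rat>" "s < q" "q < 1" "a + f 0 < f q" by auto
        moreover then have "q \<in> \<rat> \<inter> {0..1}" using s by auto
        ultimately show False using f by force
      qed
    qed
    then show "f \<in> rise_bounded a" using f by (simp add: rise_bounded_def)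
  qed (auto simp: rise_bounded_def)
  moreover have "{f\<in>space cadlag_space. \<forall>q\<in>\<rat> \<inter> {0..1}. f q - f 0 \<le> a} \<in> sets cadlag_space"
  proof (rule sets.sets_Collect_countable_All')
    show "countable (\<rat> \<inter> {0..1} :: real set)" by (rule countable_subset[OF _ countable_rat]) auto
    fix q :: real assume "q \<in> \<rat> \<inter> {0..1}"
    then have [measurable]: "(\<lambda>f. f q) \<in> borel_measurable cadlag_space" "(\<lambda>f. f 0) \<in> borel_measurable cadlag_space"
      using cadlag_processD(1)[OF cadlag_process_coordinate] by auto
    show "{f\<in>space cadlag_space. f q - f 0 \<le> a} \<in> sets cadlag_space" by measurable
  qed
  ultimately show ?thesis by simp
qed

text \<open>Since \<open>f t + \<alpha> * t\<close> tends to infinity, its infimum is an infimum over a compact interval, where the lower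
semicontinuous lower values attain it. Strictness before \<open>s\<close> expresses that \<open>s\<close> is the first such time.\<close>

lemma T_min_attained:
  assumes f: "cadlag_on {0..} f" "f 0 = 0" and low: "\<And>t. 0 \<le> t \<Longrightarrow> - c \<le> f t + \<beta> * t" and \<beta>: "\<beta> < \<alpha>"
  obtains s m where "T_min \<alpha> f = ereal s" "0 \<le> s" "lower_value f s + \<alpha> * s = m"
    "\<And>u. 0 \<le> u \<Longrightarrow> m \<le> lower_value f u + \<alpha> * u" "\<And>u. 0 \<le> u \<Longrightarrow> u < s \<Longrightarrow> m < lower_value f u + \<alpha> * u"
proof -
  define g where "g t = f t + \<alpha> * t" for t
  have g: "cadlag_on {0..} g" unfolding g_def by (intro cadlag_add_continuous f continuous_intros)
  have lg: "lower_value g t = lower_value f t + \<alpha> * t" if "0 \<le> t" for t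
    unfolding g_def using that by (subst lower_value_add_continuous[OF f(1)]) (auto intro!: continuous_intros)
  \<comment> \<open>beyond \<open>K\<close> the tilted path \<open>g\<close> is nonnegative, while its value at \<open>0\<close> is \<open>0\<close>\<close>
  define K where "K = max 0 (c / (\<alpha> - \<beta>))"
  have K: "0 \<le> g t" if "K \<le> t" for t
  proof -
    have t: "0 \<le> t" "c / (\<alpha> - \<beta>) \<le> t" using that by (auto simp: K_def)
    then have "c \<le> (\<alpha> - \<beta>) * t" using \<beta> by (simp add: pos_divide_le_eq mult.commute)
    then show ?thesis using low[OF t(1)] by (simp add: g_def algebra_simps)
  qed
  have "0 \<le> K" by (simp add: K_def)
  from lower_value_attains_minimum[OF g order_refl this] obtain t0
    where t0: "0 \<le> t0" "\<And>s. 0 \<le> s \<Longrightarrow> s \<le> K \<Longrightarrow> lower_value g t0 \<le> lower_value g s" by auto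
  define m where "m = lower_value g t0"
  have "lower_value g 0 = 0" using f(2) by (simp add: lower_value_def left_lim0_def g_def)
  then have m0: "m \<le> 0" using t0(2)[of 0] \<open>0 \<le> K\<close> by (simp add: m_def)
  have m_le_g: "m \<le> g u" if "0 \<le> u" for u
  proof (cases "u \<le> K")
    case True
    then show ?thesis using t0(2)[of u] lower_value_le[of g u] that by (simp add: m_def)
  next
    case False
    then show ?thesis using K[of u] m0 by simp
  qed
  have "ereal m \<le> (INF u\<in>{0..}. ereal (f u + \<alpha> * u))"
    using m_le_g by (intro INF_greatest) (simp add: g_def)
  moreover have "(INF u\<in>{0..}. ereal (f u + \<alpha> * u)) \<le> ereal (f 0 + \<alpha> * 0)" by (rule INF_lower) simp
  ultimately obtain I where I: "(INF u\<in>{0..}. ereal (f u + \<alpha> * u)) = ereal I" "m \<le> I"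
    by (cases "INF u\<in>{0..}. ereal (f u + \<alpha> * u)") auto
  have I_le: "I \<le> lower_value g u" if "0 \<le> u" for u
    using future_infimum_le_lower_value[OF f(1) I(1), of u] f(2) that lg by simp
  have "I = m" using I_le[OF t0(1)] I(2) by (simp add: m_def)
  define A where "A = {t. 0 \<le> t \<and> lower_value g t \<le> m}"
  have A: "closed A" "A \<subseteq> {0..}" "t0 \<in> A" unfolding A_def m_def using closed_lower_value_sublevel[OF g] t0 by auto
  have "{t. 0 \<le> t \<and> ereal (min (f t) (left_lim0 f t) + \<alpha> * t) = ereal m} = A"
    unfolding A_def using lg I_le \<open>I = m\<close> by (auto simp: lower_value_def intro: antisym)
  then have T: "T_min \<alpha> f = Inf (ereal ` A)" unfolding T_min_def I(1) \<open>I = m\<close> by simp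
  have "Inf (ereal ` A) \<le> ereal t0" using A by (intro Inf_lower) auto
  moreover have "0 \<le> Inf (ereal ` A)" using A by (auto intro!: Inf_greatest)
  ultimately obtain s where s: "Inf (ereal ` A) = ereal s" by (cases "Inf (ereal ` A)") auto
  have sA: "s \<in> A" by (rule Inf_ereal_closed_attained[OF A(1,2) s])
  show thesis
  proof (rule that[of s m])
    show "T_min \<alpha> f = ereal s" using T s by simp
    show "0 \<le> s" using sA by (simp add: A_def)
    show "lower_value f s + \<alpha> * s = m" using sA lg[of s] I_le[of s] \<open>I = m\<close> by (simp add: A_def)
    show "m \<le> lower_value f u + \<alpha> * u" if "0 \<le> u" for u using I_le[OF that] lg[OF that] \<open>I = m\<close> by simp
    show "m < lower_value f u + \<alpha> * u" if "0 \<le> u" "u < s" for u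
    proof (rule ccontr)
      assume "\<not> ?thesis"
      then have "u \<in> A" using that lg[of u] by (simp add: A_def)
      then have "ereal s \<le> ereal u" unfolding s[symmetric] by (intro Inf_lower) auto
      then show False using that by simp
    qed
  qed
qed

context levy_law
begin

text \<open>Only an upper bound at integer times is needed, applied with a slope strictly between the mean and
\<open>\<alpha>\<close>; the remaining slope then brings the path below every level.\<close>

lemma AE_T_hit_finite:
  assumes int: "integrable W (\<lambda>f. f 1)" and drift: "(\<integral>f. f 1 \<partial>W) < \<alpha>"
  shows "AE f in W. \<forall>\<gamma>. T_hit \<alpha> f \<gamma> < \<infinity>"
proof -
  define \<beta> where "\<beta> = (\<alpha> + (\<integral>f. f 1 \<partial>W)) / 2"
  have \<beta>: "\<beta> < \<alpha>" "0 < (-1) * (\<integral>f. f 1 \<partial>W) + \<beta>" using drift by (auto simp: \<beta>_def)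
  from AE_integer_times_bounded_below[OF int \<beta>(2)] show ?thesis
  proof eventually_elim
    case (elim f)
    then obtain c :: nat where c: "\<And>k. - real c \<le> (-1) * f (real k) + \<beta> * real k" by blast
    show ?case
    proof
      fix \<gamma>
      obtain k :: nat where "(real c - \<gamma>) / (\<alpha> - \<beta>) < real k" using reals_Archimedean2 by blast
      then have "real c - \<gamma> < (\<alpha> - \<beta>) * real k" using \<beta>(1) by (simp add: pos_divide_less_eq mult.commute)
      then have "lower_value f (real k) - \<alpha> * real k \<le> \<gamma>"
        using c[of k] lower_value_le[of f "real k"] by (simp add: algebra_simps)
      then have "T_hit \<alpha> f \<gamma> \<le> ereal (real k)" unfolding T_hit_eq by (intro Inf_lower) auto
      then show "T_hit \<alpha> f \<gamma> < \<infinity>" by (rule le_less_trans) simp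
    qed
  qed
qed

lemma exists_rise_bound: "\<exists>a::nat. 1 / 2 \<le> emeasure W (rise_bounded (real a))"
proof -
  have "incseq (\<lambda>a::nat. rise_bounded (real a))"
    by (rule incseq_SucI) (fastforce simp: rise_bounded_def)
  then have "(\<lambda>a::nat. emeasure W (rise_bounded (real a))) \<longlonglongrightarrow> emeasure W (\<Union>a::nat. rise_bounded (real a))"
    using sets_rise_bounded by (intro Lim_emeasure_incseq) (auto simp: sets_W)
  also have "(\<Union>a::nat. rise_bounded (real a)) = space W"
    using cadlag_bounded_above_unit_interval by (fastforce simp: rise_bounded_def space_W space_cadlag_space)
  finally have "(\<lambda>a::nat. emeasure W (rise_bounded (real a))) \<longlonglongrightarrow> 1" by (simp add: emeasure_space_1)
  then have "\<forall>\<^sub>F a in sequentially. 1 / 2 < emeasure W (rise_bounded (real a))"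
    by (rule order_tendstoD) (simp add: divide_less_ennreal)
  then show ?thesis using eventually_happens'[OF sequentially_bot] less_imp_le by blast
qed

text \<open>Let \<open>H c\<close> be the event that \<open>f t + \<beta> * t\<close> falls to the level \<open>- c\<close>. By the strong Markov property the path
rises by at most \<open>a\<close> in the unit of time after this happens, independently and with probability at least
\<open>1/2\<close>, and then some integer time has a value of at most \<open>- c + a + \<bar>\<beta>\<bar>\<close>. So \<open>H c\<close> has at most twice the
probability of the latter event \<open>D c\<close>, which tends to \<open>0\<close> as \<open>c\<close> grows, by the result for integer times.\<close>

lemma AE_bounded_below_line:
  assumes int: "integrable W (\<lambda>f. f 1)" and drift: "0 < (\<integral>f. f 1 \<partial>W) + \<beta>"
  shows "AE f in W. \<exists>c::nat. \<forall>t\<ge>0. - real c \<le> f t + \<beta> * t"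
proof -
  obtain a :: nat where a: "1 / 2 \<le> emeasure W (rise_bounded (real a))" using exists_rise_bound by blast
  define T where "T c f = T_hit (-\<beta>) f (- real c)" for c :: nat and f
  define H where "H c = stopped_event (T c) (space cadlag_space)" for c
  have T: "stopping_functional (T c)" for c unfolding T_def by (rule stopping_functional_T_hit)
  have H[measurable]: "H c \<in> sets W" for c unfolding H_def using sets_stopped_event[OF T] by (simp add: sets_W)
  have coord: "(\<lambda>f. f (real k)) \<in> borel_measurable W" for k
    using cadlag_processD(1)[OF cadlag_process_coordinate, of "real k"] by (simp add: measurable_W)
  define D where "D c = {f\<in>space W. \<exists>k::nat. f (real k) + \<beta> * real k \<le> - real c + real a + \<bar>\<beta>\<bar>}" for c :: nat
  have D[measurable]: "D c \<in> sets W" for c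
    unfolding D_def using coord by measurable
  have half: "emeasure W (H c) * (1 / 2) \<le> emeasure W (D c)" for c
  proof -
    let ?s = "\<lambda>f. shift_path (real_of_ereal (T c f)) f"
    have "emeasure W (H c) * (1 / 2) \<le> emeasure W (H c) * emeasure W (rise_bounded (real a))"
      by (intro mult_left_mono a) simp
    also have "\<dots> = (\<integral>\<^sup>+f. indicator (H c) f * indicator (rise_bounded (real a)) (?s f) \<partial>W)"
      unfolding H_def using sets_rise_bounded[of "real a"]
      by (subst strong_markov[OF T]) (simp_all add: sets_W)
    also have "\<dots> \<le> (\<integral>\<^sup>+f. indicator (D c) f \<partial>W)"
    proof (rule nn_integral_mono_AE)
      show "AE f in W. indicator (H c) f * indicator (rise_bounded (real a)) (?s f) \<le> (indicator (D c) f :: ennreal)"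
        using AE_no_upward_jump_at_hitting_time[of "-\<beta>" "- real c"] starts_at_zero AE_space
      proof eventually_elim
        case (elim f)
        have f: "cadlag_on {0..} f" using elim by (simp add: space_W space_cadlag_space)
        show ?case
        proof (cases "f \<in> H c \<and> ?s f \<in> rise_bounded (real a)")
          case True
          then obtain t where t: "T c f = ereal t" using T_hit_nonneg[of "-\<beta>" f "- real c"]
            by (cases "T c f") (auto simp: H_def stopped_event_def T_def)
          note hit = T_hit_attained[OF f t[unfolded T_def]]
          have "f t = lower_value f t"
            using elim t hit(1) by (cases "t = 0") (auto simp: T_def lower_value_def left_lim0_def min_def)
          then have ft: "f t + \<beta> * t \<le> - real c" using hit(2) by simp
          define k where "k = nat \<lceil>t\<rceil>"
          have k: "t \<le> real k" "real k - t \<le> 1" using hit(1) unfolding k_def by linarith+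
          have "shift_path t f (real k - t) - shift_path t f 0 \<le> real a"
            using True t k by (auto simp: rise_bounded_def)
          then have "f (real k) - f t \<le> real a" using k by (simp add: shift_path_def)
          moreover have "\<beta> * (real k - t) \<le> \<bar>\<beta>\<bar>"
          proof -
            have "\<beta> * (real k - t) \<le> \<bar>\<beta>\<bar> * (real k - t)" using k by (intro mult_right_mono) auto
            also have "\<dots> \<le> \<bar>\<beta>\<bar> * 1" using k by (intro mult_left_mono) auto
            finally show ?thesis by simp
          qed
          ultimately have "f (real k) + \<beta> * real k \<le> - real c + real a + \<bar>\<beta>\<bar>"
            using ft by (simp add: algebra_simps)
          then have "f \<in> D c" using elim by (auto simp: D_def)
          then show ?thesis by (simp add: indicator_def)
        qed (auto simp: indicator_def)
      qed
    qed
    also have "\<dots> = emeasure W (D c)" by simp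
    finally show ?thesis .
  qed
  have "decseq D"
  proof (rule decseq_SucI, rule subsetI)
    fix c f assume "f \<in> D (Suc c)"
    then obtain k :: nat where "f \<in> space W" "f (real k) + \<beta> * real k \<le> - real (Suc c) + real a + \<bar>\<beta>\<bar>"
      unfolding D_def by blast
    moreover then have "f (real k) + \<beta> * real k \<le> - real c + real a + \<bar>\<beta>\<bar>" by simp
    ultimately show "f \<in> D c" unfolding D_def by blast
  qed
  then have "(\<lambda>c. emeasure W (D c)) \<longlonglongrightarrow> emeasure W (\<Inter>c. D c)"
    using D by (intro Lim_emeasure_decseq) auto
  also have "emeasure W (\<Inter>c. D c) = 0"
  proof -
    have "0 < 1 * (\<integral>f. f 1 \<partial>W) + \<beta>" using drift by simp
    from AE_integer_times_bounded_below[OF int this] have "AE f in W. f \<notin> (\<Inter>c. D c)"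
    proof eventually_elim
      case (elim f)
      then obtain c :: nat where c: "\<And>k. - real c \<le> 1 * f (real k) + \<beta> * real k" by blast
      obtain c' :: nat where c': "real c + real a + \<bar>\<beta>\<bar> < real c'" using reals_Archimedean2 by blast
      have "\<not> f (real k) + \<beta> * real k \<le> - real c' + real a + \<bar>\<beta>\<bar>" for k using c[of k] c' by simp
      then have "f \<notin> D c'" by (simp add: D_def)
      then show ?case by blast
    qed
    moreover have "(\<Inter>c. D c) \<in> sets W" using D by (intro sets.countable_INT) auto
    ultimately have "(\<Inter>c. D c) \<in> null_sets W" by (subst AE_iff_null_sets)
    then show ?thesis by (rule null_setsD1)
  qed
  finally have lim: "(\<lambda>c. emeasure W (D c)) \<longlonglongrightarrow> 0" .
  have "emeasure W (\<Inter>c. H c) * (1 / 2) \<le> emeasure W (D c)" for c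
  proof -
    have "emeasure W (\<Inter>c. H c) \<le> emeasure W (H c)" by (intro emeasure_mono H) auto
    then have "emeasure W (\<Inter>c. H c) * (1 / 2) \<le> emeasure W (H c) * (1 / 2)" by (rule mult_right_mono) simp
    then show ?thesis using half[of c] by (rule order_trans)
  qed
  then have "emeasure W (\<Inter>c. H c) * (1 / 2) \<le> 0" by (intro LIMSEQ_le_const[OF lim]) auto
  then have "emeasure W (\<Inter>c. H c) = 0" by (simp add: ennreal_zero_divide)
  moreover have "(\<Inter>c. H c) \<in> sets W" using H by (intro sets.countable_INT) auto
  ultimately have "(\<Inter>c. H c) \<in> null_sets W" by blast
  then have "AE f in W. f \<notin> (\<Inter>c. H c)" by (rule AE_not_in)
  then show ?thesis using AE_space
  proof eventually_elim
    case (elim f)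
    then have f: "f \<in> space cadlag_space" by (simp add: space_W)
    from elim obtain c where c: "f \<notin> H c" by blast
    have "stop_path (T c f) f \<in> space cadlag_space" by (rule measurable_space[OF measurable_stop_at[OF T] f])
    then have inf: "T_hit (-\<beta>) f (- real c) = \<infinity>" using c f by (simp add: H_def stopped_event_def T_def)
    have "- real c \<le> f t + \<beta> * t" if "0 \<le> t" for t
    proof (rule ccontr)
      assume "\<not> ?thesis"
      then have "lower_value f t - (-\<beta>) * t \<le> - real c" using lower_value_le[of f t] by simp
      then have "T_hit (-\<beta>) f (- real c) \<le> ereal t" unfolding T_hit_eq using that by (intro Inf_lower) auto
      then show False using inf by simp
    qed
    then show ?case by blast
  qed
qed

end


section \<open>Contact at time zero\<close>

text \<open>The minorant never exceeds the values of the path, nor its left limits, because the cones are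
continuous. So contact is the statement that the minorant is not below the smaller of the two.\<close>

lemma mem_contact_set_iff:
  assumes f: "cadlag_on UNIV f"
  shows "t \<in> contact_set \<alpha> f \<longleftrightarrow> (\<forall>u. min (f t) (Lim (at_left t) f) \<le> f u + \<alpha> * \<bar>t - u\<bar>)"
proof
  let ?v = "min (f t) (Lim (at_left t) f)"
  { assume "t \<in> contact_set \<alpha> f"
    then have L: "lipschitz_minorant \<alpha> f t = ereal ?v" unfolding contact_set_def by blast
    show "\<forall>u. ?v \<le> f u + \<alpha> * \<bar>t - u\<bar>"
    proof
      fix u
      have "ereal ?v \<le> ereal (f u + \<alpha> * \<bar>t - u\<bar>)"
        unfolding L[symmetric] lipschitz_minorant_def by (rule INF_lower) simp
      then show "?v \<le> f u + \<alpha> * \<bar>t - u\<bar>" by (simp only: ereal_less_eq)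
    qed }
  { assume *: "\<forall>u. ?v \<le> f u + \<alpha> * \<bar>t - u\<bar>"
    have ge: "ereal ?v \<le> lipschitz_minorant \<alpha> f t"
      unfolding lipschitz_minorant_def using * by (intro INF_greatest) (simp only: ereal_less_eq)
    have le: "lipschitz_minorant \<alpha> f t \<le> ereal (f u + \<alpha> * \<bar>t - u\<bar>)" for u
      unfolding lipschitz_minorant_def by (rule INF_lower) simp
    obtain l where l: "lipschitz_minorant \<alpha> f t = ereal l"
      using ge le[of t] by (cases "lipschitz_minorant \<alpha> f t") (auto simp del: ereal_min)
    have "l \<le> Lim (at_left t) f"
    proof (rule tendsto_lowerbound)
      have "((\<lambda>u. f u + \<alpha> * \<bar>t - u\<bar>) \<longlongrightarrow> Lim (at_left t) f + \<alpha> * \<bar>t - t\<bar>) (at_left t)"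
        using f unfolding cadlag_UNIV_iff
        by (intro tendsto_add tendsto_Lim_at_left tendsto_mult tendsto_rabs tendsto_diff tendsto_const tendsto_ident_at) blast
      then show "((\<lambda>u. f u + \<alpha> * \<bar>t - u\<bar>) \<longlongrightarrow> Lim (at_left t) f) (at_left t)" by simp
      show "\<forall>\<^sub>F u in at_left t. l \<le> f u + \<alpha> * \<bar>t - u\<bar>" using le l by (intro always_eventually) simp
    qed simp
    moreover have "l \<le> f t" using le[of t] l by simp
    ultimately have "l \<le> ?v" by simp
    then have "l = ?v" using ge l by (simp only: ereal_less_eq)
    then show "t \<in> contact_set \<alpha> f" using l unfolding contact_set_def by blast }
qed

lemma contact_set_shift:
  assumes f: "cadlag_on UNIV f" and g: "cadlag_on UNIV (\<lambda>u. f (s + u) - c)"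
  shows "t \<in> contact_set \<alpha> (\<lambda>u. f (s + u) - c) \<longleftrightarrow> s + t \<in> contact_set \<alpha> f"
proof -
  have "(f \<longlongrightarrow> Lim (at_left (s + t)) f) (at_left (s + t))"
    using f by (intro tendsto_Lim_at_left) (simp add: cadlag_UNIV_iff)
  from tendsto_diff[OF filterlim_compose[OF this filterlim_shift_at_left] tendsto_const[of c]]
  have lim: "Lim (at_left t) (\<lambda>u. f (s + u) - c) = Lim (at_left (s + t)) f - c"
    by (intro tendsto_Lim) auto
  have "(\<forall>u. min (f (s + t)) (Lim (at_left (s + t)) f) \<le> f u + \<alpha> * \<bar>s + t - u\<bar>) \<longleftrightarrow>
      (\<forall>u. min (f (s + t)) (Lim (at_left (s + t)) f) \<le> f (s + u) + \<alpha> * \<bar>s + t - (s + u)\<bar>)"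
  proof safe
    fix u
    assume "\<forall>u. min (f (s + t)) (Lim (at_left (s + t)) f) \<le> f (s + u) + \<alpha> * \<bar>s + t - (s + u)\<bar>"
    from this[rule_format, of "u - s"]
    show "min (f (s + t)) (Lim (at_left (s + t)) f) \<le> f u + \<alpha> * \<bar>s + t - u\<bar>" by simp
  qed blast
  moreover have "min (f (s + t) - c) (Lim (at_left (s + t)) f - c) = min (f (s + t)) (Lim (at_left (s + t)) f) - c"
    by (simp add: min_def)
  ultimately show ?thesis
    unfolding mem_contact_set_iff[OF f] mem_contact_set_iff[OF g] lim by simp
qed

lemma D_time_nonneg: "0 \<le> D_time \<alpha> f"
  unfolding D_time_def by (auto intro!: Inf_greatest)

text \<open>Only isolation on the right matters, and the gap is bounded below by \<open>1/(n+1)\<close> so that times with this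
property cannot be closer to each other than that.\<close>

definition isolated_contact_at_zero :: "real \<Rightarrow> nat \<Rightarrow> (real \<Rightarrow> real) \<Rightarrow> bool" where
  "isolated_contact_at_zero \<alpha> n f \<longleftrightarrow> 0 \<in> contact_set \<alpha> f \<and> ereal (1 / real (Suc n)) < D_time \<alpha> f"

lemma pred_isolated_contact_at_zero:
  assumes Y: "two_sided_cadlag_process N Y" and \<alpha>: "0 \<le> \<alpha>"
  shows "Measurable.pred N (\<lambda>\<omega>. isolated_contact_at_zero \<alpha> n (\<lambda>t. Y t \<omega>))"
proof -
  note [measurable] = measurable_D_time[OF assms] pred_zero_mem_contact_set[OF Y]
  show ?thesis unfolding isolated_contact_at_zero_def by measurable
qed

context two_sided_levy
begin

lemma prob_of_shifted_path:
  assumes P: "\<And>N :: (real \<Rightarrow> real) measure. two_sided_cadlag_process N (\<lambda>t f. f t) \<Longrightarrow> Measurable.pred N P"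
  shows "prob {\<omega>\<in>space M. P (\<lambda>u. X (s + u) \<omega> - X s \<omega>)} = prob {\<omega>\<in>space M. P (\<lambda>u. X u \<omega>)}"
proof -
  define R where "R = restrict_space (Pi\<^sub>M UNIV (\<lambda>_::real. borel :: real measure)) {f. cadlag_on UNIV f}"
  have sp: "space R = {f. cadlag_on UNIV f}" by (auto simp: R_def space_restrict_space space_PiM)
  have "two_sided_cadlag_process R (\<lambda>t f. f t)"
    unfolding two_sided_cadlag_process_def
  proof safe
    show "(\<lambda>f. f t) \<in> borel_measurable R" for t
      unfolding R_def by (intro measurable_restrict_space1 measurable_component_singleton) auto
  qed (simp add: sp)
  from P[OF this] have "{f\<in>space R. P f} \<in> sets R" by simp
  then obtain A where A: "A \<in> sets (Pi\<^sub>M UNIV (\<lambda>_. borel))" "{f\<in>space R. P f} = {f. cadlag_on UNIV f} \<inter> A"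
    unfolding R_def by (auto simp: sets_restrict_space)
  have eq: "{\<omega>\<in>space M. P (Y \<omega>)} = Y -` A \<inter> space M" if "\<And>\<omega>. \<omega> \<in> space M \<Longrightarrow> cadlag_on UNIV (Y \<omega>)" for Y
  proof -
    have "P (Y \<omega>) \<longleftrightarrow> Y \<omega> \<in> A" if "\<omega> \<in> space M" for \<omega>
    proof -
      have "Y \<omega> \<in> {f\<in>space R. P f} \<longleftrightarrow> Y \<omega> \<in> {f. cadlag_on UNIV f} \<inter> A" by (simp only: A(2))
      then show ?thesis using \<open>\<And>\<omega>. \<omega> \<in> space M \<Longrightarrow> cadlag_on UNIV (Y \<omega>)\<close>[OF that] by (simp add: sp)
    qed
    then show ?thesis by blast
  qed
  have m: "(\<lambda>\<omega> u. X u \<omega>) \<in> M \<rightarrow>\<^sub>M Pi\<^sub>M UNIV (\<lambda>_. borel)"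
    using random_variable_X by (intro measurable_PiM_single') auto
  have "prob {\<omega>\<in>space M. P (\<lambda>u. X (s + u) \<omega> - X s \<omega>)} = measure (distr M (Pi\<^sub>M UNIV (\<lambda>_. borel)) (\<lambda>\<omega> u. X (s + u) \<omega> - X s \<omega>)) A"
    unfolding measure_distr[OF measurable_path_UNIV A(1)]
    by (subst eq[of "\<lambda>\<omega> u. X (s + u) \<omega> - X s \<omega>", OF two_sided_cadlag_processD(2)[OF two_sided_cadlag_process_shift]]) simp_all
  also have "\<dots> = measure (distr M (Pi\<^sub>M UNIV (\<lambda>_. borel)) (\<lambda>\<omega> u. X u \<omega>)) A" unfolding shift_law ..
  also have "\<dots> = prob {\<omega>\<in>space M. P (\<lambda>u. X u \<omega>)}"
    unfolding measure_distr[OF m A(1)]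
    by (subst eq[of "\<lambda>\<omega> u. X u \<omega>", OF two_sided_cadlag_processD(2)[OF two_sided_cadlag_process_X]]) simp_all
  finally show ?thesis .
qed

text \<open>Take \<open>K + 1\<close> equally spaced times in an interval of length less than \<open>1/(n+1)\<close>. The events that they are
contact times isolated on the right by more than this length exclude each other, and have the same
probability by stationarity. So this probability is at most \<open>1/(K+1)\<close>, for all \<open>K\<close>.\<close>

lemma prob_isolated_contact_at_zero:
  assumes \<alpha>: "0 \<le> \<alpha>"
  shows "prob {\<omega>\<in>space M. isolated_contact_at_zero \<alpha> n (\<lambda>u. X u \<omega>)} = 0" (is "?p = 0")
proof -
  have bound: "real (Suc K) * ?p \<le> 1" for K :: nat
  proof -
    \<comment> \<open>\<open>K + 1\<close> times in an interval of length less than \<open>1/(n+1)\<close>\<close>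
    define s where "s j = real j / (real (Suc K) * real (Suc n))" for j :: nat
    define E where "E j = {\<omega>\<in>space M. isolated_contact_at_zero \<alpha> n (\<lambda>u. X (s j + u) \<omega> - X (s j) \<omega>)}" for j
    have E: "E j \<in> sets M" for j
      unfolding E_def using pred_isolated_contact_at_zero[OF two_sided_cadlag_process_shift \<alpha>] by simp
    have disj: "False" if "i < j" "j < Suc K" "\<omega> \<in> E i" "\<omega> \<in> E j" for i j \<omega>
    proof -
      have \<omega>: "\<omega> \<in> space M" using that by (simp add: E_def)
      note X = two_sided_cadlag_processD(2)[OF two_sided_cadlag_process_X \<omega>]
      note X_shift = two_sided_cadlag_processD(2)[OF two_sided_cadlag_process_shift \<omega>]
      have "s i < s j" unfolding s_def using that by (intro divide_strict_right_mono) auto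
      have "s j - s i < 1 / real (Suc n)"
      proof -
        have "s j - s i \<le> s j" unfolding s_def by simp
        also have "s j < real (Suc K) / (real (Suc K) * real (Suc n))"
          unfolding s_def using that by (intro divide_strict_right_mono) auto
        finally show ?thesis by simp
      qed
      have "0 \<in> contact_set \<alpha> (\<lambda>u. X (s j + u) \<omega> - X (s j) \<omega>)"
        using that(4) unfolding E_def isolated_contact_at_zero_def by blast
      then have "s j \<in> contact_set \<alpha> (\<lambda>u. X u \<omega>)" using contact_set_shift[OF X X_shift[of "s j"], of 0 \<alpha>] by simp
      then have "s j - s i \<in> contact_set \<alpha> (\<lambda>u. X (s i + u) \<omega> - X (s i) \<omega>)"
        using contact_set_shift[OF X X_shift[of "s i"], of "s j - s i" \<alpha>] by simp
      then have "D_time \<alpha> (\<lambda>u. X (s i + u) \<omega> - X (s i) \<omega>) \<le> ereal (s j - s i)"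
        unfolding D_time_def using \<open>s i < s j\<close> by (intro Inf_lower) auto
      also have "\<dots> < ereal (1 / real (Suc n))" using \<open>s j - s i < 1 / real (Suc n)\<close> by simp
      finally have "D_time \<alpha> (\<lambda>u. X (s i + u) \<omega> - X (s i) \<omega>) < ereal (1 / real (Suc n))" .
      moreover have "ereal (1 / real (Suc n)) < D_time \<alpha> (\<lambda>u. X (s i + u) \<omega> - X (s i) \<omega>)"
        using that(3) unfolding E_def isolated_contact_at_zero_def by blast
      ultimately show False by (rule less_asym)
    qed
    have same: "prob (E j) = ?p" for j
      unfolding E_def
      by (rule prob_of_shifted_path[where P="isolated_contact_at_zero \<alpha> n"])
        (rule pred_isolated_contact_at_zero[where Y="\<lambda>t f. f t", OF _ \<alpha>])
    have "disjoint_family_on E {..<Suc K}"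
      unfolding disjoint_family_on_def
    proof (intro ballI impI equals0I)
      fix i j \<omega> assume "i \<in> {..<Suc K}" "j \<in> {..<Suc K}" "i \<noteq> j" "\<omega> \<in> E i \<inter> E j"
      then show False using disj[of i j \<omega>] disj[of j i \<omega>] by (cases i j rule: linorder_cases) auto
    qed
    then have "prob (\<Union>j<Suc K. E j) = (\<Sum>j<Suc K. prob (E j))"
      using E by (intro finite_measure_finite_Union) auto
    also have "\<dots> = real (Suc K) * ?p"
      using same by (simp del: sum.lessThan_Suc)
    finally show ?thesis using prob_le_1[of "\<Union>j<Suc K. E j"] by simp
  qed
  have "\<not> 0 < ?p"
  proof
    assume p: "0 < ?p"
    obtain K :: nat where "1 / ?p < real K" using reals_Archimedean2 by blast
    then have "1 < real K * ?p" using p by (simp add: pos_divide_less_eq)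
    also have "\<dots> \<le> real (Suc K) * ?p" using p by (intro mult_right_mono) auto
    finally show False using bound[of K] by simp
  qed
  then show ?thesis by (simp add: not_less measure_le_0_iff)
qed

lemma AE_zero_contact_imp_D_time_zero:
  assumes \<alpha>: "0 \<le> \<alpha>"
  shows "AE \<omega> in M. 0 \<in> contact_set \<alpha> (\<lambda>u. X u \<omega>) \<longrightarrow> D_time \<alpha> (\<lambda>u. X u \<omega>) = 0"
proof -
  have "AE \<omega> in M. \<forall>n. \<not> isolated_contact_at_zero \<alpha> n (\<lambda>u. X u \<omega>)"
    unfolding AE_all_countable
  proof
    fix n
    have "{\<omega>\<in>space M. isolated_contact_at_zero \<alpha> n (\<lambda>u. X u \<omega>)} \<in> sets M"
      using pred_isolated_contact_at_zero[OF two_sided_cadlag_process_X \<alpha>] by simp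
    then show "AE \<omega> in M. \<not> isolated_contact_at_zero \<alpha> n (\<lambda>u. X u \<omega>)"
      by (rule prob_Collect_eq_0[THEN iffD1, OF _ prob_isolated_contact_at_zero[OF \<alpha>]])
  qed
  then show ?thesis
  proof eventually_elim
    case (elim \<omega>)
    show ?case
    proof (rule impI, rule ccontr)
      assume c: "0 \<in> contact_set \<alpha> (\<lambda>u. X u \<omega>)" and D: "D_time \<alpha> (\<lambda>u. X u \<omega>) \<noteq> 0"
      have "0 < D_time \<alpha> (\<lambda>u. X u \<omega>)" using D_time_nonneg D[symmetric] by (rule le_neq_trans)
      from ereal_dense2[OF this] obtain e where pos: "0 < ereal e" and e: "ereal e < D_time \<alpha> (\<lambda>u. X u \<omega>)" by blast
      have "0 < e" using pos by simp
      obtain n where "1 / real (Suc n) < e" using \<open>0 < e\<close> by (rule nat_approx_posE)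
      then have "ereal (1 / real (Suc n)) < D_time \<alpha> (\<lambda>u. X u \<omega>)"
        by (intro less_trans[OF _ e]) simp
      then have "isolated_contact_at_zero \<alpha> n (\<lambda>u. X u \<omega>)" using c unfolding isolated_contact_at_zero_def by blast
      then show False using elim by blast
    qed
  qed
qed

text \<open>The increments over \<open>[-h, 0]\<close> and over \<open>[0, h]\<close> have the same law, and the latter tend to \<open>0\<close> with \<open>h\<close>.\<close>

lemma AE_left_limit_at_zero: "AE \<omega> in M. Lim (at_left 0) (\<lambda>t. X t \<omega>) = 0"
proof -
  define h where "h n = 1 / real (Suc n)" for n
  have h: "0 < h n" for n by (simp add: h_def)
  have hne: "h n \<noteq> 0" for n using h[of n] by simp
  have h0: "h \<longlonglongrightarrow> 0" unfolding h_def using LIMSEQ_inverse_real_of_nat by (simp add: inverse_eq_divide)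
  note [measurable] = random_variable_X
  have left: "(\<lambda>n. X (- h n) \<omega>) \<longlonglongrightarrow> Lim (at_left 0) (\<lambda>t. X t \<omega>)" if "\<omega> \<in> space M" for \<omega>
  proof (rule filterlim_compose[where g="\<lambda>t. X t \<omega>" and f="\<lambda>n. - h n"])
    show "((\<lambda>t. X t \<omega>) \<longlongrightarrow> Lim (at_left 0) (\<lambda>t. X t \<omega>)) (at_left 0)"
      using cadlag_X[OF that] by (intro tendsto_Lim_at_left) (simp add: cadlag_UNIV_iff)
    show "filterlim (\<lambda>n. - h n) (at_left 0) sequentially"
      unfolding filterlim_at using tendsto_minus[OF h0] h hne by simp
  qed
  have right: "(\<lambda>n. X (h n) \<omega>) \<longlonglongrightarrow> 0" if "\<omega> \<in> space M" for \<omega>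
  proof -
    have "filterlim h (at_right 0) sequentially"
      unfolding filterlim_at using h0 h hne by simp
    moreover have "((\<lambda>t. X t \<omega>) \<longlongrightarrow> X 0 \<omega>) (at_right 0)" using cadlag_X[OF that] by (simp add: cadlag_UNIV_iff)
    ultimately have "(\<lambda>n. X (h n) \<omega>) \<longlonglongrightarrow> X 0 \<omega>" by (rule filterlim_compose[rotated])
    then show ?thesis using X_zero[OF that] by simp
  qed
  have [measurable]: "(\<lambda>\<omega>. Lim (at_left 0) (\<lambda>t. X t \<omega>)) \<in> borel_measurable M"
    by (rule borel_measurable_LIMSEQ_real[OF left]) measurable
  have gauge: "(\<lambda>n. \<integral>\<^sup>+\<omega>. ennreal (min 1 \<bar>Y n \<omega>\<bar>) \<partial>M) \<longlonglongrightarrow> (\<integral>\<^sup>+\<omega>. ennreal (min 1 \<bar>Z \<omega>\<bar>) \<partial>M)"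
    if [measurable]: "\<And>n. Y n \<in> borel_measurable M" "Z \<in> borel_measurable M"
      and lim: "\<And>\<omega>. \<omega> \<in> space M \<Longrightarrow> (\<lambda>n. Y n \<omega>) \<longlonglongrightarrow> Z \<omega>" for Y Z
  proof (rule nn_integral_dominated_convergence[where w="\<lambda>_. 1"])
    show "AE \<omega> in M. (\<lambda>n. ennreal (min 1 \<bar>Y n \<omega>\<bar>)) \<longlonglongrightarrow> ennreal (min 1 \<bar>Z \<omega>\<bar>)"
      by (intro AE_I2 tendsto_ennrealI tendsto_min tendsto_const tendsto_rabs lim)
    show "AE \<omega> in M. ennreal (min 1 \<bar>Y n \<omega>\<bar>) \<le> 1" for n by (simp add: ennreal_le_1)
  qed (simp_all add: emeasure_space_1)
  have same: "(\<integral>\<^sup>+\<omega>. ennreal (min 1 \<bar>X (- h n) \<omega>\<bar>) \<partial>M) = (\<integral>\<^sup>+\<omega>. ennreal (min 1 \<bar>X (h n) \<omega>\<bar>) \<partial>M)" for n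
  proof -
    have "(\<integral>\<^sup>+\<omega>. ennreal (min 1 \<bar>X (- h n) \<omega>\<bar>) \<partial>M) = (\<integral>\<^sup>+\<omega>. ennreal (min 1 \<bar>X 0 \<omega> - X (- h n) \<omega>\<bar>) \<partial>M)"
      by (rule nn_integral_cong) (simp add: X_zero)
    also have "\<dots> = (\<integral>\<^sup>+x. ennreal (min 1 \<bar>x\<bar>) \<partial>distr M borel (\<lambda>\<omega>. X 0 \<omega> - X (- h n) \<omega>))"
      by (subst nn_integral_distr) auto
    also have "distr M borel (\<lambda>\<omega>. X 0 \<omega> - X (- h n) \<omega>) = distr M borel (X (h n))"
      using stationary_increments[of "- h n" 0] h[of n] by simp
    also have "(\<integral>\<^sup>+x. ennreal (min 1 \<bar>x\<bar>) \<partial>distr M borel (X (h n))) = (\<integral>\<^sup>+\<omega>. ennreal (min 1 \<bar>X (h n) \<omega>\<bar>) \<partial>M)"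
      by (subst nn_integral_distr) auto
    finally show ?thesis .
  qed
  have gl: "(\<lambda>n. \<integral>\<^sup>+\<omega>. ennreal (min 1 \<bar>X (- h n) \<omega>\<bar>) \<partial>M) \<longlonglongrightarrow> (\<integral>\<^sup>+\<omega>. ennreal (min 1 \<bar>Lim (at_left 0) (\<lambda>t. X t \<omega>)\<bar>) \<partial>M)"
    by (rule gauge[of "\<lambda>n. X (- h n)" "\<lambda>\<omega>. Lim (at_left 0) (\<lambda>t. X t \<omega>)"]) (measurable, rule left)
  have gr: "(\<lambda>n. \<integral>\<^sup>+\<omega>. ennreal (min 1 \<bar>X (h n) \<omega>\<bar>) \<partial>M) \<longlonglongrightarrow> (\<integral>\<^sup>+\<omega>. ennreal (min 1 \<bar>0\<bar>) \<partial>M)"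
    by (rule gauge[of "\<lambda>n. X (h n)" "\<lambda>_. 0"]) (measurable, rule right)
  have "(\<integral>\<^sup>+\<omega>. ennreal (min 1 \<bar>Lim (at_left 0) (\<lambda>t. X t \<omega>)\<bar>) \<partial>M) = (\<integral>\<^sup>+\<omega>. ennreal (min 1 \<bar>0\<bar>) \<partial>M)"
    using LIMSEQ_unique[OF gl[unfolded same] gr] .
  then have "(\<integral>\<^sup>+\<omega>. ennreal (min 1 \<bar>Lim (at_left 0) (\<lambda>t. X t \<omega>)\<bar>) \<partial>M) = 0" by simp
  then have "AE \<omega> in M. ennreal (min 1 \<bar>Lim (at_left 0) (\<lambda>t. X t \<omega>)\<bar>) = 0"
    by (subst (asm) nn_integral_0_iff_AE) auto
  then show ?thesis by eventually_elim (auto simp: ennreal_eq_0_iff min_def split: if_splits)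
qed

end


section \<open>The first contact time after zero\<close>

text \<open>The shifted path has left limit \<open>0\<close> at time \<open>0\<close> by convention, and this agrees with the left limit of \<open>f\<close>
at \<open>s\<close> as far as the smaller value is concerned, provided that \<open>f\<close> does not jump upwards at \<open>s\<close>.\<close>

lemma lower_value_shift_path:
  assumes f: "cadlag_on {0..} f" and s: "0 \<le> s" and jump: "s = 0 \<Longrightarrow> f 0 = 0" "0 < s \<Longrightarrow> f s \<le> left_lim0 f s" and u: "0 \<le> u"
  shows "lower_value (shift_path s f) u = lower_value f (s + u) - f s"
proof (cases "u = 0")
  case True
  then show ?thesis
    using s jump by (cases "s = 0") (auto simp: lower_value_def left_lim0_def shift_path_def min_def)
next
  case False
  then have u: "0 < u" using u by simp
  have "left_lim0 (shift_path s f) u = left_lim0 (\<lambda>v. f (s + v) - f s) u"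
    using u by (intro left_lim0_cong) (auto simp: shift_path_def)
  also have "\<dots> = left_lim0 f (s + u) - f s" by (rule left_lim0_shift[OF f s u])
  finally show ?thesis using u by (simp add: lower_value_def shift_path_def min_def)
qed

text \<open>The time \<open>d = t0 + s\<close> is a contact time: the cones from times \<open>u < t0\<close> lie high enough because
\<open>f u - \<alpha> * u \<ge> \<gamma>\<close> there while the path is at most \<open>\<gamma> + \<alpha> * t0\<close> at \<open>t0\<close>, and those from later times because
\<open>f u + \<alpha> * u\<close> is minimal at \<open>d\<close>. A contact time \<open>t > 0\<close> is at least \<open>t0\<close> by the cones from \<open>u \<le> 0\<close>; if it were
before \<open>d\<close>, the cone from \<open>d\<close> would make \<open>t\<close> an earlier minimum of \<open>f u + \<alpha> * u\<close>. The case \<open>d = 0\<close> is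
separate because \<open>D\<close> is an infimum over positive contact times.\<close>

lemma D_time_eq_hitting_plus_minimum:
  assumes f: "cadlag_on UNIV f" "f 0 = 0" "Lim (at_left 0) f = 0" and \<alpha>: "0 < \<alpha>"
    and I: "I_minus \<alpha> f = ereal \<gamma>" and T: "T_hit \<alpha> f \<gamma> = ereal t0"
    and jump: "0 < t0 \<Longrightarrow> f t0 \<le> left_lim0 f t0"
    and V: "lower_value (shift_path t0 f) s + \<alpha> * s = m" "0 \<le> s"
      "\<And>u. 0 \<le> u \<Longrightarrow> m \<le> lower_value (shift_path t0 f) u + \<alpha> * u"
      "\<And>u. 0 \<le> u \<Longrightarrow> u < s \<Longrightarrow> m < lower_value (shift_path t0 f) u + \<alpha> * u"
    and zero: "0 \<in> contact_set \<alpha> f \<Longrightarrow> D_time \<alpha> f = 0"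
  shows "D_time \<alpha> f = ereal (t0 + s)"
proof -
  have fh: "cadlag_on {0..} f" by (rule cadlag_UNIV_imp_half_line[OF f(1)])
  note hit = T_hit_attained[OF fh T]
  define d where "d = t0 + s"
  have v: "min (f t) (Lim (at_left t) f) = lower_value f t" if "0 \<le> t" for t
    using that f(2,3) by (cases "t = 0") (auto simp: lower_value_def left_lim0_def)
  have lV: "lower_value (shift_path t0 f) u = lower_value f (t0 + u) - f t0" if "0 \<le> u" for u
    by (rule lower_value_shift_path[OF fh hit(1) f(2) jump that])
  have past: "\<gamma> \<le> f u - \<alpha> * u" if "u \<le> 0" for u
  proof -
    have "ereal \<gamma> \<le> ereal (f u - \<alpha> * u)" unfolding I[symmetric] I_minus_def using that by (intro INF_lower) auto
    then show ?thesis by simp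
  qed
  have "lower_value f t0 = f t0" using lV[of 0] f(2) by (simp add: lower_value_def left_lim0_def shift_path_def)
  then have ft0: "f t0 \<le> \<gamma> + \<alpha> * t0" using hit(2) by simp
  have m0: "m \<le> 0" using V(3)[of 0] by (simp add: lower_value_def left_lim0_def shift_path_def)
  have ld: "lower_value f d = m + f t0 - \<alpha> * s" using V(1) lV[OF V(2)] by (simp add: d_def)
  have d0: "0 \<le> d" using hit(1) V(2) by (simp add: d_def)
  have contact_d: "d \<in> contact_set \<alpha> f"
    unfolding mem_contact_set_iff[OF f(1)] v[OF d0]
  proof
    fix u
    consider "u < t0" | "t0 \<le> u" by linarith
    then show "lower_value f d \<le> f u + \<alpha> * \<bar>d - u\<bar>"
    proof cases
      case 1
      have "\<gamma> \<le> f u - \<alpha> * u"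
        using past[of u] hit(3)[of u] 1 lower_value_le[of f u] by (cases "u \<le> 0") auto
      moreover have "\<alpha> * \<bar>d - u\<bar> = \<alpha> * d - \<alpha> * u" using 1 V(2) by (simp add: d_def algebra_simps)
      moreover have "0 \<le> \<alpha> * s" using \<alpha> V(2) by simp
      ultimately show ?thesis using ld m0 ft0 by (simp add: d_def algebra_simps)
    next
      case 2
      define w where "w = u - t0"
      have w: "0 \<le> w" "u = t0 + w" using 2 by (auto simp: w_def)
      have "m + f t0 \<le> f u + \<alpha> * w"
        using V(3)[OF w(1)] lV[OF w(1)] lower_value_le[of f u] w(2) by simp
      moreover have "\<alpha> * (w - s) \<le> \<alpha> * \<bar>d - u\<bar>"
        using \<alpha> by (intro mult_left_mono) (auto simp: d_def w(2))
      ultimately show ?thesis using ld by (simp add: algebra_simps)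
    qed
  qed
  have lower: "d \<le> t" if t: "t \<in> contact_set \<alpha> f" "0 < t" for t
  proof (rule ccontr)
    assume "\<not> d \<le> t"
    then have td: "t < d" by simp
    have c: "lower_value f t \<le> f u + \<alpha> * \<bar>t - u\<bar>" for u
      using t(1) v[of t] t(2) unfolding mem_contact_set_iff[OF f(1)] by simp
    have "ereal (lower_value f t - \<alpha> * t) \<le> I_minus \<alpha> f"
      unfolding I_minus_def
    proof (rule INF_greatest)
      fix u :: real assume "u \<in> {..0}"
      then have "\<alpha> * \<bar>t - u\<bar> = \<alpha> * t - \<alpha> * u" using t(2) by (simp add: algebra_simps)
      then show "ereal (lower_value f t - \<alpha> * t) \<le> ereal (f u - \<alpha> * u)" using c[of u] by simp
    qed
    then have "lower_value f t - \<alpha> * t \<le> \<gamma>" using I by simp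
    then have "t0 \<le> t" using hit(3)[of t] t(2) by (meson less_imp_le not_le)
    then have w: "0 \<le> t - t0" "t - t0 < s" using td by (auto simp: d_def)
    have strict: "m + f t0 < lower_value f t + \<alpha> * (t - t0)" using V(4)[OF w] lV[OF w(1)] by simp
    have right: "lower_value f t \<le> f u + \<alpha> * (u - t)" if "t < u" for u
      using c[of u] that by (simp add: abs_minus_commute)
    have "lower_value f t \<le> left_lim0 f d + \<alpha> * (d - t)"
    proof (rule tendsto_lowerbound)
      show "((\<lambda>u. f u + \<alpha> * (u - t)) \<longlongrightarrow> left_lim0 f d + \<alpha> * (d - t)) (at_left d)"
        using td t(2) by (intro tendsto_add cadlag_left_limit[OF fh] tendsto_mult tendsto_const tendsto_diff tendsto_ident_at) auto
      show "\<forall>\<^sub>F u in at_left d. lower_value f t \<le> f u + \<alpha> * (u - t)"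
        unfolding eventually_at_left_field using td right by blast
    qed simp
    then have "lower_value f t \<le> lower_value f d + \<alpha> * (d - t)"
      using right[OF td] unfolding lower_value_def[of f d] by linarith
    then show False using strict ld by (simp add: d_def algebra_simps)
  qed
  have "D_time \<alpha> f = ereal d"
  proof (cases "d = 0")
    case True
    then show ?thesis using zero contact_d by simp
  next
    case False
    then have "0 < d" using d0 by simp
    show ?thesis unfolding D_time_def
    proof (rule antisym)
      show "Inf (ereal ` (contact_set \<alpha> f \<inter> {0<..})) \<le> ereal d" using contact_d \<open>0 < d\<close> by (intro Inf_lower) auto
      show "ereal d \<le> Inf (ereal ` (contact_set \<alpha> f \<inter> {0<..}))" using lower by (intro Inf_greatest) auto
    qed
  qed
  then show ?thesis by (simp add: d_def)
qed

lemma T_hit_stop_at_hitting_time: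
  assumes f: "cadlag_on {0..} f"
  shows "T_hit \<alpha> (stop_path (T_hit \<alpha> f \<gamma>) f) \<gamma> = T_hit \<alpha> f \<gamma>"
proof -
  let ?g = "stop_path (T_hit \<alpha> f \<gamma>) f"
  have lv: "lower_value ?g t = lower_value f t" if "0 \<le> t" "ereal t \<le> T_hit \<alpha> f \<gamma>" for t
    unfolding lower_value_def using that
    by (subst left_lim0_cong[of t ?g f]) (auto simp: stop_path_def intro: order_trans[of _ "ereal t"])
  show ?thesis
  proof (rule antisym)
    show "T_hit \<alpha> ?g \<gamma> \<le> T_hit \<alpha> f \<gamma>"
    proof (cases "T_hit \<alpha> f \<gamma>")
      case (real t)
      have "0 \<le> t" "lower_value f t - \<alpha> * t \<le> \<gamma>" using T_hit_attained[OF f real] by auto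
      then have "T_hit \<alpha> ?g \<gamma> \<le> ereal t" unfolding T_hit_eq[of _ ?g] using lv[of t] real by (intro Inf_lower) auto
      then show ?thesis using real by simp
    qed (use T_hit_nonneg[of \<alpha> f \<gamma>] in auto)
    show "T_hit \<alpha> f \<gamma> \<le> T_hit \<alpha> ?g \<gamma>"
      unfolding T_hit_eq[of _ ?g]
    proof (rule Inf_greatest, safe)
      fix t assume t: "0 \<le> t" "lower_value ?g t - \<alpha> * t \<le> \<gamma>"
      show "T_hit \<alpha> f \<gamma> \<le> ereal t"
      proof (rule ccontr)
        assume *: "\<not> T_hit \<alpha> f \<gamma> \<le> ereal t"
        then have "lower_value f t - \<alpha> * t \<le> \<gamma>" using lv[of t] t by simp
        then have "T_hit \<alpha> f \<gamma> \<le> ereal t" unfolding T_hit_eq using t by (intro Inf_lower) auto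
        then show False using * by simp
      qed
    qed
  qed
qed

text \<open>The concatenated path uses its first path only up to the hitting time. This is what makes it a function
of the stopped path and the shifted path, to which the strong Markov property applies.\<close>

lemma Z_path_stop_path:
  assumes f: "cadlag_on {0..} f" and t: "0 \<le> t"
  shows "Z_path \<alpha> \<gamma> (stop_path (T_hit \<alpha> f \<gamma>) f) g t = Z_path \<alpha> \<gamma> f g t"
proof -
  have "0 \<le> T_hit \<alpha> f \<gamma>" by (rule T_hit_nonneg)
  then show ?thesis
    unfolding Z_path_def T_hit_stop_at_hitting_time[OF f] Let_def using t
    by (cases "T_hit \<alpha> f \<gamma>") (auto simp: stop_path_def)
qed

lemma T_hit_restrict: "T_hit \<alpha> (restrict f {0..}) \<gamma> = T_hit \<alpha> f \<gamma>"
proof -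
  have "lower_value (restrict f {0..}) t = lower_value f t" if "0 \<le> t" for t
    unfolding lower_value_def using that by (subst left_lim0_cong[of t "restrict f {0..}" f]) auto
  then show ?thesis unfolding T_hit_eq by (intro arg_cong[where f=Inf] arg_cong[where f="image ereal"]) auto
qed

lemma T_min_restrict: "T_min \<alpha> (restrict f {0..}) = T_min \<alpha> f"
proof -
  have "left_lim0 (restrict f {0..}) t = left_lim0 f t" if "0 \<le> t" for t
    using that by (intro left_lim0_cong) auto
  moreover have "(INF u\<in>{0..}. ereal (restrict f {0..} u + \<alpha> * u)) = (INF u\<in>{0..}. ereal (f u + \<alpha> * u))"
    by (rule INF_cong) auto
  ultimately show ?thesis
    unfolding T_min_def by (intro arg_cong[where f=Inf] arg_cong[where f="image ereal"]) auto
qed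

lemma Z_path_restrict:
  assumes "0 \<le> t"
  shows "Z_path \<alpha> \<gamma> (restrict f {0..}) (restrict g {0..}) t = Z_path \<alpha> \<gamma> f g t"
proof -
  have "0 \<le> T_hit \<alpha> f \<gamma>" by (rule T_hit_nonneg)
  then show ?thesis
    using assms unfolding Z_path_def T_hit_restrict T_min_restrict Let_def
    by (cases "T_hit \<alpha> f \<gamma>") auto
qed

definition Z_map :: "real \<Rightarrow> real \<times> (real \<Rightarrow> real) \<times> (real \<Rightarrow> real) \<Rightarrow> real \<Rightarrow> real option" where
  "Z_map \<alpha> = (\<lambda>(\<gamma>, f, g). \<lambda>t\<in>{0..}. Z_path \<alpha> \<gamma> f g t)"

lemma measurable_Z_map: "Z_map \<alpha> \<in> borel \<Otimes>\<^sub>M (cadlag_space \<Otimes>\<^sub>M cadlag_space) \<rightarrow>\<^sub>M killed_path_space"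
proof -
  let ?N = "borel \<Otimes>\<^sub>M (cadlag_space \<Otimes>\<^sub>M cadlag_space) :: (real \<times> (real \<Rightarrow> real) \<times> (real \<Rightarrow> real)) measure"
  have 1: "cadlag_process ?N (\<lambda>t p. fst (snd p) t)" by (intro cadlag_process_compose) measurable
  have 2: "cadlag_process ?N (\<lambda>t p. snd (snd p) t)" by (intro cadlag_process_compose) measurable
  have "half_line_path (\<lambda>t p. Z_path \<alpha> (fst p) (\<lambda>s. fst (snd p) s) (\<lambda>s. snd (snd p) s) t) \<in> ?N \<rightarrow>\<^sub>M killed_path_space"
    by (rule measurable_Z_path[OF 1 2]) measurable
  also have "half_line_path (\<lambda>t p. Z_path \<alpha> (fst p) (\<lambda>s. fst (snd p) s) (\<lambda>s. snd (snd p) s) t) = Z_map \<alpha>"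
    by (auto simp: Z_map_def half_line_path_def fun_eq_iff)
  finally show ?thesis .
qed

lemma Z_map_stop_path:
  "cadlag_on {0..} f \<Longrightarrow> Z_map \<alpha> (\<gamma>, stop_path (T_hit \<alpha> f \<gamma>) f, g) = Z_map \<alpha> (\<gamma>, f, g)"
  by (auto simp: Z_map_def fun_eq_iff Z_path_stop_path)

context levy_law
begin

text \<open>For a fixed level, continuing the path by its own increments after the hitting time has the same effect
in law as continuing it by an independent copy.\<close>

lemma nn_integral_Z_map_strong_markov:
  assumes fin: "AE f in W. T_hit \<alpha> f \<gamma> < \<infinity>" and A: "A \<in> sets killed_path_space"
  shows "(\<integral>\<^sup>+f. indicator A (Z_map \<alpha> (\<gamma>, f, shift_path (real_of_ereal (T_hit \<alpha> f \<gamma>)) f)) \<partial>W) =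
    (\<integral>\<^sup>+p. indicator A (Z_map \<alpha> (\<gamma>, fst p, snd p)) \<partial>(W \<Otimes>\<^sub>M W))"
proof -
  let ?T = "\<lambda>f. T_hit \<alpha> f \<gamma>" and ?S = "cadlag_space \<Otimes>\<^sub>M cadlag_space"
  let ?F = "\<lambda>p. indicator A (Z_map \<alpha> (\<gamma>, fst p, snd p)) :: ennreal"
  note T = stopping_functional_T_hit[of \<alpha> \<gamma>]
  have m1: "(\<lambda>f. stop_path (?T f) f) \<in> W \<rightarrow>\<^sub>M cadlag_space"
    and m2: "(\<lambda>f. shift_path (real_of_ereal (?T f)) f) \<in> W \<rightarrow>\<^sub>M cadlag_space"
    using measurable_stop_at[OF T] measurable_shift_at[OF T] by (simp_all add: measurable_W)
  have Fm: "(\<lambda>p. Z_map \<alpha> (\<gamma>, fst p, snd p)) \<in> ?S \<rightarrow>\<^sub>M killed_path_space"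
    by (rule measurable_compose[OF _ measurable_Z_map]) measurable
  have F: "?F \<in> borel_measurable ?S"
    by (rule measurable_compose[OF Fm]) (use A in simp)
  have stopF: "?F (stop_path (?T f) f, g) = ?F (f, g)" if "f \<in> space W" for f g
    using that by (simp add: Z_map_stop_path space_W space_cadlag_space)
  have sets_WW: "sets (W \<Otimes>\<^sub>M W) = sets ?S" by (rule sets_pair_measure_cong[OF sets_W sets_W])
  have sets_DW: "sets (distr W cadlag_space (\<lambda>f. stop_path (?T f) f) \<Otimes>\<^sub>M W) = sets ?S"
    by (rule sets_pair_measure_cong) (simp_all add: sets_W)
  have "(\<integral>\<^sup>+f. indicator A (Z_map \<alpha> (\<gamma>, f, shift_path (real_of_ereal (?T f)) f)) \<partial>W) =
      (\<integral>\<^sup>+f. ?F (stop_path (?T f) f, shift_path (real_of_ereal (?T f)) f) \<partial>W)"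
    by (rule nn_integral_cong) (use stopF in simp)
  also have "\<dots> = (\<integral>\<^sup>+p. ?F p \<partial>distr W ?S (\<lambda>f. (stop_path (?T f) f, shift_path (real_of_ereal (?T f)) f)))"
    by (rule nn_integral_distr[symmetric]) (use m1 m2 F in auto)
  also have "\<dots> = (\<integral>\<^sup>+p. ?F p \<partial>(distr W cadlag_space (\<lambda>f. stop_path (?T f) f) \<Otimes>\<^sub>M W))"
    unfolding strong_markov_law[OF T fin] ..
  also have "\<dots> = (\<integral>\<^sup>+x. \<integral>\<^sup>+g. ?F (x, g) \<partial>W \<partial>distr W cadlag_space (\<lambda>f. stop_path (?T f) f))"
    by (rule nn_integral_fst[symmetric]) (use F in \<open>simp only: measurable_cong_sets[OF sets_DW refl]\<close>)
  also have "\<dots> = (\<integral>\<^sup>+f. \<integral>\<^sup>+g. ?F (stop_path (?T f) f, g) \<partial>W \<partial>W)"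
  proof (rule nn_integral_distr[OF m1])
    have "?F \<in> borel_measurable (cadlag_space \<Otimes>\<^sub>M W)"
      using F by (simp only: measurable_cong_sets[OF sets_pair_measure_cong[OF refl sets_W] refl])
    from borel_measurable_nn_integral_fst[OF this]
    show "(\<lambda>x. \<integral>\<^sup>+g. ?F (x, g) \<partial>W) \<in> borel_measurable (distr W cadlag_space (\<lambda>f. stop_path (?T f) f))" by simp
  qed
  also have "\<dots> = (\<integral>\<^sup>+f. \<integral>\<^sup>+g. ?F (f, g) \<partial>W \<partial>W)"
    by (intro nn_integral_cong) (rule stopF)
  also have "\<dots> = (\<integral>\<^sup>+p. ?F p \<partial>(W \<Otimes>\<^sub>M W))"
    by (rule nn_integral_fst) (use F in \<open>simp only: measurable_cong_sets[OF sets_WW refl]\<close>)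
  finally show ?thesis .
qed

end


section \<open>The two laws\<close>

lemma killed_after_eq_Z_path:
  assumes T: "T_hit \<alpha> f \<gamma> = ereal t0" and S: "T_min \<alpha> (shift_path t0 f) = ereal s" and D: "D_time \<alpha> f = ereal (t0 + s)"
    and t: "0 \<le> t" "0 \<le> s"
  shows "killed_after (D_time \<alpha> f) f t = Z_path \<alpha> \<gamma> f (shift_path t0 f) t"
  using t unfolding killed_after_def Z_path_def T S D Let_def by (auto simp: shift_path_def)

lemma shift_path_restrict: "0 \<le> s \<Longrightarrow> shift_path s (restrict f {0..}) = shift_path s f"
  by (auto simp: shift_path_def)

lemma killed_path_eq_Z_map:
  assumes f: "cadlag_on UNIV f" "f 0 = 0" "Lim (at_left 0) f = 0" and \<alpha>: "0 < \<alpha>" and \<beta>: "\<beta> < \<alpha>"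
    and I: "I_minus \<alpha> f = ereal \<gamma>" and fin: "T_hit \<alpha> f \<gamma> < \<infinity>"
    and gauge: "jump_gauge \<alpha> \<gamma> f = 0"
    and low: "\<And>t. 0 \<le> t \<Longrightarrow> - c \<le> f t + \<beta> * t"
    and zero: "0 \<in> contact_set \<alpha> f \<Longrightarrow> D_time \<alpha> f = 0"
  shows "(\<lambda>t\<in>{0..}. killed_after (D_time \<alpha> f) f t) = Z_map \<alpha> (\<gamma>, f, shift_path (real_of_ereal (T_hit \<alpha> f \<gamma>)) f)"
proof -
  have fh: "cadlag_on {0..} f" by (rule cadlag_UNIV_imp_half_line[OF f(1)])
  obtain t0 where T: "T_hit \<alpha> f \<gamma> = ereal t0" and t0: "0 \<le> t0"
    using fin T_hit_nonneg[of \<alpha> f \<gamma>] by (cases "T_hit \<alpha> f \<gamma>") auto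
  have jump: "f t0 \<le> left_lim0 f t0" if "0 < t0"
    using jump_gauge_pos[OF fh T that] gauge by (meson not_le)
  have V: "cadlag_on {0..} (shift_path t0 f)" "shift_path t0 f 0 = 0"
    using shift_path_cadlag[OF fh t0] by (auto simp: shift_path_def)
  have Vlow: "- (c + \<beta> * t0 + f t0) \<le> shift_path t0 f t + \<beta> * t" if "0 \<le> t" for t
    using low[of "t0 + t"] that t0 by (simp add: shift_path_def algebra_simps)
  obtain s m where s: "T_min \<alpha> (shift_path t0 f) = ereal s" "0 \<le> s" "lower_value (shift_path t0 f) s + \<alpha> * s = m"
    "\<And>u. 0 \<le> u \<Longrightarrow> m \<le> lower_value (shift_path t0 f) u + \<alpha> * u"
    "\<And>u. 0 \<le> u \<Longrightarrow> u < s \<Longrightarrow> m < lower_value (shift_path t0 f) u + \<alpha> * u"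
    by (rule T_min_attained[OF V Vlow \<beta>]) (assumption, rule that)
  have D: "D_time \<alpha> f = ereal (t0 + s)"
    by (rule D_time_eq_hitting_plus_minimum[OF f \<alpha> I T jump s(3,2,4,5) zero])
  show ?thesis
    unfolding Z_map_def case_prod_conv T real_of_ereal.simps
    by (intro restrict_ext killed_after_eq_Z_path[OF T s(1) D _ s(2)]) simp
qed

lemma Z_map_restrict:
  "Z_map \<alpha> (\<gamma>, restrict f {0..}, restrict g {0..}) = Z_map \<alpha> (\<gamma>, f, g)"
  unfolding Z_map_def case_prod_conv by (intro restrict_ext Z_path_restrict) simp

lemma jump_gauge_restrict: "jump_gauge \<alpha> \<gamma> (restrict f {0..}) = jump_gauge \<alpha> \<gamma> f"
proof -
  have "0 \<le> real_of_ereal (T_hit \<alpha> f c)" for c by (intro real_of_ereal_pos T_hit_nonneg)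
  then have "restrict f {0..} (real_of_ereal (T_hit \<alpha> f c)) = f (real_of_ereal (T_hit \<alpha> f c))"
    "restrict f {0..} (real_of_ereal (T_hit \<alpha> f c) + 1 / real (Suc k)) = f (real_of_ereal (T_hit \<alpha> f c) + 1 / real (Suc k))" for c k
    by (simp_all add: add_nonneg_nonneg)
  then show ?thesis unfolding jump_gauge_def T_hit_restrict Let_def by (simp only:)
qed

context two_sided_levy
begin

text \<open>By right-continuity \<open>I\<^sup>-\<close> is an infimum over rational times \<open>u \<le> 0\<close>, hence a measurable function of the past of
time \<open>0\<close>.\<close>

lemma I_minus_independent_of_half_line:
  "distr M borel (\<lambda>\<omega>. real_of_ereal (I_minus \<alpha> (\<lambda>t. X t \<omega>))) \<Otimes>\<^sub>M path_law =
    distr M (borel \<Otimes>\<^sub>M cadlag_space) (\<lambda>\<omega>. (real_of_ereal (I_minus \<alpha> (\<lambda>t. X t \<omega>)), half_line_path X \<omega>))"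
proof -
  let ?S = "Pi\<^sub>M UNIV (\<lambda>_. borel) :: (real \<Rightarrow> real) measure"
  define h where "h g = real_of_ereal (INF u\<in>{..0} \<inter> \<rat>. ereal (g u - \<alpha> * u))" for g :: "real \<Rightarrow> real"
  have h: "h \<in> ?S \<rightarrow>\<^sub>M borel"
  proof -
    have "(\<lambda>g. INF u\<in>{..0} \<inter> \<rat>. ereal (g u - \<alpha> * u)) \<in> ?S \<rightarrow>\<^sub>M borel"
    proof (rule borel_measurable_INF)
      show "countable ({..0} \<inter> \<rat> :: real set)" by (rule countable_subset[OF _ countable_rat]) auto
    qed measurable
    then show ?thesis unfolding h_def by measurable
  qed
  define P where "P \<omega> = (\<lambda>u. X (min u 0) \<omega> - X 0 \<omega>)" for \<omega>
  define F where "F = half_line_path (\<lambda>u \<omega>. X (0 + u) \<omega> - X 0 \<omega>)"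
  have P: "P \<in> M \<rightarrow>\<^sub>M ?S" unfolding P_def by (rule measurable_path_UNIV)
  have F: "F \<in> M \<rightarrow>\<^sub>M cadlag_space" unfolding F_def by (rule measurable_cadlag_spaceI[OF cadlag_process_shift])
  have ind: "distr M ?S P \<Otimes>\<^sub>M distr M cadlag_space F = distr M (?S \<Otimes>\<^sub>M cadlag_space) (\<lambda>\<omega>. (P \<omega>, F \<omega>))"
    using indep_var_of_past_and_future[OF measurable_ident, of 0]
    unfolding indep_var_distribution_eq P_def F_def id_def by blast
  have F_law: "distr M cadlag_space F = path_law" unfolding F_def by (rule distr_shift)
  interpret PL: prob_space path_law using levy_law_path_law by (rule levy_law.axioms(1))
  have id: "(\<lambda>f. f) \<in> path_law \<rightarrow>\<^sub>M cadlag_space" by (rule measurable_ident_sets) (simp add: path_law_def)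
  have past: "real_of_ereal (I_minus \<alpha> (\<lambda>t. X t \<omega>)) = h (P \<omega>)" if "\<omega> \<in> space M" for \<omega>
    unfolding h_def P_def I_minus_rational[OF two_sided_cadlag_process_X that]
    using X_zero[OF that] by (intro arg_cong[where f=real_of_ereal] INF_cong) auto
  have future: "half_line_path X \<omega> = F \<omega>" if "\<omega> \<in> space M" for \<omega>
    using X_zero[OF that] by (simp add: half_line_path_def F_def)
  have "distr M borel (\<lambda>\<omega>. real_of_ereal (I_minus \<alpha> (\<lambda>t. X t \<omega>))) \<Otimes>\<^sub>M path_law =
      distr (distr M ?S P) borel h \<Otimes>\<^sub>M distr path_law cadlag_space (\<lambda>f. f)"
  proof (rule arg_cong2[where f=pair_measure])
    show "distr M borel (\<lambda>\<omega>. real_of_ereal (I_minus \<alpha> (\<lambda>t. X t \<omega>))) = distr (distr M ?S P) borel h"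
      unfolding distr_distr[OF h P] by (rule distr_cong) (simp_all add: past)
    show "path_law = distr path_law cadlag_space (\<lambda>f. f)"
      by (rule distr_id2[symmetric]) (simp add: path_law_def)
  qed
  also have "\<dots> = distr (distr M ?S P \<Otimes>\<^sub>M path_law) (borel \<Otimes>\<^sub>M cadlag_space) (\<lambda>(x, y). (h x, y))"
    by (rule pair_measure_distr) (use h id distr_id2[of cadlag_space path_law] PL.sigma_finite_measure_axioms in \<open>auto simp: path_law_def\<close>)
  also have "\<dots> = distr M (borel \<Otimes>\<^sub>M cadlag_space) (\<lambda>\<omega>. (h (P \<omega>), F \<omega>))"
  proof -
    have "(\<lambda>(x, y). (h x, y)) \<in> ?S \<Otimes>\<^sub>M cadlag_space \<rightarrow>\<^sub>M borel \<Otimes>\<^sub>M cadlag_space" using h by measurable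
    then show ?thesis
      unfolding F_law[symmetric] ind by (subst distr_distr[OF _ measurable_Pair[OF P F]]) (simp_all add: comp_def)
  qed
  also have "\<dots> = distr M (borel \<Otimes>\<^sub>M cadlag_space) (\<lambda>\<omega>. (real_of_ereal (I_minus \<alpha> (\<lambda>t. X t \<omega>)), half_line_path X \<omega>))"
    by (rule distr_cong) (simp_all only: past future)
  finally show ?thesis .
qed

lemma AE_path_law: "(AE f in path_law. P f) \<Longrightarrow> AE \<omega> in M. P (half_line_path X \<omega>)"
  unfolding path_law_def by (rule AE_distrD[OF measurable_half_line_X])

lemma path_law_mean:
  "integrable path_law (\<lambda>f. f 1) \<longleftrightarrow> integrable M (X 1)" "(\<integral>f. f 1 \<partial>path_law) = (\<integral>\<omega>. X 1 \<omega> \<partial>M)"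
proof -
  have m: "(\<lambda>f. f 1) \<in> borel_measurable cadlag_space"
    by (rule cadlag_processD(1)[OF cadlag_process_coordinate]) simp
  show "integrable path_law (\<lambda>f. f 1) \<longleftrightarrow> integrable M (X 1)"
    unfolding path_law_def by (subst integrable_distr_eq[OF measurable_half_line_X m]) (simp add: half_line_path_def)
  show "(\<integral>f. f 1 \<partial>path_law) = (\<integral>\<omega>. X 1 \<omega> \<partial>M)"
    unfolding path_law_def by (subst integral_distr[OF measurable_half_line_X m]) (simp add: half_line_path_def)
qed

text \<open>For a fixed level this is known; independence of the level and the path allows it to be integrated over
the law of the level.\<close>

lemma AE_jump_gauge_I_minus:
  "AE \<omega> in M. jump_gauge \<alpha> (real_of_ereal (I_minus \<alpha> (\<lambda>t. X t \<omega>))) (half_line_path X \<omega>) = 0"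
proof -
  let ?J = "\<lambda>\<omega>. real_of_ereal (I_minus \<alpha> (\<lambda>t. X t \<omega>))"
  interpret W: levy_law path_law by (rule levy_law_path_law)
  have J: "?J \<in> borel_measurable M" using measurable_I_minus(1)[OF two_sided_cadlag_process_X, where \<alpha>=\<alpha>] by simp
  note law = I_minus_independent_of_half_line[of \<alpha>]
  interpret J: prob_space "distr M borel ?J" by (rule prob_space_distr[OF J])
  interpret P: pair_sigma_finite "distr M borel ?J" path_law ..
  let ?N = "borel \<Otimes>\<^sub>M cadlag_space :: (real \<times> (real \<Rightarrow> real)) measure"
  have "cadlag_process ?N (\<lambda>t p. snd p t)" by (intro cadlag_process_compose) measurable
  from measurable_jump_gauge[OF this, of fst \<alpha>]
  have g: "(\<lambda>p. jump_gauge \<alpha> (fst p) (snd p)) \<in> borel_measurable ?N" by simp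
  have "AE p in distr M borel ?J \<Otimes>\<^sub>M path_law. jump_gauge \<alpha> (fst p) (snd p) = 0"
  proof (rule P.AE_pair_measure)
    have "(\<lambda>p. jump_gauge \<alpha> (fst p) (snd p)) \<in> borel_measurable (distr M borel ?J \<Otimes>\<^sub>M path_law)"
      using g unfolding law by simp
    then show "{p \<in> space (distr M borel ?J \<Otimes>\<^sub>M path_law). jump_gauge \<alpha> (fst p) (snd p) = 0} \<in> sets (distr M borel ?J \<Otimes>\<^sub>M path_law)"
      by measurable
    show "AE x in distr M borel ?J. AE f in path_law. jump_gauge \<alpha> (fst (x, f)) (snd (x, f)) = 0"
      using W.AE_jump_gauge by simp
  qed
  then have "AE p in distr M ?N (\<lambda>\<omega>. (?J \<omega>, half_line_path X \<omega>)). jump_gauge \<alpha> (fst p) (snd p) = 0"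
    unfolding law .
  from AE_distrD[OF measurable_Pair[OF J measurable_half_line_X] this] show ?thesis by simp
qed

lemma AE_killed_path_eq_Z_map:
  assumes \<alpha>: "0 < \<alpha>" and int: "integrable M (X 1)" and drift: "\<bar>\<integral>\<omega>. X 1 \<omega> \<partial>M\<bar> < \<alpha>"
    and fin: "AE \<omega> in M. \<bar>I_minus \<alpha> (\<lambda>t. X t \<omega>)\<bar> \<noteq> \<infinity>"
  shows "AE \<omega> in M. half_line_path (\<lambda>t \<omega>. killed_after (D_time \<alpha> (\<lambda>s. X s \<omega>)) (\<lambda>s. X s \<omega>) t) \<omega> =
    (let \<gamma> = real_of_ereal (I_minus \<alpha> (\<lambda>t. X t \<omega>)); f = half_line_path X \<omega> in
      Z_map \<alpha> (\<gamma>, f, shift_path (real_of_ereal (T_hit \<alpha> f \<gamma>)) f))"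
proof -
  interpret W: levy_law path_law by (rule levy_law_path_law)
  note mean = path_law_mean
  define \<mu> where "\<mu> = (\<integral>f. f 1 \<partial>path_law)"
  have \<mu>: "- \<alpha> < \<mu>" "\<mu> < \<alpha>" using drift by (simp_all add: \<mu>_def mean abs_less_iff)
  define \<beta> where "\<beta> = (\<alpha> - \<mu>) / 2"
  have \<beta>: "\<beta> < \<alpha>" "0 < \<mu> + \<beta>" using \<mu> by (simp_all add: \<beta>_def field_simps)
  have int': "integrable path_law (\<lambda>f. f 1)" using int mean by simp
  from AE_path_law[OF W.AE_T_hit_finite[OF int' \<mu>(2)[unfolded \<mu>_def]]] AE_path_law[OF W.AE_bounded_below_line[OF int' \<beta>(2)[unfolded \<mu>_def]]]
    AE_jump_gauge_I_minus[of \<alpha>] AE_left_limit_at_zero AE_zero_contact_imp_D_time_zero[OF less_imp_le[OF \<alpha>]] fin AE_space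
  show ?thesis
  proof eventually_elim
    case (elim \<omega>)
    let ?f = "\<lambda>t. X t \<omega>"
    define \<gamma> where "\<gamma> = real_of_ereal (I_minus \<alpha> ?f)"
    have I: "I_minus \<alpha> ?f = ereal \<gamma>" unfolding \<gamma>_def using elim(6) by (simp add: ereal_real')
    have half: "half_line_path X \<omega> = restrict ?f {0..}" by (simp add: half_line_path_def)
    obtain c :: nat where c: "\<And>t. 0 \<le> t \<Longrightarrow> - real c \<le> X t \<omega> + \<beta> * t"
      using elim(2) by (auto simp: half)
    have "(\<lambda>t\<in>{0..}. killed_after (D_time \<alpha> ?f) ?f t) = Z_map \<alpha> (\<gamma>, ?f, shift_path (real_of_ereal (T_hit \<alpha> ?f \<gamma>)) ?f)"
    proof (rule killed_path_eq_Z_map[where \<beta>=\<beta> and c="real c"])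
      show "cadlag_on UNIV ?f" "?f 0 = 0" using cadlag_X X_zero elim(7) by auto
      show "T_hit \<alpha> ?f \<gamma> < \<infinity>" using elim(1) by (simp only: half T_hit_restrict)
      show "jump_gauge \<alpha> \<gamma> ?f = 0" using elim(3) by (simp only: half jump_gauge_restrict \<gamma>_def)
    qed (use elim(4,5) \<alpha> \<beta>(1) I c in \<open>simp_all only:\<close>)
    moreover have "shift_path (real_of_ereal (T_hit \<alpha> ?f \<gamma>)) (restrict ?f {0..}) = shift_path (real_of_ereal (T_hit \<alpha> ?f \<gamma>)) ?f"
      by (intro shift_path_restrict real_of_ereal_pos T_hit_nonneg)
    moreover have "Z_map \<alpha> (\<gamma>, restrict ?f {0..}, shift_path b ?f) = Z_map \<alpha> (\<gamma>, ?f, shift_path b ?f)" for b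
      using Z_map_restrict[of \<alpha> \<gamma> ?f "shift_path b ?f"] by (simp add: shift_path_def restrict_restrict)
    ultimately show ?case
      by (simp only: half_line_path_def Let_def \<gamma>_def[symmetric] T_hit_restrict)
  qed
qed

lemma measurable_killed_path:
  assumes "0 \<le> \<alpha>"
  shows "half_line_path (\<lambda>t \<omega>. killed_after (D_time \<alpha> (\<lambda>s. X s \<omega>)) (\<lambda>s. X s \<omega>) t) \<in> M \<rightarrow>\<^sub>M killed_path_space"
  unfolding half_line_path_def killed_after_def
proof (rule measurable_restrict, rule measurable_killed)
  note [measurable] = measurable_D_time[OF two_sided_cadlag_process_X assms]
  show "Measurable.pred M (\<lambda>\<omega>. ereal t \<le> D_time \<alpha> (\<lambda>s. X s \<omega>))" for t by measurable
qed (rule random_variable_X)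

end

lemma Int_stable_vimage: "Int_stable {Z -` A \<inter> \<Omega> |A. A \<in> sets S}"
proof (rule Int_stableI, safe)
  fix A B assume "A \<in> sets S" "B \<in> sets S"
  then show "\<exists>C. Z -` A \<inter> \<Omega> \<inter> (Z -` B \<inter> \<Omega>) = Z -` C \<inter> \<Omega> \<and> C \<in> sets S"
    by (intro exI[of _ "A \<inter> B"]) auto
qed

text \<open>The events generated by the second and the third object generate a sigma-algebra that is independent of
the first object, by the grouping property of independent families.\<close>

lemma (in prob_space) indep_triple_law:
  assumes G: "G \<in> borel_measurable M" and Y: "half_line_path Y \<in> M \<rightarrow>\<^sub>M cadlag_space"
    and Y': "half_line_path Y' \<in> M \<rightarrow>\<^sub>M cadlag_space" and ind: "indep_triple M G Y Y'"
  shows "distr M (borel \<Otimes>\<^sub>M (cadlag_space \<Otimes>\<^sub>M cadlag_space)) (\<lambda>\<omega>. (G \<omega>, half_line_path Y \<omega>, half_line_path Y' \<omega>)) =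
    distr M borel G \<Otimes>\<^sub>M (distr M cadlag_space (half_line_path Y) \<Otimes>\<^sub>M distr M cadlag_space (half_line_path Y'))"
proof -
  define E where "E i = (if i = 0 then generated_events M borel G
                 else if i = 1 then generated_events M path_space (half_line_path Y)
                 else generated_events M path_space (half_line_path Y'))" for i :: nat
  have E: "indep_sets E {0, 1, 2}" using ind unfolding indep_triple_def E_def .
  have E0: "E 0 = {G -` A \<inter> space M |A. A \<in> sets borel}" by (simp add: E_def generated_events_def)
  have E1: "E 1 = {half_line_path Y -` A \<inter> space M |A. A \<in> sets cadlag_space}"
    by (simp add: E_def generated_events_def vimage_cadlag_space[OF Y])
  have E2: "E 2 = {half_line_path Y' -` A \<inter> space M |A. A \<in> sets cadlag_space}"
    by (simp add: E_def generated_events_def vimage_cadlag_space[OF Y'])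
  have E_stable: "Int_stable (E i)" if "i \<in> {0, 1, 2}" for i
  proof -
    have "Int_stable (E 0)" "Int_stable (E 1)" "Int_stable (E 2)"
      unfolding E0 E1 E2 by (rule Int_stable_vimage)+
    then show ?thesis using that by auto
  qed
  have E_events: "E i \<subseteq> events" if "i \<in> {0, 1, 2}" for i using E that unfolding indep_sets_def by blast
  have "indep_set (E 1) (E 2)"
    unfolding indep_sets2_eq
  proof (intro conjI ballI)
    fix a b assume ab: "a \<in> E 1" "b \<in> E 2"
    have "prob (\<Inter>j\<in>{1, 2}. if j = (1::nat) then a else b) = (\<Prod>j\<in>{1, 2}. prob (if j = (1::nat) then a else b))"
      by (rule indep_setsD[OF E]) (use ab in auto)
    then show "prob (a \<inter> b) = prob a * prob b" by (simp add: Int_commute)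
  qed (use E_events in auto)
  from indep_set_sigma_sets[OF this] E_stable
  have "indep_set (sigma_sets (space M) (E 1)) (sigma_sets (space M) (E 2))" by simp
  then have "indep_var cadlag_space (half_line_path Y) cadlag_space (half_line_path Y')"
    unfolding indep_var_eq E1 E2 using Y Y' by simp
  then have pair: "distr M cadlag_space (half_line_path Y) \<Otimes>\<^sub>M distr M cadlag_space (half_line_path Y') =
      distr M (cadlag_space \<Otimes>\<^sub>M cadlag_space) (\<lambda>\<omega>. (half_line_path Y \<omega>, half_line_path Y' \<omega>))"
    unfolding indep_var_distribution_eq by blast
  define I where "I b = (if b then {0} else {1, 2::nat})" for b
  have "indep_sets (\<lambda>b. sigma_sets (space M) (\<Union>i\<in>I b. E i)) UNIV"
  proof (rule indep_sets_collect_sigma)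
    show "indep_sets E (\<Union>b\<in>UNIV. I b)" using E by (simp add: I_def UNIV_bool insert_commute)
    show "disjoint_family_on I UNIV" by (auto simp: disjoint_family_on_def I_def)
  qed (use E_stable in \<open>auto simp: I_def split: if_splits\<close>)
  then have coll: "indep_set (sigma_sets (space M) (E 0)) (sigma_sets (space M) (E 1 \<union> E 2))"
    unfolding indep_set_def by (rule indep_sets_cong[THEN iffD1, rotated 2]) (auto simp: I_def split: bool.split)
  define F where "F = sigma (space M) (E 1 \<union> E 2)"
  have EP: "E 1 \<union> E 2 \<subseteq> Pow (space M)" using E_events sets.space_closed by blast
  have F: "sets F = sigma_sets (space M) (E 1 \<union> E 2)" "space F = space M"
    using EP by (simp_all add: F_def)
  have mem: "(\<lambda>\<omega>. (half_line_path Y \<omega>, half_line_path Y' \<omega>)) \<in> F \<rightarrow>\<^sub>M cadlag_space \<Otimes>\<^sub>M cadlag_space"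
  proof (rule measurable_Pair)
    show "half_line_path Y \<in> F \<rightarrow>\<^sub>M cadlag_space"
      by (rule measurableI) (use measurable_space[OF Y] F E1 in auto)
    show "half_line_path Y' \<in> F \<rightarrow>\<^sub>M cadlag_space"
      by (rule measurableI) (use measurable_space[OF Y'] F E2 in auto)
  qed
  let ?P = "\<lambda>\<omega>. (half_line_path Y \<omega>, half_line_path Y' \<omega>)"
  have P: "?P \<in> M \<rightarrow>\<^sub>M cadlag_space \<Otimes>\<^sub>M cadlag_space" using Y Y' by (rule measurable_Pair)
  show ?thesis
    unfolding pair
  proof (rule pair_measure_eqI[symmetric])
    interpret D1: prob_space "distr M borel G" by (rule prob_space_distr[OF G])
    interpret D2: prob_space "distr M (cadlag_space \<Otimes>\<^sub>M cadlag_space) ?P" by (rule prob_space_distr[OF P])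
    show "sigma_finite_measure (distr M borel G)" "sigma_finite_measure (distr M (cadlag_space \<Otimes>\<^sub>M cadlag_space) ?P)"
      by unfold_locales
    fix A B assume "A \<in> sets (distr M borel G)" "B \<in> sets (distr M (cadlag_space \<Otimes>\<^sub>M cadlag_space) ?P)"
    then have A: "A \<in> sets borel" and B: "B \<in> sets (cadlag_space \<Otimes>\<^sub>M cadlag_space)" by simp_all
    have "G -` A \<inter> space M \<in> sigma_sets (space M) (E 0)" unfolding E0 using A by (intro sigma_sets.Basic) blast
    moreover have "?P -` B \<inter> space M \<in> sigma_sets (space M) (E 1 \<union> E 2)" using measurable_sets[OF mem B] by (simp add: F)
    ultimately have "prob ((G -` A \<inter> space M) \<inter> (?P -` B \<inter> space M)) = prob (G -` A \<inter> space M) * prob (?P -` B \<inter> space M)"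
      using coll unfolding indep_sets2_eq by blast
    moreover have "(\<lambda>\<omega>. (G \<omega>, half_line_path Y \<omega>, half_line_path Y' \<omega>)) -` (A \<times> B) \<inter> space M =
        (G -` A \<inter> space M) \<inter> (?P -` B \<inter> space M)" by auto
    ultimately show "emeasure (distr M borel G) A * emeasure (distr M (cadlag_space \<Otimes>\<^sub>M cadlag_space) ?P) B =
        emeasure (distr M (borel \<Otimes>\<^sub>M (cadlag_space \<Otimes>\<^sub>M cadlag_space)) (\<lambda>\<omega>. (G \<omega>, half_line_path Y \<omega>, half_line_path Y' \<omega>))) (A \<times> B)"
      using A B by (simp add: emeasure_distr[OF G] emeasure_distr[OF P] emeasure_distr[OF measurable_Pair[OF G P]]
        emeasure_eq_measure ennreal_mult[symmetric])
  qed (simp cong: sets_pair_measure_cong)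
qed

theorem proposition4p1:
  fixes \<alpha> :: real
    and M :: "'a measure" and X :: "real \<Rightarrow> 'a \<Rightarrow> real"
    and N :: "'b measure" and \<Gamma> :: "'b \<Rightarrow> real" and X' X'' :: "real \<Rightarrow> 'b \<Rightarrow> real"
  assumes "\<alpha> > 0"
    and "two_sided_levy M X"
    and "\<not> linear_drift M X"
    and "integrable M (X 1)"
    and "\<bar>integral\<^sup>L M (X 1)\<bar> < \<alpha>"
    and "prob_space N"
    and "same_law borel N (\<lambda>\<omega>. ereal (\<Gamma> \<omega>)) M (\<lambda>\<omega>. I_minus \<alpha> (\<lambda>t. X t \<omega>))"
    and "half_line_copy N X' M X"
    and "half_line_copy N X'' M X"
    and "indep_triple N \<Gamma> X' X''"
  shows "same_law killed_path_space
     M (half_line_path (\<lambda>t \<omega>. killed_after (D_time \<alpha> (\<lambda>s. X s \<omega>)) (\<lambda>s. X s \<omega>) t))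
     N (half_line_path (\<lambda>t \<omega>. Z_path \<alpha> (\<Gamma> \<omega>) (\<lambda>s. X' s \<omega>) (\<lambda>s. X'' s \<omega>) t))"
proof -
  interpret L: two_sided_levy M X by fact
  interpret N: prob_space N by fact
  define W where "W = L.path_law"
  interpret W: levy_law W unfolding W_def by (rule L.levy_law_path_law)
  let ?C = "cadlag_space" and ?K = "killed_path_space"
  let ?J = "\<lambda>\<omega>. real_of_ereal (I_minus \<alpha> (\<lambda>t. X t \<omega>))"
  define \<nu> where "\<nu> = distr M borel ?J"
  have \<Gamma>e: "(\<lambda>\<omega>. ereal (\<Gamma> \<omega>)) \<in> borel_measurable N" and I: "(\<lambda>\<omega>. I_minus \<alpha> (\<lambda>t. X t \<omega>)) \<in> borel_measurable M"
    and \<Gamma>I: "distr N borel (\<lambda>\<omega>. ereal (\<Gamma> \<omega>)) = distr M borel (\<lambda>\<omega>. I_minus \<alpha> (\<lambda>t. X t \<omega>))"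
    using assms(7) unfolding same_law_def by auto
  have \<Gamma>: "\<Gamma> \<in> borel_measurable N" using borel_measurable_real_of_ereal[OF \<Gamma>e] by simp
  have "distr N borel \<Gamma> = distr (distr N borel (\<lambda>\<omega>. ereal (\<Gamma> \<omega>))) borel real_of_ereal"
    using \<Gamma>e by (subst distr_distr) (auto simp: comp_def)
  also have "\<dots> = \<nu>"
    unfolding \<Gamma>I \<nu>_def using I by (subst distr_distr) (auto simp: comp_def)
  finally have \<nu>: "distr N borel \<Gamma> = \<nu>" .
  \<comment> \<open>\<open>\<Gamma>\<close> is real, so \<open>I\<^sup>-\<close> is almost surely finite\<close>
  have "AE x in distr N borel (\<lambda>\<omega>. ereal (\<Gamma> \<omega>)). \<bar>x\<bar> \<noteq> \<infinity>"
    by (subst AE_distr_iff[OF \<Gamma>e]) auto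
  then have fin: "AE \<omega> in M. \<bar>I_minus \<alpha> (\<lambda>t. X t \<omega>)\<bar> \<noteq> \<infinity>" unfolding \<Gamma>I by (rule AE_distrD[OF I])
  have copy: "cadlag_process N Y \<and> distr N ?C (half_line_path Y) = W" if "half_line_copy N Y M X" for Y
  proof -
    have c: "\<forall>\<omega>\<in>space N. cadlag_on {0..} (\<lambda>t. Y t \<omega>)" and m: "half_line_path Y \<in> N \<rightarrow>\<^sub>M path_space"
      and eq: "distr N path_space (half_line_path Y) = distr M path_space (half_line_path X)"
      using that unfolding half_line_copy_def same_law_def by auto
    have Y: "cadlag_process N Y"
      unfolding cadlag_process_def
    proof (intro conjI allI impI)
      fix t :: real assume t: "0 \<le> t"
      have "(\<lambda>f. f t) \<in> path_space \<rightarrow>\<^sub>M borel" using t by (intro measurable_component_singleton) auto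
      from measurable_compose[OF m this] show "Y t \<in> borel_measurable N" using t by (simp add: half_line_path_def)
    qed (rule c)
    then show ?thesis
      using distr_cadlag_space_eqI[OF measurable_cadlag_spaceI[OF Y] L.measurable_half_line_X eq]
      by (simp add: W_def L.path_law_def)
  qed
  have X': "cadlag_process N X'" "distr N ?C (half_line_path X') = W" using copy[OF assms(8)] by auto
  have X'': "cadlag_process N X''" "distr N ?C (half_line_path X'') = W" using copy[OF assms(9)] by auto
  note mX' = measurable_cadlag_spaceI[OF X'(1)] and mX'' = measurable_cadlag_spaceI[OF X''(1)]
  define Z where "Z = half_line_path (\<lambda>t \<omega>. Z_path \<alpha> (\<Gamma> \<omega>) (\<lambda>s. X' s \<omega>) (\<lambda>s. X'' s \<omega>) t)"
  define U where "U = half_line_path (\<lambda>t \<omega>. killed_after (D_time \<alpha> (\<lambda>s. X s \<omega>)) (\<lambda>s. X s \<omega>) t)"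
  have Z: "Z \<in> N \<rightarrow>\<^sub>M ?K" unfolding Z_def by (rule measurable_Z_path[OF X'(1) X''(1) \<Gamma>])
  have U: "U \<in> M \<rightarrow>\<^sub>M ?K" unfolding U_def using assms(1) by (intro L.measurable_killed_path) simp
  have J: "?J \<in> borel_measurable M" using I by simp
  interpret \<nu>: prob_space \<nu> unfolding \<nu>_def by (rule L.prob_space_distr[OF J])
  have "Z = Z_map \<alpha> \<circ> (\<lambda>\<omega>. (\<Gamma> \<omega>, half_line_path X' \<omega>, half_line_path X'' \<omega>))"
    unfolding Z_def half_line_path_def comp_def Z_map_restrict by (simp add: Z_map_def)
  then have "distr N ?K Z = distr (distr N (borel \<Otimes>\<^sub>M (?C \<Otimes>\<^sub>M ?C)) (\<lambda>\<omega>. (\<Gamma> \<omega>, half_line_path X' \<omega>, half_line_path X'' \<omega>))) ?K (Z_map \<alpha>)"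
    by (subst distr_distr[OF measurable_Z_map]) (auto intro!: measurable_Pair \<Gamma> mX' mX'')
  also have "\<dots> = distr (\<nu> \<Otimes>\<^sub>M (W \<Otimes>\<^sub>M W)) ?K (Z_map \<alpha>)"
    unfolding N.indep_triple_law[OF \<Gamma> mX' mX'' assms(10)] \<nu> X'(2) X''(2) ..
  finally have law_Z: "distr N ?K Z = distr (\<nu> \<Otimes>\<^sub>M (W \<Otimes>\<^sub>M W)) ?K (Z_map \<alpha>)" .
  \<comment> \<open>the path killed at \<open>D\<close>, as a functional of the level and the half-line path\<close>
  define R where "R = (\<lambda>(\<gamma>, f). Z_map \<alpha> (\<gamma>, f, shift_path (real_of_ereal (T_hit \<alpha> f \<gamma>)) f))"
  let ?N = "borel \<Otimes>\<^sub>M ?C :: (real \<times> (real \<Rightarrow> real)) measure"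
  have R: "R \<in> ?N \<rightarrow>\<^sub>M ?K"
  proof -
    have snd: "snd \<in> ?N \<rightarrow>\<^sub>M ?C" by measurable
    have T[measurable]: "(\<lambda>p. T_hit \<alpha> (snd p) (fst p)) \<in> borel_measurable ?N"
      using measurable_T_hit[OF cadlag_process_compose[OF snd], of fst \<alpha>] by simp
    have "(\<lambda>p. shift_path (real_of_ereal (T_hit \<alpha> (snd p) (fst p))) (snd p)) \<in> ?N \<rightarrow>\<^sub>M ?C"
      by (rule measurable_shift_path) (auto simp: T_hit_nonneg real_of_ereal_pos)
    then have "(\<lambda>p. Z_map \<alpha> (fst p, snd p, shift_path (real_of_ereal (T_hit \<alpha> (snd p) (fst p))) (snd p))) \<in> ?N \<rightarrow>\<^sub>M ?K"
      by (intro measurable_compose[OF _ measurable_Z_map] measurable_Pair) auto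
    then show ?thesis by (simp add: R_def case_prod_beta')
  qed
  have mJX: "(\<lambda>\<omega>. (?J \<omega>, half_line_path X \<omega>)) \<in> M \<rightarrow>\<^sub>M ?N" by (rule measurable_Pair[OF J L.measurable_half_line_X])
  have "distr M ?K U = distr M ?K (\<lambda>\<omega>. R (?J \<omega>, half_line_path X \<omega>))"
  proof (rule distr_cong_AE)
    show "AE \<omega> in M. U \<omega> = R (?J \<omega>, half_line_path X \<omega>)"
      unfolding U_def R_def case_prod_conv
      using L.AE_killed_path_eq_Z_map[OF assms(1,4,5) fin] unfolding Let_def .
    show "(\<lambda>\<omega>. R (?J \<omega>, half_line_path X \<omega>)) \<in> M \<rightarrow>\<^sub>M ?K" by (rule measurable_compose[OF mJX R])
  qed (use U in auto)
  also have "\<dots> = distr (distr M ?N (\<lambda>\<omega>. (?J \<omega>, half_line_path X \<omega>))) ?K R"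
    by (subst distr_distr[OF R mJX]) (simp add: comp_def)
  also have "distr M ?N (\<lambda>\<omega>. (?J \<omega>, half_line_path X \<omega>)) = \<nu> \<Otimes>\<^sub>M W"
    unfolding \<nu>_def W_def by (rule L.I_minus_independent_of_half_line[symmetric])
  finally have law_U: "distr M ?K U = distr (\<nu> \<Otimes>\<^sub>M W) ?K R" .
  have sets1: "sets (\<nu> \<Otimes>\<^sub>M W) = sets ?N" by (rule sets_pair_measure_cong) (simp_all add: \<nu>_def W.sets_W)
  have sets2: "sets (W \<Otimes>\<^sub>M W) = sets (?C \<Otimes>\<^sub>M ?C)" by (rule sets_pair_measure_cong) (simp_all add: W.sets_W)
  have sets3: "sets (\<nu> \<Otimes>\<^sub>M (W \<Otimes>\<^sub>M W)) = sets (borel \<Otimes>\<^sub>M (?C \<Otimes>\<^sub>M ?C))"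
    by (rule sets_pair_measure_cong) (simp_all add: \<nu>_def sets2)
  interpret WW: pair_prob_space W W ..
  have mean: "integrable W (\<lambda>f. f 1)" "(\<integral>f. f 1 \<partial>W) < \<alpha>" using assms(4,5) L.path_law_mean by (simp_all add: W_def)
  have T_fin: "AE f in W. T_hit \<alpha> f \<gamma> < \<infinity>" for \<gamma>
    using W.AE_T_hit_finite[OF mean] by eventually_elim simp
  \<comment> \<open>after disintegration over the level, both sides agree level by level\<close>
  have "distr (\<nu> \<Otimes>\<^sub>M W) ?K R = distr (\<nu> \<Otimes>\<^sub>M (W \<Otimes>\<^sub>M W)) ?K (Z_map \<alpha>)"
  proof (rule measure_eqI)
    fix A assume "A \<in> sets (distr (\<nu> \<Otimes>\<^sub>M W) ?K R)"
    then have A: "A \<in> sets ?K" by simp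
    have R': "R \<in> \<nu> \<Otimes>\<^sub>M W \<rightarrow>\<^sub>M ?K" using R by (simp only: measurable_cong_sets[OF sets1 refl])
    have Zm: "Z_map \<alpha> \<in> \<nu> \<Otimes>\<^sub>M (W \<Otimes>\<^sub>M W) \<rightarrow>\<^sub>M ?K" using measurable_Z_map by (simp only: measurable_cong_sets[OF sets3 refl])
    have iA: "indicator A \<in> ?K \<rightarrow>\<^sub>M (borel :: ennreal measure)" using A by simp
    have "emeasure (distr (\<nu> \<Otimes>\<^sub>M W) ?K R) A = (\<integral>\<^sup>+p. indicator A (R p) \<partial>(\<nu> \<Otimes>\<^sub>M W))"
      using nn_integral_distr[OF R', of "indicator A"] A by simp
    also have "\<dots> = (\<integral>\<^sup>+\<gamma>. \<integral>\<^sup>+f. indicator A (R (\<gamma>, f)) \<partial>W \<partial>\<nu>)"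
      by (rule W.nn_integral_fst[symmetric]) (rule measurable_compose[OF R' iA])
    also have "\<dots> = (\<integral>\<^sup>+\<gamma>. \<integral>\<^sup>+p. indicator A (Z_map \<alpha> (\<gamma>, p)) \<partial>(W \<Otimes>\<^sub>M W) \<partial>\<nu>)"
      using W.nn_integral_Z_map_strong_markov[OF T_fin A] by (simp add: R_def)
    also have "\<dots> = (\<integral>\<^sup>+p. indicator A (Z_map \<alpha> p) \<partial>(\<nu> \<Otimes>\<^sub>M (W \<Otimes>\<^sub>M W)))"
      by (rule WW.nn_integral_fst) (rule measurable_compose[OF Zm iA])
    also have "\<dots> = emeasure (distr (\<nu> \<Otimes>\<^sub>M (W \<Otimes>\<^sub>M W)) ?K (Z_map \<alpha>)) A"
      using nn_integral_distr[OF Zm, of "indicator A"] A by simp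
    finally show "emeasure (distr (\<nu> \<Otimes>\<^sub>M W) ?K R) A = emeasure (distr (\<nu> \<Otimes>\<^sub>M (W \<Otimes>\<^sub>M W)) ?K (Z_map \<alpha>)) A" .
  qed simp
  then show ?thesis
    unfolding same_law_def using U Z law_U law_Z by (simp add: U_def Z_def)
qed

end
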